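(* Let $f\in\mathcal{U}^2$, i.e. let $f:[0,1]\to[0,1]$ be a $C^2$ unimodal map with critical point $c\in(0,1)$ and left and right critical orders $\ell_-,\ell_+\ge 1$ (not assumed to be equal). Then $f$ has no wandering interval.
   Context: For $r\ge 1$, a map $f:[0,1]\to[0,1]$ is called $C^r$ unimodal if: (i) there exists $c\in(0,1)$ such that $f$ is $C^r$ and $f'\neq 0$ on $[0,1]\setminus\{c\}$; (ii) there exist real numbers $\ell_-,\ell_+\ge 1$, a neighborhood $U$ of $c$, and $C^r$ diffeomorphisms $\phi_-,\phi_+,\varphi_-,\varphi_+$ of $\mathbb{R}$ with $\phi_\pm(c)=\varphi_\pm(f(c))=0$ such that $|\varphi_-(f(x))|=|\phi_-(x)|^{\ell_-}$ for every $x\in U$ with $x\le c$, and $|\varphi_+(f(x))|=|\phi_+(x)|^{\ell_+}$ for every $x\in U$ with $x\ge c$. $\mathcal{U}^r$ denotes the collection of $C^r$ unimodal maps. A wandering interval of $f$ is a (nondegenerate) interval $J\subset[0,1]$ such that the intervals $J,f(J),f^2(J),\dots$ are pairwise disjoint, and for each $x\in J$ the omega-limit set $\omega(x)$ is not a periodic orbit. *)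

theory Defs
  imports "HOL-Analysis.Analysis"
begin

text \<open>
  Maps of the unit interval are total functions on the reals of which only the values on \<open>{0..1}\<close>
  matter; every notion below depends only on those values. Derivatives at points of a set \<open>S\<close> are
  taken within \<open>S\<close>, hence are one-sided at the endpoints of an interval.
\<close>

primrec Cr_on :: "nat \<Rightarrow> (real \<Rightarrow> real) \<Rightarrow> real set \<Rightarrow> bool" where
  "Cr_on 0 f S \<longleftrightarrow> continuous_on S f"
| "Cr_on (Suc r) f S \<longleftrightarrow>
     (\<exists>f'. (\<forall>x\<in>S. (f has_real_derivative f' x) (at x within S)) \<and> Cr_on r f' S)"

definition Cr_diffeo :: "nat \<Rightarrow> (real \<Rightarrow> real) \<Rightarrow> bool" where
  "Cr_diffeo r \<phi> \<longleftrightarrow> bij \<phi> \<and> Cr_on r \<phi> UNIV \<and> Cr_on r (inv \<phi>) UNIV"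

text \<open>
  Smoothness is required only off the critical point \<open>c\<close>, as \<open>f\<close> need not be differentiable there
  (for instance when one of the critical orders is 1). Continuity at \<open>c\<close> follows from the local
  normal forms.
\<close>

definition unimodal_at ::
    "nat \<Rightarrow> (real \<Rightarrow> real) \<Rightarrow> real \<Rightarrow> real \<Rightarrow> real \<Rightarrow> bool" where
  "unimodal_at r f c l\<^sub>m l\<^sub>p \<longleftrightarrow>
     f \<in> {0..1} \<rightarrow> {0..1} \<and>
     0 < c \<and> c < 1 \<and>
     Cr_on r f ({0..1} - {c}) \<and>
     (\<forall>x\<in>{0..1} - {c}. \<exists>D. (f has_real_derivative D) (at x within {0..1} - {c}) \<and> D \<noteq> 0) \<and>
     1 \<le> l\<^sub>m \<and> 1 \<le> l\<^sub>p \<and>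
     (\<exists>U \<phi>\<^sub>m \<phi>\<^sub>p \<psi>\<^sub>m \<psi>\<^sub>p.
        open U \<and> c \<in> U \<and>
        Cr_diffeo r \<phi>\<^sub>m \<and> Cr_diffeo r \<phi>\<^sub>p \<and> Cr_diffeo r \<psi>\<^sub>m \<and> Cr_diffeo r \<psi>\<^sub>p \<and>
        \<phi>\<^sub>m c = 0 \<and> \<phi>\<^sub>p c = 0 \<and> \<psi>\<^sub>m (f c) = 0 \<and> \<psi>\<^sub>p (f c) = 0 \<and>
        (\<forall>x\<in>U \<inter> {0..1}. x \<le> c \<longrightarrow> \<bar>\<psi>\<^sub>m (f x)\<bar> = \<bar>\<phi>\<^sub>m x\<bar> powr l\<^sub>m) \<and>
        (\<forall>x\<in>U \<inter> {0..1}. c \<le> x \<longrightarrow> \<bar>\<psi>\<^sub>p (f x)\<bar> = \<bar>\<phi>\<^sub>p x\<bar> powr l\<^sub>p))"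

definition unimodal_maps :: "nat \<Rightarrow> (real \<Rightarrow> real) set" where
  "unimodal_maps r = {f. \<exists>c l\<^sub>m l\<^sub>p. unimodal_at r f c l\<^sub>m l\<^sub>p}"

definition omega_limit :: "(real \<Rightarrow> real) \<Rightarrow> real \<Rightarrow> real set" where
  "omega_limit f x = {y. \<exists>s. strict_mono s \<and> (\<lambda>k. (f ^^ s k) x) \<longlonglongrightarrow> y}"

definition periodic_orbit :: "(real \<Rightarrow> real) \<Rightarrow> real set \<Rightarrow> bool" where
  "periodic_orbit f A \<longleftrightarrow>
     (\<exists>p\<in>{0..1}. \<exists>n\<ge>1. (f ^^ n) p = p \<and> A = range (\<lambda>k. (f ^^ k) p))"

definition wandering_interval :: "(real \<Rightarrow> real) \<Rightarrow> real set \<Rightarrow> bool" where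
  "wandering_interval f J \<longleftrightarrow>
     is_interval J \<and> (\<exists>a\<in>J. \<exists>b\<in>J. a < b) \<and> J \<subseteq> {0..1} \<and>
     disjoint_family (\<lambda>n. (f ^^ n) ` J) \<and>
     (\<forall>x\<in>J. \<not> periodic_orbit f (omega_limit f x))"

end

theory Submission
  imports Defs
begin

text \<open>A wandering interval produces an interval all of whose points are wild, meaning that their orbits are
not attracted by a periodic orbit. Where an iterate maps an interval
monotonically into itself, orbits converge to periodic ones and wild points do not exist; in
particular \<open>f\<close> cannot be monotone across \<open>c\<close>; this elementary
trapping argument (\<open>mono_trap\<close>, \<open>no_trap\<close>) is used over and over. Reflecting if necessary, assume
that \<open>f\<close> has its maximum at \<open>c\<close>.

The analytic input is a cross ratio. On each side of \<open>c\<close> the normal form and the \<open>C\<^sup>2\<close> smoothness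
away from \<open>c\<close> write \<open>f c - f x\<close> as the power \<open>\<ge> 1\<close> of a map with Lipschitz, nonvanishing derivative
(\<open>side_ok_of_normal_form\<close>). Powers expand the cross ratio (\<open>cross_powr\<close>), and the inner map
contracts it by at most \<open>exp (- K * length)\<close>. Hence a branch of an iterate loses at most a constant
factor whenever the lengths of the intermediate images have bounded sum (\<open>cross_it\<close>).

Let \<open>(a, b)\<close> be a component of the complement of the closure of the precritical points containing a
wild orbit. Its images are disjoint and accumulate at \<open>c\<close> (\<open>accumulates_at_c\<close>, the argument of
Schwartz). Among the images \<open>(f ^^ k) (a, b)\<close> with \<open>k \<ge> 1\<close> call one a record if it is closer to
\<open>f c\<close> than all its predecessors, and let \<open>(u i, v i)\<close> be the \<open>i\<close>-th record. The interval from the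
previous record to the next one can be pulled back monotonically to a neighbourhood of \<open>(a, b)\<close>; the
intermediate intervals overlap at most three times (\<open>overlap_le_3\<close>), while the left end of
the domain tends to \<open>a\<close> because precritical points accumulate there. So the cross ratio of a record inside
its two neighbours tends to infinity (\<open>space_blowup\<close>), which forces \<open>f c - v i\<close> to be negligible
compared with \<open>f c - u i\<close> (\<open>records_near_top\<close>).

Finally the iterate leading from one record to the next is a diffeomorphic branch followed by one
passage through the fold. With \<open>A i = f c - v i\<close> and \<open>B i = f c - u i\<close>, the cross ratio inequality for
that branch (\<open>record_estimate\<close>) bounds \<open>A (i + 1) / B (i + 1)\<close> from above, and also bounds how far the
opposite side of the fold can stick out. If the records were infinitely often on the side of the
smaller or equal critical order, that second bound would be violated; so all late records lie on the
strictly flatter side, of order \<open>l\<close> say. Then \<open>ln (B i / A i)\<close> grows at least like \<open>l ^ i\<close> whereas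
\<open>- ln (B i)\<close>, multiplied by at most \<open>l\<close> at each step, loses a multiple of the former
infinitely often; it would become negative (\<open>growth_absurd\<close>). In particular, when the two critical
orders agree there is no flatter side and the contradiction comes one step earlier.\<close>

section \<open>Interval maps and monotone branches of their iterates\<close>

locale selfmap =
  fixes f :: "real \<Rightarrow> real"
  assumes cont: "continuous_on {0..1} f"
    and self: "\<And>x. x \<in> {0..1} \<Longrightarrow> f x \<in> {0..1}"
begin

lemma it_in: "x \<in> {0..1} \<Longrightarrow> (f ^^ n) x \<in> {0..1}"
  by (induction n) (simp_all only: funpow.simps id_apply o_apply self)

lemma it_cont: "continuous_on {0..1} (f ^^ n)"
proof (induction n)
  case (Suc n)
  have "continuous_on {0..1} (f \<circ> (f ^^ n))"
    by (rule continuous_on_compose[OF Suc]) (use it_in in \<open>auto intro!: continuous_on_subset[OF cont]\<close>)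
  then show ?case by simp
qed (simp add: continuous_on_id)

lemma it_cont_sub: "0 \<le> a \<Longrightarrow> b \<le> 1 \<Longrightarrow> continuous_on {a..b} (f ^^ n)"
  by (rule continuous_on_subset[OF it_cont]) auto

lemma it_add: "(f ^^ (m + n)) x = (f ^^ m) ((f ^^ n) x)"
  by (simp add: funpow_add)

lemma it_diff: "m \<le> n \<Longrightarrow> (f ^^ n) x = (f ^^ (n - m)) ((f ^^ m) x)"
  by (metis it_add le_add_diff_inverse2)

text \<open>The preimage is wanted strictly between \<open>x\<close> and \<open>y\<close>, whichever of the two is larger.\<close>

lemma ivt:
  assumes "x \<in> {0..1}" "y \<in> {0..1}" "(f ^^ n) x < t" "t < (f ^^ n) y"
  obtains z where "min x y < z" "z < max x y" "(f ^^ n) z = t"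
proof (cases "x \<le> y")
  case True
  have "\<exists>z. x \<le> z \<and> z \<le> y \<and> (f ^^ n) z = t"
    using assms True by (intro IVT') (auto intro!: it_cont_sub)
  then obtain z where z: "x \<le> z" "z \<le> y" "(f ^^ n) z = t" by blast
  with assms have "z \<noteq> x" "z \<noteq> y" by auto
  with z have "min x y < z" "z < max x y" by auto
  with z that show ?thesis by blast
next
  case False
  have "\<exists>z. y \<le> z \<and> z \<le> x \<and> (f ^^ n) z = t"
    using assms False by (intro IVT2') (auto intro!: it_cont_sub)
  then obtain z where z: "y \<le> z" "z \<le> x" "(f ^^ n) z = t" by blast
  with assms have "z \<noteq> x" "z \<noteq> y" by auto
  with z have "min x y < z" "z < max x y" by auto
  with z that show ?thesis by blast
qed

text \<open>Not attracted to a periodic orbit: by continuity it suffices to look at the times which are multiples of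
the period.\<close>

definition wild :: "real \<Rightarrow> bool" where
  "wild x \<longleftrightarrow> x \<in> {0..1} \<and>
     \<not> (\<exists>r\<ge>1. \<exists>p\<in>{0..1}. (f ^^ r) p = p \<and> (\<lambda>k. (f ^^ (r * k)) x) \<longlonglongrightarrow> p)"

lemma it_tendsto:
  assumes "X \<longlonglongrightarrow> p" "\<And>k. X k \<in> {0..1}" "p \<in> {0..1}"
  shows "(\<lambda>k. (f ^^ n) (X k)) \<longlonglongrightarrow> (f ^^ n) p"
  using continuous_on_tendsto_compose[OF it_cont assms(1)] assms by auto

lemma wild_it: assumes "wild x" shows "wild ((f ^^ m) x)"
proof -
  have x: "x \<in> {0..1}" using assms wild_def by auto
  have False if r: "r \<ge> 1" "p \<in> {0..1}" "(f ^^ r) p = p" "(\<lambda>k. (f ^^ (r * k)) ((f ^^ m) x)) \<longlonglongrightarrow> p" for r p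
  proof -
    define j where "j = r * m - m"
    have jm: "j + m = r * m" using r(1) by (simp add: j_def)
    have "(\<lambda>k. (f ^^ j) ((f ^^ (r * k)) ((f ^^ m) x))) \<longlonglongrightarrow> (f ^^ j) p"
      by (rule it_tendsto[OF r(4)]) (use x it_in r in auto)
    moreover have "(f ^^ j) ((f ^^ (r * k)) ((f ^^ m) x)) = (f ^^ (r * (k + m))) x" for k
    proof -
      have "r * (k + m) = j + (r * k + m)" using jm by (simp add: algebra_simps)
      then show ?thesis by (simp only: it_add)
    qed
    ultimately have "(\<lambda>k. (f ^^ (r * (k + m))) x) \<longlonglongrightarrow> (f ^^ j) p" by simp
    then have "(\<lambda>k. (f ^^ (r * k)) x) \<longlonglongrightarrow> (f ^^ j) p"
      using LIMSEQ_offset[of "\<lambda>k. (f ^^ (r * k)) x" m] by simp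
    moreover have "(f ^^ r) ((f ^^ j) p) = (f ^^ j) p" by (metis add.commute it_add r(3))
    moreover have "(f ^^ j) p \<in> {0..1}" using it_in r by blast
    ultimately show False using assms r(1) unfolding wild_def by blast
  qed
  then show ?thesis unfolding wild_def using it_in[OF x] by blast
qed

text \<open>Under a monotone self-map of an interval every orbit is a monotone sequence, so it converges, and its
limit is a fixed point.\<close>

lemma mono_trap:
  assumes r: "r \<ge> 1" and ab: "0 \<le> a" "b \<le> 1"
    and map: "\<And>x. x \<in> {a..b} \<Longrightarrow> (f ^^ r) x \<in> {a..b}"
    and mono: "\<And>x y. a \<le> x \<Longrightarrow> x \<le> y \<Longrightarrow> y \<le> b \<Longrightarrow> (f ^^ r) x \<le> (f ^^ r) y"
    and x: "x \<in> {a..b}"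
  shows "\<not> wild x"
proof -
  define X where "X k = (f ^^ (r * k)) x" for k
  have X_Suc: "X (Suc k) = (f ^^ r) (X k)" for k
    unfolding X_def by (simp add: it_add)
  have Xin: "X k \<in> {a..b}" for k
  proof (induction k)
    case 0 then show ?case using x by (simp add: X_def)
  next
    case (Suc k) then show ?case using map X_Suc by auto
  qed
  have "monoseq X"
  proof (cases "X 0 \<le> X 1")
    case True
    have "X k \<le> X (Suc k)" for k
    proof (induction k)
      case (Suc k) then show ?case using mono[of "X k" "X (Suc k)"] Xin[of k] Xin[of "Suc k"] X_Suc[of k] X_Suc[of "Suc k"] by simp
    qed (use True in simp)
    then show ?thesis by (simp add: monoseq_Suc)
  next
    case False
    have "X (Suc k) \<le> X k" for k
    proof (induction k)
      case (Suc k) then show ?case using mono[of "X (Suc k)" "X k"] Xin[of k] Xin[of "Suc k"] X_Suc[of k] X_Suc[of "Suc k"] by simp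
    qed (use False in simp)
    then show ?thesis by (simp add: monoseq_Suc)
  qed
  moreover have "Bseq X" by (rule BseqI'[of _ 1]) (use Xin ab in \<open>auto simp: abs_le_iff; smt (verit)\<close>)
  ultimately obtain p where p: "X \<longlonglongrightarrow> p" using Bseq_monoseq_convergent convergent_def by blast
  have X01: "X k \<in> {0..1}" for k using Xin[of k] ab by auto
  have p01: "p \<in> {0..1}" using p X01 closed_sequentially[of "{0..1}" X p] by auto
  have "(\<lambda>k. (f ^^ r) (X k)) \<longlonglongrightarrow> (f ^^ r) p" by (rule it_tendsto[OF p X01 p01])
  then have "(\<lambda>k. X (Suc k)) \<longlonglongrightarrow> (f ^^ r) p" by (simp add: X_Suc)
  then have "(f ^^ r) p = p" using p LIMSEQ_Suc LIMSEQ_unique by blast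
  moreover have "X = (\<lambda>k. (f ^^ (r * k)) x)" by (auto simp: X_def)
  ultimately show ?thesis unfolding wild_def using r p p01 by blast
qed

end

locale fold = selfmap f for f :: "real \<Rightarrow> real" +
  fixes c :: real
  assumes c0: "0 < c" and c1: "c < 1"
    and inc: "\<And>x y. 0 \<le> x \<Longrightarrow> x < y \<Longrightarrow> y \<le> c \<Longrightarrow> f x < f y"
    and dec: "\<And>x y. c \<le> x \<Longrightarrow> x < y \<Longrightarrow> y \<le> 1 \<Longrightarrow> f y < f x"
begin

lemma top_less: "x \<in> {0..1} \<Longrightarrow> x \<noteq> c \<Longrightarrow> f x < f c"
  using inc[of x c] dec[of c x] c0 c1 by (cases "x < c") auto

lemma top_le: "x \<in> {0..1} \<Longrightarrow> f x \<le> f c"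
  using top_less[of x] by (cases "x = c") auto

text \<open>The interior of \<open>{a..b}\<close> avoids the turning point during the first \<open>n\<close> steps: exactly what makes
\<open>f ^^ n\<close> strictly monotone there.\<close>

definition free :: "nat \<Rightarrow> real \<Rightarrow> real \<Rightarrow> bool" where
  "free n a b \<longleftrightarrow> 0 \<le> a \<and> a \<le> b \<and> b \<le> 1 \<and> (\<forall>k<n. \<forall>x. a < x \<and> x < b \<longrightarrow> (f ^^ k) x \<noteq> c)"

definition smono :: "(real \<Rightarrow> real) \<Rightarrow> real \<Rightarrow> real \<Rightarrow> bool" where
  "smono g a b \<longleftrightarrow> (\<forall>x y. a \<le> x \<and> x < y \<and> y \<le> b \<longrightarrow> g x < g y) \<or>
     (\<forall>x y. a \<le> x \<and> x < y \<and> y \<le> b \<longrightarrow> g y < g x)"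

lemma free_sub: "free n a b \<Longrightarrow> a \<le> a' \<Longrightarrow> a' \<le> b' \<Longrightarrow> b' \<le> b \<Longrightarrow> m \<le> n \<Longrightarrow> free m a' b'"
  unfolding free_def by auto

lemma free_side:
  assumes "free (Suc n) a b"
  shows "(\<forall>x\<in>{a..b}. (f ^^ n) x \<le> c) \<or> (\<forall>x\<in>{a..b}. c \<le> (f ^^ n) x)"
proof (rule ccontr)
  assume "\<not> ?thesis"
  then obtain x y where xy: "x \<in> {a..b}" "y \<in> {a..b}" "(f ^^ n) x > c" "(f ^^ n) y < c" by force
  obtain z where "min y x < z" "z < max y x" "(f ^^ n) z = c"
    using ivt[of y x n c] xy assms unfolding free_def by auto
  with xy assms show False unfolding free_def by (auto simp: min_def max_def split: if_splits)
qed

lemma free_smono: "free n a b \<Longrightarrow> smono (f ^^ n) a b"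
proof (induction n)
  case 0 then show ?case by (simp add: smono_def)
next
  case (Suc n)
  have sm: "smono (f ^^ n) a b" using Suc free_sub[of "Suc n" a b a b n] by (auto simp: free_def)
  have rng: "\<And>x. x \<in> {a..b} \<Longrightarrow> (f ^^ n) x \<in> {0..1}" using Suc.prems it_in unfolding free_def by auto
  from free_side[OF Suc.prems] show ?case
  proof
    assume s: "\<forall>x\<in>{a..b}. (f ^^ n) x \<le> c"
    have "f ((f ^^ n) x) < f ((f ^^ n) y)" if "x \<in> {a..b}" "y \<in> {a..b}" "(f ^^ n) x < (f ^^ n) y" for x y
      using inc s rng that by auto
    with sm show ?thesis unfolding smono_def by (elim disjE) auto
  next
    assume s: "\<forall>x\<in>{a..b}. c \<le> (f ^^ n) x"
    have "f ((f ^^ n) y) < f ((f ^^ n) x)" if "x \<in> {a..b}" "y \<in> {a..b}" "(f ^^ n) x < (f ^^ n) y" for x y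
      using dec s rng that by auto
    with sm show ?thesis unfolding smono_def by (elim disjE) auto
  qed
qed

text \<open>If \<open>f ^^ r\<close> is decreasing, its square is increasing, so both cases reduce to the monotone one.\<close>

lemma no_trap:
  assumes fr: "free r a b" and r: "r \<ge> 1"
    and map: "\<And>x. x \<in> {a..b} \<Longrightarrow> (f ^^ r) x \<in> {a..b}" and x: "x \<in> {a..b}" "wild x"
  shows False
proof -
  have ab: "0 \<le> a" "b \<le> 1" using fr by (auto simp: free_def)
  from free_smono[OF fr] consider "\<And>x y. a \<le> x \<Longrightarrow> x < y \<Longrightarrow> y \<le> b \<Longrightarrow> (f ^^ r) x < (f ^^ r) y"
    | "\<And>x y. a \<le> x \<Longrightarrow> x < y \<Longrightarrow> y \<le> b \<Longrightarrow> (f ^^ r) y < (f ^^ r) x" unfolding smono_def by blast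
  then show False
  proof cases
    case 1
    have "(f ^^ r) x \<le> (f ^^ r) y" if "a \<le> x" "x \<le> y" "y \<le> b" for x y
      using 1[of x y] that by (cases "x = y") auto
    then show ?thesis using mono_trap[OF r ab map _ x(1)] x(2) by blast
  next
    case 2
    have d: "(f ^^ r) y \<le> (f ^^ r) x" if "a \<le> x" "x \<le> y" "y \<le> b" for x y
      using 2[of x y] that by (cases "x = y") auto
    have "(f ^^ (r + r)) x \<le> (f ^^ (r + r)) y" if "a \<le> x" "x \<le> y" "y \<le> b" for x y
      using d[OF that] d[of "(f ^^ r) y" "(f ^^ r) x"] map[of x] map[of y] that by (auto simp: it_add)
    moreover have "(f ^^ (r + r)) x \<in> {a..b}" if "x \<in> {a..b}" for x using map that by (metis it_add)
    ultimately show ?thesis using mono_trap[of "r + r" a b x] r ab x by auto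
  qed
qed

end

section \<open>Gaps of the set of precritical points\<close>

text \<open>The wild point \<open>x0\<close> lies in an interval all of whose iterates are monotone branches. The images of
that interval need not be maximal; they are replaced below by the gaps \<open>(A m, B m)\<close> of the
set of precritical points that contain the orbit.\<close>

locale wander = fold +
  fixes x0 :: real
  assumes wild0: "wild x0"
    and hom: "\<exists>a b. a < x0 \<and> x0 < b \<and> (\<forall>n. free n a b)"
begin

definition precrit :: "real set" where "precrit = {x \<in> {0..1}. \<exists>n. (f ^^ n) x = c}"
definition y :: "nat \<Rightarrow> real" where "y m = (f ^^ m) x0"
definition A :: "nat \<Rightarrow> real" where "A m = Sup (insert 0 {p \<in> precrit. p \<le> y m})"
definition B :: "nat \<Rightarrow> real" where "B m = Inf (insert 1 {p \<in> precrit. y m \<le> p})"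

lemma y_in: "y m \<in> {0..1}"
  using wild0 it_in unfolding wild_def y_def by blast

lemma y_wild: "wild (y m)" unfolding y_def by (rule wild_it[OF wild0])

lemma y_add: "y (m + k) = (f ^^ k) (y m)" unfolding y_def by (metis add.commute it_add)

lemma precrit_it: "x \<in> {0..1} \<Longrightarrow> (f ^^ k) x \<in> precrit \<Longrightarrow> x \<in> precrit"
  unfolding precrit_def by (auto simp: it_add[symmetric])

lemma bddA: "bdd_above (insert 0 {p \<in> precrit. p \<le> y m})" and bddB: "bdd_below (insert 1 {p \<in> precrit. y m \<le> p})"
  unfolding precrit_def by (auto intro: bdd_aboveI[of _ 1] bdd_belowI[of _ 0])

lemma precrit_A: "p \<in> precrit \<Longrightarrow> p \<le> y m \<Longrightarrow> p \<le> A m"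
  unfolding A_def by (rule cSup_upper[OF _ bddA]) auto

lemma precrit_B: "p \<in> precrit \<Longrightarrow> y m \<le> p \<Longrightarrow> B m \<le> p"
  unfolding B_def by (rule cInf_lower[OF _ bddB]) auto

lemma A_ge: "0 \<le> A m" and B_le: "B m \<le> 1"
  unfolding A_def B_def by (auto intro: cSup_upper[OF _ bddA] cInf_lower[OF _ bddB])

text \<open>Maximality of the gap: precritical points accumulate at (or lie on) each endpoint other than the ends
of the unit interval.\<close>

lemma A_approx: assumes "e < A m" "0 < A m" shows "\<exists>p\<in>precrit. e < p \<and> p \<le> A m"
proof -
  obtain p where "p \<in> insert 0 {p \<in> precrit. p \<le> y m}" "max e 0 < p"
    using less_cSup_iff[OF _ bddA, of m "max e 0"] assms unfolding A_def by auto
  then show ?thesis using precrit_A by auto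
qed

lemma B_approx: assumes "B m < e" "B m < 1" shows "\<exists>p\<in>precrit. p < e \<and> B m \<le> p"
proof -
  obtain p where "p \<in> insert 1 {p \<in> precrit. y m \<le> p}" "p < min e 1"
    using cInf_less_iff[OF _ bddB, of m "min e 1"] assms unfolding B_def by auto
  then show ?thesis using precrit_B by auto
qed

lemma A_less: "A m < y m" "y m < B m"
proof -
  obtain a b where ab: "a < x0" "x0 < b" "\<And>n. free n a b" using hom by blast
  have a0: "0 \<le> a" and b1: "b \<le> 1" using ab(3)[of 0] by (auto simp: free_def)
  define l where "l = min ((f ^^ m) a) ((f ^^ m) b)"
  define h where "h = max ((f ^^ m) a) ((f ^^ m) b)"
  have lh: "l < y m" "y m < h"
    using free_smono[OF ab(3)[of m]] ab(1,2) less_imp_le[OF ab(1)] less_imp_le[OF ab(2)]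
    unfolding smono_def l_def h_def y_def by (metis min_less_iff_disj less_max_iff_disj order_refl)+
  have l0: "0 \<le> l" "h \<le> 1" using it_in[of a m] it_in[of b m] a0 b1 ab unfolding l_def h_def by auto
  have no: "t \<notin> precrit" if t: "l < t" "t < h" for t
  proof
    assume "t \<in> precrit"
    then obtain k where k: "(f ^^ k) t = c" unfolding precrit_def by auto
    obtain z where "a < z" "z < b" "(f ^^ m) z = t"
    proof (cases "(f ^^ m) a \<le> (f ^^ m) b")
      case True
      with t have "(f ^^ m) a < t" "t < (f ^^ m) b" by (auto simp: l_def h_def)
      from ivt[OF _ _ this] show ?thesis using that a0 b1 ab by (auto simp: min_def max_def split: if_splits)
    next
      case False
      with t have "(f ^^ m) b < t" "t < (f ^^ m) a" by (auto simp: l_def h_def)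
      from ivt[OF _ _ this] show ?thesis using that a0 b1 ab by (auto simp: min_def max_def split: if_splits)
    qed
    with k ab(3)[of "Suc (k + m)"] show False unfolding free_def by (metis it_add lessI)
  qed
  have "A m \<le> l" unfolding A_def by (rule cSup_least) (use no lh l0 in \<open>auto simp: not_less[symmetric]\<close>)
  then show "A m < y m" using lh by linarith
  have "h \<le> B m" unfolding B_def by (rule cInf_greatest) (use no lh l0 in \<open>auto simp: not_less[symmetric]\<close>)
  then show "y m < B m" using lh by linarith
qed

lemma gapfree: "A m < x \<Longrightarrow> x < B m \<Longrightarrow> x \<notin> precrit"
  using precrit_A[of x m] precrit_B[of x m] by fastforce

lemma freeAB: "free n (A m) (B m)"
  unfolding free_def using A_ge[of m] B_le[of m] A_less[of m] gapfree[of m] precrit_def by fastforce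

text \<open>A precritical point between \<open>(f ^^ k) x\<close> and the orbit would have a precritical preimage in the gap.\<close>

lemma step: assumes x: "x \<in> {A m..B m}" shows "(f ^^ k) x \<in> {A (m + k)..B (m + k)}"
proof -
  have x01: "x \<in> {0..1}" using x A_ge[of m] B_le[of m] by auto
  have none: False if p: "p \<in> precrit" "min ((f ^^ k) x) (y (m + k)) < p" "p < max ((f ^^ k) x) (y (m + k))" for p
  proof -
    obtain z where z: "min x (y m) < z" "z < max x (y m)" "(f ^^ k) z = p"
    proof (cases "(f ^^ k) x \<le> (f ^^ k) (y m)")
      case True
      with p have "(f ^^ k) x < p" "p < (f ^^ k) (y m)" by (auto simp: y_add)
      from ivt[OF x01 y_in this] show ?thesis using that by blast
    next
      case False
      with p have "(f ^^ k) (y m) < p" "p < (f ^^ k) x" by (auto simp: y_add)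
      from ivt[OF y_in x01 this] show ?thesis using that by (metis min.commute max.commute)
    qed
    then have "A m < z" "z < B m" using x A_less[of m] by auto
    moreover have "z \<in> precrit" using precrit_it[of z k] p z calculation A_ge[of m] B_le[of m] by auto
    ultimately show False using gapfree by blast
  qed
  have w01: "(f ^^ k) x \<in> {0..1}" using it_in x01 by blast
  have "\<not> (f ^^ k) x < A (m + k)"
  proof
    assume h: "(f ^^ k) x < A (m + k)"
    with w01 have "0 < A (m + k)" by auto
    from A_approx[OF h this] obtain p where "p \<in> precrit" "(f ^^ k) x < p" "p \<le> A (m + k)" by blast
    with none[of p] A_less[of "m + k"] show False by auto
  qed
  moreover have "\<not> B (m + k) < (f ^^ k) x"
  proof
    assume h: "B (m + k) < (f ^^ k) x"
    with w01 have "B (m + k) < 1" by auto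
    from B_approx[OF h this] obtain p where "p \<in> precrit" "p < (f ^^ k) x" "B (m + k) \<le> p" by blast
    with none[of p] A_less[of "m + k"] show False by auto
  qed
  ultimately show ?thesis by auto
qed

text \<open>A gap is determined by which precritical points lie on either side of the orbit, and overlapping gaps
have the same points on either side.\<close>

lemma same: assumes "A m < B n" "A n < B m" shows "A m = A n \<and> B m = B n"
proof -
  have s: "p \<le> y m \<longleftrightarrow> p \<le> y n" "y m \<le> p \<longleftrightarrow> y n \<le> p" if "p \<in> precrit" for p
    using that assms precrit_A[of p m] precrit_A[of p n] precrit_B[of p m] precrit_B[of p n] A_less[of m] A_less[of n] by linarith+
  show ?thesis unfolding A_def B_def using s by (auto intro!: arg_cong[where f = Sup] arg_cong[where f = Inf])
qed

text \<open>If two gaps of the same orbit were equal, the gap would be trapped by an iterate.\<close>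

lemma disjAB_less: assumes "m < n" shows "B m \<le> A n \<or> B n \<le> A m"
proof (rule ccontr)
  assume "\<not> ?thesis"
  then have e: "A m = A n" "B m = B n" using same[of m n] by auto
  have "(f ^^ (n - m)) x \<in> {A m..B m}" if "x \<in> {A m..B m}" for x
    using step[OF that, of "n - m"] assms e by auto
  moreover have "1 \<le> n - m" using assms by linarith
  ultimately show False using no_trap[OF freeAB[of "n - m" m] _ _ _ y_wild[of m]] A_less[of m] by auto
qed

lemma disjAB: "m \<noteq> n \<Longrightarrow> B m \<le> A n \<or> B n \<le> A m"
  using disjAB_less[of m n] disjAB_less[of n m] by (cases "m < n") auto

text \<open>Of three consecutive disjoint gaps, at most two touch the boundary of the unit interval.\<close>

lemma pick: "\<exists>m\<ge>M. 0 < A m \<and> B m < 1"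
proof -
  have 1: "A m < B m" "0 \<le> A m" "B m \<le> 1" for m using A_less[of m] A_ge[of m] B_le[of m] by auto
  have d: "B M \<le> A (Suc M) \<or> B (Suc M) \<le> A M" "B M \<le> A (Suc (Suc M)) \<or> B (Suc (Suc M)) \<le> A M"
    "B (Suc M) \<le> A (Suc (Suc M)) \<or> B (Suc (Suc M)) \<le> A (Suc M)" by (auto intro!: disjAB)
  have "0 < A M \<and> B M < 1 \<or> 0 < A (Suc M) \<and> B (Suc M) < 1 \<or> 0 < A (Suc (Suc M)) \<and> B (Suc (Suc M)) < 1"
    using d 1[of M] 1[of "Suc M"] 1[of "Suc (Suc M)"] by linarith
  then show ?thesis by (meson le_Suc_eq order_refl)
qed

end

section \<open>Record intervals and pulling back along the orbit of a gap\<close>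

text \<open>Moving left from \<open>a\<close>, the point \<open>p\<close> is where \<open>g\<close> leaves the window \<open>(U, W)\<close> for the first time.\<close>

lemma last_exit:
  fixes g :: "real \<Rightarrow> real"
  assumes g: "continuous_on {p0..a} g" and p0: "x0 \<in> {p0..a}" "\<not> (U < g x0 \<and> g x0 < W)"
    and a: "U < g a" "g a < W"
  obtains p where "x0 \<le> p" "p < a" "g p = U \<or> g p = W" "\<And>x. p < x \<Longrightarrow> x \<le> a \<Longrightarrow> U < g x \<and> g x < W"
proof -
  define S where "S = {p0..a} \<inter> g -` ({..U} \<union> {W..})"
  have "closed S" unfolding S_def by (rule continuous_closed_preimage[OF g]) auto
  then have "compact S" using bounded_subset[of "{p0..a}" S] by (auto simp: compact_eq_bounded_closed S_def)
  moreover have x0S: "x0 \<in> S" using p0 by (auto simp: S_def)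
  ultimately obtain p where p: "p \<in> S" "\<And>x. x \<in> S \<Longrightarrow> x \<le> p"
    using compact_attains_sup[of S] by blast
  have pa: "p < a" using p(1) a by (cases "p = a") (auto simp: S_def)
  have in_: "U < g x \<and> g x < W" if "p < x" "x \<le> a" for x
    using p(2)[of x] that p(1) by (auto simp: S_def not_le[symmetric])
  have p01: "p0 \<le> p" using p(1) by (auto simp: S_def)
  have "g p = U \<or> g p = W"
  proof (rule ccontr)
    assume n: "\<not> (g p = U \<or> g p = W)"
    have cp: "continuous_on {p..a} g" by (rule continuous_on_subset[OF g]) (use p01 in auto)
    have UW: "U < W" using a by linarith
    consider "g p < U" | "W < g p" using p(1) n by (auto simp: S_def)
    then show False
    proof cases
      case 1
      then obtain z where "p \<le> z" "z \<le> a" "g z = U" using IVT'[of g p U a] a pa cp by auto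
      with in_[of z] 1 show False by (cases "z = p") auto
    next
      case 2
      then obtain z where "p \<le> z" "z \<le> a" "g z = W" using IVT2'[of g a W p] a pa cp by auto
      with in_[of z] 2 show False by (cases "z = p") auto
    qed
  qed
  then show ?thesis using that p(2)[OF x0S] pa in_ by blast
qed

lemma first_exit:
  fixes g :: "real \<Rightarrow> real"
  assumes g: "continuous_on {b..q0} g" and q0: "x0 \<in> {b..q0}" "\<not> (U < g x0 \<and> g x0 < W)"
    and b: "U < g b" "g b < W"
  obtains q where "q \<le> x0" "b < q" "g q = U \<or> g q = W" "\<And>x. b \<le> x \<Longrightarrow> x < q \<Longrightarrow> U < g x \<and> g x < W"
proof -
  have "continuous_on {-q0..-b} (\<lambda>x. g (- x))"
    by (rule continuous_on_compose2[OF g]) (auto intro!: continuous_intros)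
  from last_exit[OF this, of "-x0" U W] q0 b obtain p where
    p: "- x0 \<le> p" "p < - b" "g (- p) = U \<or> g (- p) = W" "\<And>x. p < x \<Longrightarrow> x \<le> - b \<Longrightarrow> U < g (- x) \<and> g (- x) < W"
    by auto
  show ?thesis
  proof (rule that[of "- p"])
    fix x assume "b \<le> x" "x < - p" then show "U < g x \<and> g x < W" using p(4)[of "- x"] by simp
  qed (use p(1-3) in auto)
qed

text \<open>The purely topological situation: an interval with disjoint images, homeomorphic branches of all
orders, precritical points accumulating from outside at both ends, and images coming arbitrarily close
to the maximal value \<open>f c\<close>.\<close>

locale gap = fold +
  fixes a b :: real
  assumes a0: "0 < a" and ab: "a < b" and b1: "b < 1"
    and fr: "\<And>n. free n a b"
    and wp: "\<exists>z. a < z \<and> z < b \<and> wild z"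
    and left: "\<And>e. e < a \<Longrightarrow> \<exists>p n. 0 \<le> p \<and> e < p \<and> p \<le> a \<and> (f ^^ n) p = c"
    and right: "\<And>e. b < e \<Longrightarrow> \<exists>p n. p \<le> 1 \<and> p < e \<and> b \<le> p \<and> (f ^^ n) p = c"
    and disj0: "\<And>m n. m \<noteq> n \<Longrightarrow>
        max ((f ^^ m) a) ((f ^^ m) b) \<le> min ((f ^^ n) a) ((f ^^ n) b) \<or>
        max ((f ^^ n) a) ((f ^^ n) b) \<le> min ((f ^^ m) a) ((f ^^ m) b)"
    and approach0: "\<And>v M. v < f c \<Longrightarrow> \<exists>m\<ge>M. v < max ((f ^^ m) a) ((f ^^ m) b)"
begin

definition lo :: "nat \<Rightarrow> real" where "lo k = min ((f ^^ k) a) ((f ^^ k) b)"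
definition hi :: "nat \<Rightarrow> real" where "hi k = max ((f ^^ k) a) ((f ^^ k) b)"

lemma disj: "m \<noteq> n \<Longrightarrow> hi m \<le> lo n \<or> hi n \<le> lo m"
  using disj0 unfolding lo_def hi_def by blast

lemma approach: "v < f c \<Longrightarrow> \<exists>m\<ge>M. v < hi m"
  using approach0 unfolding hi_def by blast

lemma ab01: "a \<in> {0..1}" "b \<in> {0..1}" using a0 ab b1 by auto

lemma between: assumes "a < z" "z < b" shows "lo k < (f ^^ k) z" "(f ^^ k) z < hi k"
  using free_smono[OF fr[of k]] assms less_imp_le[OF assms(1)] less_imp_le[OF assms(2)]
  unfolding smono_def lo_def hi_def by (metis min_less_iff_disj less_max_iff_disj order_refl)+

lemma lohi: "lo k < hi k" using between[of "(a + b) / 2" k] ab by force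

lemma lohi01: "0 \<le> lo k" "hi k \<le> 1"
  using it_in[OF ab01(1), of k] it_in[OF ab01(2), of k] by (auto simp: lo_def hi_def)

lemma H_ex: assumes "lo k < t" "t < hi k" obtains z where "a < z" "z < b" "(f ^^ k) z = t"
proof (cases "(f ^^ k) a \<le> (f ^^ k) b")
  case True
  with assms have "(f ^^ k) a < t" "t < (f ^^ k) b" by (auto simp: lo_def hi_def)
  from ivt[OF ab01(1) ab01(2) this] show ?thesis using that ab by (auto simp: min_def max_def split: if_splits)
next
  case False
  with assms have "(f ^^ k) b < t" "t < (f ^^ k) a" by (auto simp: lo_def hi_def)
  from ivt[OF ab01(2) ab01(1) this] show ?thesis using that ab by (auto simp: min_def max_def split: if_splits)
qed

lemma H_map: assumes "lo k < t" "t < hi k" shows "lo (k + m) < (f ^^ m) t" "(f ^^ m) t < hi (k + m)"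
proof -
  obtain z where "a < z" "z < b" "(f ^^ k) z = t" using H_ex assms by blast
  moreover from this have "(f ^^ m) t = (f ^^ (k + m)) z" by (metis add.commute it_add)
  ultimately show "lo (k + m) < (f ^^ m) t" "(f ^^ m) t < hi (k + m)"
    using between[of z "k + m"] by simp_all
qed

text \<open>Iterates permute the endpoints of the images, since all branches are strictly monotone.\<close>

lemma H_end: "(f ^^ m) (lo k) = lo (k + m) \<or> (f ^^ m) (lo k) = hi (k + m)"
    "(f ^^ m) (hi k) = lo (k + m) \<or> (f ^^ m) (hi k) = hi (k + m)"
  unfolding lo_def hi_def add.commute[of k] it_add by (auto simp: min_def max_def)

lemma H_end': "lo (k + m) \<le> (f ^^ m) (lo k)" "(f ^^ m) (lo k) \<le> hi (k + m)"
    "lo (k + m) \<le> (f ^^ m) (hi k)" "(f ^^ m) (hi k) \<le> hi (k + m)"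
  using H_end[of m k] lohi[of "k + m"] by auto

lemma H_mapc: assumes "lo k \<le> t" "t \<le> hi k" shows "lo (k + m) \<le> (f ^^ m) t" "(f ^^ m) t \<le> hi (k + m)"
proof -
  consider "t = lo k" | "t = hi k" | "lo k < t \<and> t < hi k" using assms by linarith
  then have "lo (k + m) \<le> (f ^^ m) t \<and> (f ^^ m) t \<le> hi (k + m)"
    using H_map[of k t m] H_end'[where k = k and m = m] by cases simp_all
  then show "lo (k + m) \<le> (f ^^ m) t" "(f ^^ m) t \<le> hi (k + m)" by auto
qed

lemma H_wild: obtains w where "lo k < w" "w < hi k" "wild w"
  using wp wild_it between by (metis)

lemma hi_le_top: "1 \<le> m \<Longrightarrow> hi m \<le> f c"
  using it_in ab01 top_le by (cases m) (auto simp: hi_def)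

text \<open>An image reaching up to \<open>f c\<close> would be overlapped by the later images, which come arbitrarily close to
\<open>f c\<close>.\<close>

lemma hi_lt_top: assumes "1 \<le> m" shows "hi m < f c"
proof (rule ccontr)
  assume "\<not> ?thesis"
  with hi_le_top[OF assms] have e: "hi m = f c" by simp
  with lohi[of m] approach[of "lo m" "Suc m"] obtain m' where m': "Suc m \<le> m'" "lo m < hi m'" by auto
  then have "hi m \<le> lo m'" using disj[of m m'] by auto
  with e lohi[of m'] hi_le_top[of m'] m' show False by auto
qed

lemma notin: "\<not> (lo l < lo j \<and> lo j < hi l)" "\<not> (lo l < hi j \<and> hi j < hi l)"
  using disj[of l j] lohi[of l] lohi[of j] by (cases "l = j"; force)+

text \<open>The record times. Counting starts with the first image rather than with the gap itself, because
only images are known to lie below \<open>f c\<close>.\<close>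

primrec N :: "nat \<Rightarrow> nat" where
  "N 0 = 1"
| "N (Suc i) = (LEAST m. N i < m \<and> hi (N i) \<le> lo m)"

definition u :: "nat \<Rightarrow> real" where "u i = lo (N i)"
definition v :: "nat \<Rightarrow> real" where "v i = hi (N i)"

lemma N_Suc_ex: assumes "1 \<le> N i" shows "\<exists>m. N i < m \<and> hi (N i) \<le> lo m"
proof -
  obtain m where m: "Suc (N i) \<le> m" "hi (N i) < hi m" using approach[OF hi_lt_top[OF assms]] by blast
  then show ?thesis using disj[of "N i" m] lohi[of m] lohi[of "N i"] by (intro exI[of _ m]) auto
qed

lemma N_ge: "1 \<le> N i"
proof (induction i)
  case (Suc i)
  have "N i < N (Suc i) \<and> hi (N i) \<le> lo (N (Suc i))"
    unfolding N.simps(2) by (rule LeastI_ex[OF N_Suc_ex[OF Suc]])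
  with Suc show ?case by linarith
qed simp

lemma N_Suc: "N i < N (Suc i)" "v i \<le> u (Suc i)"
  using LeastI_ex[OF N_Suc_ex[OF N_ge[of i]]] by (auto simp: u_def v_def)

lemma N_mono: "i < j \<Longrightarrow> N i < N j" by (rule lift_Suc_mono_less[of N]) (rule N_Suc)
lemma N_mono_le: "i \<le> j \<Longrightarrow> N i \<le> N j" using N_mono[of i j] by (cases "i = j") auto

lemma N_gt: "i < N i" 
proof (induction i)
  case (Suc i) then show ?case using N_Suc(1)[of i] by linarith
qed simp

lemma uv: "u i < v i" unfolding u_def v_def by (rule lohi)

lemma u_mono: "i \<le> j \<Longrightarrow> u i \<le> u j"
proof (rule lift_Suc_mono_le[of u])
  fix n show "u n \<le> u (Suc n)" using N_Suc(2)[of n] uv[of n] by linarith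
qed

lemma v_le_u: "i < j \<Longrightarrow> v i \<le> u j"
  using N_Suc(2)[of i] u_mono[of "Suc i" j] by simp

lemma v_mono: "i \<le> j \<Longrightarrow> v i \<le> v j"
  using v_le_u[of i j] uv[of j] by (cases "i = j") auto

lemma v_top: "v i < f c" unfolding v_def by (rule hi_lt_top[OF N_ge])

text \<open>An image above the last record would be the next record.\<close>

lemma rec_lt: "1 \<le> k \<Longrightarrow> k < N (Suc i) \<Longrightarrow> k \<noteq> N i \<Longrightarrow> hi k \<le> u i"
proof (induction i)
  case 0
  then have "N 0 < k" by simp
  with 0 have "\<not> (hi (N 0) \<le> lo k)" using not_less_Least[of k "\<lambda>m. N 0 < m \<and> hi (N 0) \<le> lo m"] by auto
  then show ?case using disj[of k "N 0"] 0 by (auto simp: u_def)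
next
  case (Suc i)
  consider "k < N (Suc i)" | "N (Suc i) < k" using Suc by linarith
  then show ?case
  proof cases
    case 1
    show ?thesis
    proof (cases "k = N i")
      case True then show ?thesis using N_Suc(2)[of i] by (simp add: v_def)
    next
      case False then show ?thesis using Suc 1 u_mono[of i "Suc i"] by force
    qed
  next
    case 2
    with Suc have "\<not> (hi (N (Suc i)) \<le> lo k)"
      using not_less_Least[of k "\<lambda>m. N (Suc i) < m \<and> hi (N (Suc i)) \<le> lo m"] by auto
    then show ?thesis using disj[of k "N (Suc i)"] 2 by (auto simp: u_def)
  qed
qed

lemma rec_ge: "1 \<le> m \<Longrightarrow> v e < hi m \<Longrightarrow> N (Suc e) \<le> m"
  using rec_lt[of m e] uv[of e] by (cases "m = N e") (force simp: v_def)+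

lemma rec_ge': "1 \<le> m \<Longrightarrow> u e < hi m \<Longrightarrow> m \<noteq> N e \<Longrightarrow> N (Suc e) \<le> m"
  using rec_lt[of m e] by force

lemma rec_between: "1 \<le> k \<Longrightarrow> k < N (Suc i) \<Longrightarrow> \<exists>e\<le>i. N e \<le> k \<and> k < N (Suc e)"
proof (induction i)
  case (Suc i)
  then show ?case by (cases "k < N (Suc i)") (auto simp: not_less intro: le_SucI)
qed auto

lemma v_lim: "v \<longlonglongrightarrow> f c"
proof (rule order_tendstoI)
  fix e assume "e < f c"
  then obtain m where m: "1 \<le> m" "e < hi m" using approach[of e 1] by blast
  have "e < v i" if "i \<ge> m" for i
  proof (rule ccontr)
    assume "\<not> e < v i"
    then have "v i < hi m" using m by linarith
    then have "N (Suc i) \<le> m" using rec_ge m by blast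
    with N_gt[of "Suc i"] that show False by linarith
  qed
  then show "\<forall>\<^sub>F i in sequentially. e < v i" unfolding eventually_sequentially by blast
next
  fix e assume "f c < e" then show "\<forall>\<^sub>F i in sequentially. v i < e"
    using less_trans[OF v_top] by (auto intro!: always_eventually)
qed

text \<open>The obstruction to pulling back a window \<open>(u i, W)\<close> around the record at time \<open>n\<close>. If an intermediate image of a
connected set \<open>S\<close> containing the gap meets \<open>c\<close>, take the last such time. The next image then
contains everything between the image of the gap at that time and \<open>f c\<close>, and the rest of the way it is a
monotone branch; since it ends in a window contained in that interval, a wild point is trapped.\<close>

lemma pull_free:
  assumes U: "U = u i" and W: "v (Suc i) \<le> W" "W \<le> f c" and n: "n = N (Suc i)"
    and S: "S \<subseteq> {0..1}" "a \<in> S" "b \<in> S" "\<And>x y z. x \<in> S \<Longrightarrow> y \<in> S \<Longrightarrow> x \<le> z \<Longrightarrow> z \<le> y \<Longrightarrow> z \<in> S"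
    and inside: "\<And>x. x \<in> S \<Longrightarrow> U < (f ^^ n) x \<and> (f ^^ n) x < W"
    and kz0: "k0 < n" "z0 \<in> S"
  shows "(f ^^ k0) z0 \<noteq> c"
proof
  assume kc: "(f ^^ k0) z0 = c"
  define P where "P k \<longleftrightarrow> k < n \<and> (\<exists>z\<in>S. (f ^^ k) z = c)" for k
  have "P k0" unfolding P_def using kz0 kc by blast
  then obtain k where k: "P k" "\<And>k'. P k' \<Longrightarrow> k' \<le> k"
  proof -
    have fin: "finite {k. P k}" by (rule finite_subset[of _ "{..<n}"]) (auto simp: P_def)
    have "P (Max {k. P k})" using Max_in[OF fin] \<open>P k0\<close> by auto
    moreover have "k' \<le> Max {k. P k}" if "P k'" for k' using Max_ge[OF fin] that by simp
    ultimately show ?thesis by (rule that)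
  qed
  then obtain z where z: "k < n" "z \<in> S" "(f ^^ k) z = c" unfolding P_def by blast
  define m where "m = Suc k"
  have fm: "(f ^^ m) z = f c" using z by (simp add: m_def)
  have mn: "m \<le> n" "1 \<le> m" using z by (auto simp: m_def)
  have z01: "z \<in> {0..1}" using z(2) S(1) by blast
  show False
  proof (cases "m = n")
    case True with inside[of z] z fm W show False by auto
  next
    case False
    then have mlt: "m < n" using mn by simp
    obtain e where e: "e = a \<or> e = b" "(f ^^ m) e = lo m" unfolding lo_def by (metis min_def)
    have e01: "e \<in> {0..1}" "e \<in> S" using e(1) ab01 S(2,3) by auto
    have him: "hi m \<le> f c" "lo m < f c" using hi_lt_top[of m] lohi[of m] mn by auto
    have hit: "\<exists>x\<in>S. (f ^^ m) x = t" if t: "lo m < t" "t < f c" for t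
    proof -
      obtain x where x: "min e z < x" "x < max e z" "(f ^^ m) x = t"
        using ivt[OF e01(1) z01, of m t] t e fm by auto
      then have "x \<in> S" using S(4)[of e z x] S(4)[of z e x] e01 z by (auto simp: min_def max_def split: if_splits)
      then show ?thesis using x by blast
    qed
    have fre: "free (n - m) (lo m) (f c)"
    proof -
      have "(f ^^ j) t \<noteq> c" if j: "j < n - m" and t: "lo m < t" "t < f c" for j t
      proof
        assume jt: "(f ^^ j) t = c"
        obtain x where x: "x \<in> S" "(f ^^ m) x = t" using hit[OF t] by blast
        then have "P (j + m)" unfolding P_def using j jt by (auto simp: it_add)
        then have "j + m \<le> k" using k by blast
        then show False unfolding m_def by simp
      qed
      then show ?thesis unfolding free_def using him lohi01(1)[of m] self[of c] c0 c1 by auto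
    qed
    have loU: "lo m \<le> U"
      using rec_lt[of m i] mn mlt n lohi[of m] U by (cases "m = N i") (auto simp: u_def)
    have cl: "(f ^^ (n - m)) t \<in> {lo m..f c}" if t: "lo m < t" "t < f c" for t
    proof -
      obtain x where x: "x \<in> S" "(f ^^ m) x = t" using hit[OF t] by blast
      then have "(f ^^ (n - m)) t = (f ^^ n) x" using it_diff[of m n x] mn by simp
      then show ?thesis using inside[OF x(1)] loU W by auto
    qed
    have "(f ^^ (n - m)) ` closure {lo m<..<f c} \<subseteq> {lo m..f c}"
    proof (rule image_closure_subset)
      show "continuous_on (closure {lo m<..<f c}) (f ^^ (n - m))"
        using him lohi01(1)[of m] self[of c] c0 c1 by (auto intro!: it_cont_sub)
    qed (use cl in auto)
    then have cl2: "(f ^^ (n - m)) t \<in> {lo m..f c}" if "t \<in> {lo m..f c}" for t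
      using that him by (auto simp: image_subset_iff)
    obtain w where w: "lo m < w" "w < hi m" "wild w" by (rule H_wild)
    show False by (rule no_trap[OF fre _ cl2 _ w(3)]) (use mlt w him in auto)
  qed
qed

lemma H_in_UW: "x \<in> {a..b} \<Longrightarrow> v (Suc i) < W \<Longrightarrow> u i < (f ^^ N (Suc i)) x \<and> (f ^^ N (Suc i)) x < W"
  using H_mapc[of 0 x "N (Suc i)"] ab N_Suc(2)[of i] uv[of i] by (auto simp: lo_def hi_def u_def v_def)

text \<open>Precritical points \<open>p0\<close>, \<open>q0\<close> with small hitting times stop the pull-back, so the pulled back interval
\<open>(p, q)\<close> lies between them; this is how its size is controlled.\<close>

lemma pull_ex:
  assumes W: "v (Suc i) < W" "W \<le> f c" and n: "n = N (Suc i)"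
    and p0: "0 \<le> p0" "p0 \<le> a" "(f ^^ k) p0 = c" "k < n"
    and q0: "q0 \<le> 1" "b \<le> q0" "(f ^^ l) q0 = c" "l < n"
  obtains p q where "p0 \<le> p" "p < a" "b < q" "q \<le> q0" "free n p q"
    "(f ^^ n) p = u i \<or> (f ^^ n) p = W" "(f ^^ n) q = u i \<or> (f ^^ n) q = W"
    "\<And>x. p < x \<Longrightarrow> x < q \<Longrightarrow> u i < (f ^^ n) x \<and> (f ^^ n) x < W"
proof -
  note inH = H_in_UW[OF _ W(1), folded n]
  have W': "v (Suc i) \<le> W" using W by simp
  have "\<exists>x\<in>{p0..a}. \<not> (u i < (f ^^ n) x \<and> (f ^^ n) x < W)"
  proof (rule ccontr)
    assume no: "\<not> ?thesis"
    have inS: "u i < (f ^^ n) x \<and> (f ^^ n) x < W" if "x \<in> {p0..b}" for x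
      using no inH[of x] that by (cases "x \<le> a") auto
    have "(f ^^ k) p0 \<noteq> c"
      by (rule pull_free[where S = "{p0..b}", OF refl W' W(2) n _ _ _ _ inS p0(4)]) (use p0 ab01 ab in auto)
    with p0 show False by simp
  qed
  then obtain x where x: "x \<in> {p0..a}" "\<not> (u i < (f ^^ n) x \<and> (f ^^ n) x < W)" by blast
  obtain p where p: "x \<le> p" "p < a" "(f ^^ n) p = u i \<or> (f ^^ n) p = W"
    "\<And>x. p < x \<Longrightarrow> x \<le> a \<Longrightarrow> u i < (f ^^ n) x \<and> (f ^^ n) x < W"
  proof (rule last_exit[where g = "f ^^ n" and U = "u i" and W = W, OF _ x])
    show "continuous_on {p0..a} (f ^^ n)" using p0 ab01 by (intro it_cont_sub) auto
    show "u i < (f ^^ n) a" "(f ^^ n) a < W" using inH[of a] ab by auto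
  qed blast
  have "\<exists>x\<in>{b..q0}. \<not> (u i < (f ^^ n) x \<and> (f ^^ n) x < W)"
  proof (rule ccontr)
    assume no: "\<not> ?thesis"
    have inS: "u i < (f ^^ n) x \<and> (f ^^ n) x < W" if "x \<in> {a..q0}" for x
      using no inH[of x] that by (cases "b \<le> x") auto
    have "(f ^^ l) q0 \<noteq> c"
      by (rule pull_free[where S = "{a..q0}", OF refl W' W(2) n _ _ _ _ inS q0(4)]) (use q0 ab01 ab in auto)
    with q0 show False by simp
  qed
  then obtain x' where x': "x' \<in> {b..q0}" "\<not> (u i < (f ^^ n) x' \<and> (f ^^ n) x' < W)" by blast
  obtain q where q: "q \<le> x'" "b < q" "(f ^^ n) q = u i \<or> (f ^^ n) q = W"
    "\<And>x. b \<le> x \<Longrightarrow> x < q \<Longrightarrow> u i < (f ^^ n) x \<and> (f ^^ n) x < W"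
  proof (rule first_exit[where g = "f ^^ n" and U = "u i" and W = W, OF _ x'])
    show "continuous_on {b..q0} (f ^^ n)" using q0 ab01 by (intro it_cont_sub) auto
    show "u i < (f ^^ n) b" "(f ^^ n) b < W" using inH[of b] ab by auto
  qed blast
  have ins: "u i < (f ^^ n) x \<and> (f ^^ n) x < W" if "p < x" "x < q" for x
    using p(4)[of x] q(4)[of x] inH[of x] that by (cases "x \<le> a"; cases "b \<le> x") auto
  have "free n p q"
    unfolding free_def
  proof (intro conjI allI impI)
    fix k x assume kx: "k < n" "p < x \<and> x < q"
    have inS: "u i < (f ^^ n) x \<and> (f ^^ n) x < W" if "x \<in> {p<..<q}" for x
      using ins[of x] that by simp
    show "(f ^^ k) x \<noteq> c"
      by (rule pull_free[where S = "{p<..<q}", OF refl W' W(2) n _ _ _ _ inS kx(1)]) (use kx p(1,2) q(1,2) x(1) x'(1) p0 q0 ab in auto)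
  qed (use p(1,2) q(1,2) x(1) x'(1) p0 q0 ab in auto)
  moreover have "p0 \<le> p" "q \<le> q0" using p(1) q(1) x(1) x'(1) by auto
  ultimately show ?thesis using p(2,3) q(2,3) ins by (intro that)
qed

end

section \<open>The pulled back intervals overlap at most three times\<close>

context gap begin

declare N.simps(2) [simp del]

text \<open>When the time to a record gets strictly shorter, the branch of the shorter length
pushes the old record down and the new one up, so it has a fixed point between the two
records. Its whole orbit stays low, which contradicts any situation where that point is known to be
lifted above \<open>u (Suc e)\<close>.\<close>

lemma fix_orbit:
  assumes q: "1 \<le> q" "N e + q < N (Suc e)" "N (Suc (Suc e)) = N (Suc e) + q"
    and fre: "free q (u e) (v (Suc e))"
  obtains z where "v e < z" "z < u (Suc e)" "(f ^^ q) z = z" "\<And>t. (f ^^ t) z \<le> u (Suc e)"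
proof -
  have l: "(f ^^ t) (v e) \<le> u e" if "1 \<le> t" "t \<le> q" for t
    using H_end'(4)[of t "N e"] rec_lt[of "N e + t" e] that q N_ge[of e] by (simp add: v_def)
  have r: "(f ^^ t) (u (Suc e)) \<le> u (Suc e)" if "1 \<le> t" "t < q" for t
    using H_end'(2)[of t "N (Suc e)"] rec_lt[of "N (Suc e) + t" "Suc e"] that q N_ge[of "Suc e"] by (simp add: u_def)
  have rq: "u (Suc (Suc e)) \<le> (f ^^ q) (u (Suc e))"
    using H_end'(1)[of "N (Suc e)" q] q(3) by (simp add: u_def)
  have u01: "0 \<le> u e" "v (Suc e) \<le> 1" using lohi01 by (auto simp: u_def v_def)
  have ord: "u e < v e" "v e \<le> u (Suc e)" "u (Suc e) < v (Suc e)" "v (Suc e) \<le> u (Suc (Suc e))"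
    using uv N_Suc(2) by auto
  have lq: "(f ^^ q) (v e) \<le> u e" using l[of q] q by simp
  have ne: "v e < u (Suc e)" using lq rq ord by (cases "v e = u (Suc e)") auto
  have "\<exists>z\<ge>v e. z \<le> u (Suc e) \<and> (f ^^ q) z - z = 0"
    by (rule IVT') (use lq rq ord ne u01 in \<open>auto intro!: continuous_intros it_cont_sub\<close>)
  then obtain z where z: "v e \<le> z" "z \<le> u (Suc e)" "(f ^^ q) z = z" by auto
  have zs: "v e < z" "z < u (Suc e)"
    using z lq rq ord by (cases "z = v e"; cases "z = u (Suc e)"; simp)+
  have small: "(f ^^ t) z \<le> u (Suc e)" if "t < q" for t
  proof (cases "t = 0")
    case True then show ?thesis using z by simp
  next
    case False
    have "smono (f ^^ t) (v e) (u (Suc e))"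
      by (rule free_smono, rule free_sub[OF fre]) (use that ord in auto)
    then have "(f ^^ t) z \<le> max ((f ^^ t) (v e)) ((f ^^ t) (u (Suc e)))"
      unfolding smono_def using zs by (elim disjE) (smt (verit, best))+
    then show ?thesis using l[of t] r[of t] that False ord by auto
  qed
  have "(f ^^ t) z \<le> u (Suc e)" for t
    using small[of "t mod q"] q funpow_mod_eq[OF z(3), of t] by simp
  with zs z that show ?thesis by blast
qed

end

text \<open>\<open>(p, q)\<close> is the pull-back, along the first \<open>n = N (j + 3)\<close> iterates, of the window spanned by the
records preceding and following the one at time \<open>n\<close>; its images are \<open>(tl k, th k)\<close>.\<close>

locale pull = gap +
  fixes j :: nat and p q :: real
  assumes frpq: "free (N (j + 3)) p q" and pa: "p < a" and bq: "b < q"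
    and endp: "(f ^^ N (j + 3)) p = u (j + 2) \<or> (f ^^ N (j + 3)) p = v (j + 4)"
    and endq: "(f ^^ N (j + 3)) q = u (j + 2) \<or> (f ^^ N (j + 3)) q = v (j + 4)"
begin

definition n :: nat where "n = N (j + 3)"
definition tl :: "nat \<Rightarrow> real" where "tl k = min ((f ^^ k) p) ((f ^^ k) q)"
definition th :: "nat \<Rightarrow> real" where "th k = max ((f ^^ k) p) ((f ^^ k) q)"

lemma pq01: "p \<in> {0..1}" "q \<in> {0..1}" "p < q"
  using frpq pa bq ab unfolding free_def by auto

lemma frn: "k \<le> n \<Longrightarrow> free k p q"
  using frpq free_sub[of n p q p q k] pq01 unfolding n_def by auto

lemma T_in: assumes "p < x" "x < q" "k \<le> n" shows "tl k < (f ^^ k) x" "(f ^^ k) x < th k"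
  using free_smono[OF frn[OF assms(3)]] assms less_imp_le[OF assms(1)] less_imp_le[OF assms(2)]
  unfolding smono_def tl_def th_def by (metis min_less_iff_disj less_max_iff_disj order_refl)+

lemma T_ex: assumes "tl k < t" "t < th k" obtains x where "p < x" "x < q" "(f ^^ k) x = t"
proof (cases "(f ^^ k) p \<le> (f ^^ k) q")
  case True
  with assms have "(f ^^ k) p < t" "t < (f ^^ k) q" by (auto simp: tl_def th_def)
  from ivt[OF pq01(1) pq01(2) this] show ?thesis using that pq01(3) by (auto simp: min_def max_def split: if_splits)
next
  case False
  with assms have "(f ^^ k) q < t" "t < (f ^^ k) p" by (auto simp: tl_def th_def)
  from ivt[OF pq01(2) pq01(1) this] show ?thesis using that pq01(3) by (auto simp: min_def max_def split: if_splits)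
qed

lemma T_H: assumes "k \<le> n" shows "tl k < lo k" "hi k < th k"
  using T_in[of a k] T_in[of b k] assms pa bq ab by (auto simp: lo_def hi_def)

lemma T01: "0 \<le> tl k" "th k \<le> 1"
  using it_in[OF pq01(1), of k] it_in[OF pq01(2), of k] by (auto simp: tl_def th_def)

lemma tlth: "k \<le> n \<Longrightarrow> tl k < th k"
  using T_H[of k] lohi[of k] by linarith

lemma T_map: assumes "tl k < t" "t < th k" "k + m \<le> n"
  shows "tl (k + m) < (f ^^ m) t" "(f ^^ m) t < th (k + m)"
proof -
  obtain x where "p < x" "x < q" "(f ^^ k) x = t" using T_ex assms by blast
  moreover from this have "(f ^^ m) t = (f ^^ (k + m)) x" by (metis add.commute it_add)
  ultimately show "tl (k + m) < (f ^^ m) t" "(f ^^ m) t < th (k + m)"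
    using T_in[of x "k + m"] assms by simp_all
qed

lemma T_end: "(f ^^ m) (tl k) = tl (k + m) \<or> (f ^^ m) (tl k) = th (k + m)"
    "(f ^^ m) (th k) = tl (k + m) \<or> (f ^^ m) (th k) = th (k + m)"
  unfolding tl_def th_def add.commute[of k] it_add by (auto simp: min_def max_def)

lemma T_mapc: assumes "tl k \<le> t" "t \<le> th k" "k + m \<le> n"
  shows "tl (k + m) \<le> (f ^^ m) t" "(f ^^ m) t \<le> th (k + m)"
proof -
  consider "t = tl k" | "t = th k" | "tl k < t \<and> t < th k" using assms by linarith
  then have "tl (k + m) \<le> (f ^^ m) t \<and> (f ^^ m) t \<le> th (k + m)"
    using T_map[of k t m] T_end(1)[of m k] T_end(2)[of m k] tlth[OF assms(3)] assms(3) by cases auto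
  then show "tl (k + m) \<le> (f ^^ m) t" "(f ^^ m) t \<le> th (k + m)" by auto
qed

lemma T_free: assumes "k + m \<le> n" shows "free m (tl k) (th k)"
proof -
  have "(f ^^ i) t \<noteq> c" if it: "i < m" and t: "tl k < t" "t < th k" for i t
  proof -
    obtain x where x: "p < x" "x < q" "(f ^^ k) x = t" using T_ex t by blast
    have "(f ^^ (i + k)) x \<noteq> c" using frn[of n] x it assms unfolding free_def by auto
    then show ?thesis using x by (simp add: it_add)
  qed
  then show ?thesis using T01 tlth[of k] assms unfolding free_def by auto
qed

lemma UW: "u (j + 2) < v (j + 4)"
  using v_le_u[of "j + 2" "j + 4"] uv[of "j + 2"] uv[of "j + 4"] by linarith

lemma T_n: "tl n = u (j + 2)" "th n = v (j + 4)"
proof -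
  have "tl n < th n" by (rule tlth) simp
  then have "(f ^^ n) p \<noteq> (f ^^ n) q" by (auto simp: tl_def th_def)
  then show "tl n = u (j + 2)" "th n = v (j + 4)"
    using endp endq UW unfolding tl_def th_def n_def by (elim disjE; simp)+
qed

text \<open>An intermediate interval which meets an image of the gap contains it: otherwise an endpoint
of the interval would lie inside that image, and so would its last image, which is an endpoint
of another image of the gap.\<close>

lemma whole: assumes "k \<le> n" "tl k < hi i" "lo i < th k" shows "tl k \<le> lo i" "hi i \<le> th k"
proof -
  have e: "(f ^^ (n - k)) (tl k) = u (j + 2) \<or> (f ^^ (n - k)) (tl k) = v (j + 4)"
    "(f ^^ (n - k)) (th k) = u (j + 2) \<or> (f ^^ (n - k)) (th k) = v (j + 4)"
    using T_end[of "n - k" k] T_n assms(1) by auto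
  show "tl k \<le> lo i"
  proof (rule ccontr)
    assume "\<not> tl k \<le> lo i"
    then have "lo (i + (n - k)) < (f ^^ (n - k)) (tl k)" "(f ^^ (n - k)) (tl k) < hi (i + (n - k))"
      using H_map[of i "tl k" "n - k"] assms by auto
    with e(1) notin[of "i + (n - k)"] show False unfolding u_def v_def by metis
  qed
  show "hi i \<le> th k"
  proof (rule ccontr)
    assume "\<not> hi i \<le> th k"
    then have "lo (i + (n - k)) < (f ^^ (n - k)) (th k)" "(f ^^ (n - k)) (th k) < hi (i + (n - k))"
      using H_map[of i "th k" "n - k"] assms by auto
    with e(2) notin[of "i + (n - k)"] show False unfolding u_def v_def by metis
  qed
qed

lemma Nn: "e \<le> j + 3 \<Longrightarrow> N e \<le> n" unfolding n_def by (rule N_mono_le)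

text \<open>Downward induction. If the interval at some record time extended below the preceding record, that
record would be carried along by the monotone branch to the following one and, by the choice of
records, would have to land on the current record; the left end of the following interval would
then violate the bound.\<close>

lemma left_end_bound: "e \<le> j + 2 \<Longrightarrow> u e \<le> tl (N (Suc e))"
proof (induction rule: inc_induct)
  case base
  have "N (Suc (j + 2)) = n" by (simp add: n_def numeral_3_eq_3)
  then show ?case using T_n by simp
next
  case (step e)
  show ?case
  proof (rule ccontr)
    assume neg: "\<not> u e \<le> tl (N (Suc e))"
    have le1: "N (Suc e) \<le> n" "N (Suc (Suc e)) \<le> n" using step by (auto intro!: Nn)
    define s where "s = N (Suc (Suc e)) - N (Suc e)"
    have s: "N (Suc e) + s = N (Suc (Suc e))" "1 \<le> s" using N_Suc(1)[of "Suc e"] by (auto simp: s_def)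
    have th: "v (Suc e) < th (N (Suc e))" "tl (N (Suc e)) < u (Suc e)"
      using T_H[OF le1(1)] by (auto simp: u_def v_def)
    have o: "u e < v e" "v e \<le> u (Suc e)" "u (Suc e) < v (Suc e)" "v (Suc e) \<le> u (Suc (Suc e))"
      using uv N_Suc(2) by auto
    have m1: "tl (N (Suc (Suc e))) < (f ^^ s) (u e)"
      using T_map(1)[of "N (Suc e)" "u e" s] neg th o s le1 by auto
    have m2: "tl (N (Suc (Suc e))) < (f ^^ s) (v e)"
      using T_map(1)[of "N (Suc e)" "v e" s] neg th o s le1 by auto
    have "u (Suc e) < hi (N e + s)" using m1 step H_end'(2)[of s "N e"] by (auto simp: u_def)
    moreover have "N e + s < N (Suc (Suc e))" using s N_Suc(1)[of e] by linarith
    ultimately have idx: "N e + s = N (Suc e)" using rec_lt[of "N e + s" "Suc e"] N_ge[of e] by force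
    have sm: "smono (f ^^ s) (tl (N (Suc e))) (th (N (Suc e)))"
      by (rule free_smono, rule T_free) (use s le1 in auto)
    have ve: "(f ^^ s) (v e) \<le> v (Suc e)" using H_end'(4)[of s "N e"] idx by (simp add: v_def)
    have use1: "u (Suc (Suc e)) \<le> (f ^^ s) (v (Suc e))" using H_end'(3)[of "N (Suc e)" s] s by (simp add: u_def v_def)
    have lt: "(f ^^ s) (v e) < (f ^^ s) (v (Suc e)) \<or> (f ^^ s) (v e) = (f ^^ s) (v (Suc e))"
      using ve use1 o by linarith
    have inc': "\<And>x y. tl (N (Suc e)) \<le> x \<Longrightarrow> x < y \<Longrightarrow> y \<le> th (N (Suc e)) \<Longrightarrow> (f ^^ s) x < (f ^^ s) y"
    proof -
      have "\<not> (f ^^ s) (v (Suc e)) < (f ^^ s) (v e)" using ve use1 o by linarith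
      moreover have "tl (N (Suc e)) \<le> v e" "v e < v (Suc e)" "v (Suc e) \<le> th (N (Suc e))" using neg th o by linarith+
      ultimately show "\<And>x y. tl (N (Suc e)) \<le> x \<Longrightarrow> x < y \<Longrightarrow> y \<le> th (N (Suc e)) \<Longrightarrow> (f ^^ s) x < (f ^^ s) y"
        using sm unfolding smono_def by blast
    qed
    have "(f ^^ s) (u e) < (f ^^ s) (v e)" using inc'[of "u e" "v e"] neg th o by linarith
    then have "(f ^^ s) (u e) = u (Suc e)"
      using H_end(1)[of s "N e"] H_end(2)[of s "N e"] lohi[of "N (Suc e)"] idx by (auto simp: u_def v_def)
    then show False using m1 step by simp
  qed
qed

text \<open>At a time that is not a record time the image of the gap is below the current record, so an interval
reaching up to \<open>u (j + 2)\<close> contains that record. Following both to the next record time contradicts the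
lower bound on the left end.\<close>

lemma T_meet:
  assumes k: "1 \<le> k" "k < n" "u (j + 2) < th k"
  shows "\<exists>e\<le>j + 2. k = N e"
proof -
  have nS: "n = N (Suc (j + 2))" by (simp add: n_def numeral_3_eq_3)
  obtain e where e: "e \<le> j + 2" "N e \<le> k" "k < N (Suc e)" using rec_between[of k "j + 2"] k nS by auto
  have "k = N e"
  proof (rule ccontr)
    assume ne: "k \<noteq> N e"
    have hk: "hi k \<le> u e" using rec_lt[of k e] k e ne by simp
    have "tl k < v e" "u e < th k"
      using T_H[of k] lohi[of k] hk uv[of e] u_mono[OF e(1)] k by linarith+
    then have w: "tl k \<le> u e" "v e \<le> th k" using whole[of k "N e"] k by (auto simp: u_def v_def)
    define r where "r = N (Suc e) - k"
    have r: "k + r = N (Suc e)" "1 \<le> r" using e by (auto simp: r_def)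
    define m where "m = (u e + v e) / 2"
    have m: "u e < m" "m < v e" using uv[of e] by (auto simp: m_def)
    have "tl (k + r) < (f ^^ r) m"
      by (rule T_map(1)) (use m w r Nn[of "Suc e"] e in auto)
    then have "u e < (f ^^ r) m" using left_end_bound[OF e(1)] r by simp
    moreover have "(f ^^ r) m < hi (N e + r)" using H_map(2)[of "N e" m r] m by (simp add: u_def v_def)
    moreover have "hi (N e + r) \<le> u e" using rec_lt[of "N e + r" e] N_ge[of e] ne e r by auto
    ultimately show False by linarith
  qed
  with e show ?thesis by blast
qed

text \<open>A decreasing branch would map \<open>[u e, v (Suc e)]\<close> into itself.\<close>

lemma step_inc:
  assumes e: "e \<le> j + 1" and V: "v (j + 2) \<le> th (N e)"
    and s: "s = N (Suc e) - N e"
  shows "\<And>x y. tl (N e) \<le> x \<Longrightarrow> x < y \<Longrightarrow> y \<le> th (N e) \<Longrightarrow> (f ^^ s) x < (f ^^ s) y"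
proof -
  have s': "N e + s = N (Suc e)" "1 \<le> s" using N_Suc(1)[of e] s by auto
  have le: "N (Suc e) \<le> n" "N e \<le> n" using e by (auto intro!: Nn)
  have sm: "smono (f ^^ s) (tl (N e)) (th (N e))"
    by (rule free_smono, rule T_free) (use s' le in auto)
  have tu: "tl (N e) < u e" using T_H[OF le(2)] by (simp add: u_def)
  have vj: "v (Suc e) \<le> th (N e)" using v_mono[of "Suc e" "j + 2"] e V by simp
  have o: "u e < v e" "v e \<le> u (Suc e)" "u (Suc e) < v (Suc e)" using uv N_Suc(2) by auto
  have "\<not> (\<forall>x y. tl (N e) \<le> x \<and> x < y \<and> y \<le> th (N e) \<longrightarrow> (f ^^ s) y < (f ^^ s) x)"
  proof
    assume d: "\<forall>x y. tl (N e) \<le> x \<and> x < y \<and> y \<le> th (N e) \<longrightarrow> (f ^^ s) y < (f ^^ s) x"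
    have d': "(f ^^ s) y \<le> (f ^^ s) x" if "tl (N e) \<le> x" "x \<le> y" "y \<le> th (N e)" for x y
      using d[rule_format, of x y] that by (cases "x = y") auto
    have f1: "(f ^^ s) (u e) \<le> v (Suc e)" using H_end'(2)[of s "N e"] s' by (simp add: u_def v_def)
    have f2: "u e \<le> (f ^^ s) (v (Suc e))"
      using T_mapc(1)[of "N e" "v (Suc e)" s] left_end_bound[of e] tu vj o s' le e by auto
    have map: "(f ^^ s) x \<in> {u e..v (Suc e)}" if "x \<in> {u e..v (Suc e)}" for x
      using d'[of "u e" x] d'[of x "v (Suc e)"] f1 f2 that tu vj by auto
    have fre: "free s (u e) (v (Suc e))"
      by (rule free_sub[OF T_free[of "N e" s]]) (use s' le tu vj o in auto)
    obtain w where "lo (N e) < w" "w < hi (N e)" "wild w" by (rule H_wild)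
    then show False using no_trap[OF fre s'(2) map, of w] o by (auto simp: u_def v_def)
  qed
  with sm show "\<And>x y. tl (N e) \<le> x \<Longrightarrow> x < y \<Longrightarrow> y \<le> th (N e) \<Longrightarrow> (f ^^ s) x < (f ^^ s) y"
    unfolding smono_def by blast
qed

text \<open>A point not moved upwards would bound an interval trapped by the branch.\<close>

lemma step_gt:
  assumes e: "e \<le> j + 2" and s: "s = N (Suc e) - N e"
    and inc': "\<And>x y. tl (N e) \<le> x \<Longrightarrow> x < y \<Longrightarrow> y \<le> th (N e) \<Longrightarrow> (f ^^ s) x < (f ^^ s) y"
    and z: "u e \<le> z" "z \<le> th (N e)"
  shows "z < (f ^^ s) z"
proof (rule ccontr)
  assume neg: "\<not> z < (f ^^ s) z"
  have s': "N e + s = N (Suc e)" "1 \<le> s" using N_Suc(1)[of e] s by auto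
  have le: "N (Suc e) \<le> n" "N e \<le> n" using e by (auto intro!: Nn)
  have tu: "tl (N e) < u e" using T_H[OF le(2)] by (simp add: u_def)
  have o: "u e < v e" "v e \<le> u (Suc e)" "u (Suc e) < v (Suc e)" using uv N_Suc(2) by auto
  have i: "(f ^^ s) x \<le> (f ^^ s) y" if "tl (N e) \<le> x" "x \<le> y" "y \<le> th (N e)" for x y
    using inc'[of x y] that by (cases "x = y") auto
  have fu: "u (Suc e) \<le> (f ^^ s) (u e)" using H_end'(1)[of "N e" s] s' by (simp add: u_def)
  have "(f ^^ s) (u e) \<le> (f ^^ s) z" using i[of "u e" z] tu z by simp
  then have "v e \<le> z" using neg fu o by linarith
  have map: "(f ^^ s) x \<in> {u e..z}" if "x \<in> {u e..z}" for x
    using i[of "u e" x] i[of x z] that tu z fu o neg by auto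
  have fre: "free s (u e) z"
    by (rule free_sub[OF T_free[of "N e" s]]) (use s' le tu z in auto)
  obtain w where "lo (N e) < w" "w < hi (N e)" "wild w" by (rule H_wild)
  then show False using no_trap[OF fre s'(2) map, of w] \<open>v e \<le> z\<close> by (auto simp: u_def v_def)
qed

lemma V_of_U: assumes "e \<le> j + 2" "u (j + 2) < th (N e)" shows "v (j + 2) \<le> th (N e)"
proof -
  have "tl (N e) < u e" using T_H[OF Nn[of e]] assms by (simp add: u_def)
  then have "tl (N e) < v (j + 2)" using u_mono[OF assms(1)] uv[of "j + 2"] by linarith
  then show ?thesis using whole(2)[of "N e" "N (j + 2)"] assms Nn[of e] by (simp add: u_def v_def)
qed

lemma next_reaches: assumes e: "e \<le> j + 1" and U: "u (j + 2) < th (N e)" shows "u (j + 2) < th (N (Suc e))"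
proof -
  define s where "s = N (Suc e) - N e"
  have s': "N e + s = N (Suc e)" using N_Suc(1)[of e] s_def by auto
  have V: "v (j + 2) \<le> th (N e)" using V_of_U e U by simp
  note inc' = step_inc[OF e V s_def]
  have "v (j + 2) < (f ^^ s) (v (j + 2))"
    by (rule step_gt[OF _ s_def inc']) (use e V u_mono[of e "j + 2"] uv[of "j + 2"] in auto)
  moreover have "(f ^^ s) (v (j + 2)) \<le> th (N e + s)"
    by (rule T_mapc(2)) (use V s' e Nn[of "Suc e"] Nn[of e] T_H[of "N e"] u_mono[of e "j + 2"] uv[of "j + 2"] in \<open>auto simp: u_def\<close>)
  ultimately show ?thesis using s' uv[of "j + 2"] by simp
qed

lemma reaches_on: "e \<le> j \<Longrightarrow> u (j + 2) < th (N e) \<Longrightarrow> u (j + 2) < th (N j)"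
proof (induction rule: inc_induct)
  case (step e) then show ?case using next_reaches[of e] by simp
qed

text \<open>Suppose the interval at time \<open>N j\<close> already reaches up to the window. The branches leading from record to record are
increasing and move points up, so the time differences cannot grow; a strict decrease produces a
low periodic orbit (\<open>fix_orbit\<close>) which is also lifted high. Hence all differences are equal, every record
is mapped to the next by the same branch, and the last interval would extend beyond its own upper end
at \<open>v (j + 4)\<close>.\<close>

lemma no_deep: "\<not> u (j + 2) < th (N j)"
proof
  assume U0: "u (j + 2) < th (N j)"
  have E: "j + 2 = Suc (Suc j)" "j + 3 = Suc (Suc (Suc j))" "j + 4 = Suc (Suc (Suc (Suc j)))" by simp_all
  have U1: "u (j + 2) < th (N (Suc j))" using next_reaches[of j] U0 by simp
  have V: "v (Suc (Suc j)) \<le> th (N j)" "v (Suc (Suc j)) \<le> th (N (Suc j))"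
    using V_of_U[of j] V_of_U[of "Suc j"] U0 U1 by simp_all
  define r0 r1 r2 r3 r4 where r: "r0 = N j" "r1 = N (Suc j)" "r2 = N (Suc (Suc j))" "r3 = N (Suc (Suc (Suc j)))"
    "r4 = N (Suc (Suc (Suc (Suc j))))"
  define u0 u1 u2 u3 u4 where us: "u0 = u j" "u1 = u (Suc j)" "u2 = u (Suc (Suc j))" "u3 = u (Suc (Suc (Suc j)))"
    "u4 = u (Suc (Suc (Suc (Suc j))))"
  define v0 v1 v2 v3 v4 where vs: "v0 = v j" "v1 = v (Suc j)" "v2 = v (Suc (Suc j))" "v3 = v (Suc (Suc (Suc j)))"
    "v4 = v (Suc (Suc (Suc (Suc j))))"
  have lohis: "u0 = lo r0" "u1 = lo r1" "u2 = lo r2" "u3 = lo r3" "u4 = lo r4"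
     "v0 = hi r0" "v1 = hi r1" "v2 = hi r2" "v3 = hi r3" "v4 = hi r4"
    by (simp_all add: us vs r u_def v_def)
  have rr: "r0 < r1" "r1 < r2" "r2 < r3" "r3 < r4" unfolding r by (rule N_Suc(1))+
  have n3: "n = r3" by (simp add: n_def E r)
  have o: "u0 < v0" "v0 \<le> u1" "u1 < v1" "v1 \<le> u2" "u2 < v2" "v2 \<le> u3" "u3 < v3" "v3 \<le> u4" "u4 < v4"
    unfolding us vs by (rule uv N_Suc(2))+
  have tn: "tl r3 = u2" "th r3 = v4" using T_n n3 by (simp_all add: us vs E)
  have V': "v2 \<le> th r0" "v2 \<le> th r1" using V by (simp_all add: vs r)
  define s1 s2 s3 where s: "s1 = r1 - r0" "s2 = r2 - r1" "s3 = r3 - r2"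
  have sr: "r0 + s1 = r1" "r1 + s2 = r2" "r2 + s3 = r3" "1 \<le> s2" "1 \<le> s3" using rr s by auto
  have Th: "tl r0 < u0" "tl r1 < u1" "tl r2 < u2" using T_H[of r0] T_H[of r1] T_H[of r2] rr n3 lohis by auto
  have inc0: "\<And>x y. tl r0 \<le> x \<Longrightarrow> x < y \<Longrightarrow> y \<le> th r0 \<Longrightarrow> (f ^^ s1) x < (f ^^ s1) y"
    using step_inc[of j s1] V s r by simp
  have inc1: "\<And>x y. tl r1 \<le> x \<Longrightarrow> x < y \<Longrightarrow> y \<le> th r1 \<Longrightarrow> (f ^^ s2) x < (f ^^ s2) y"
    using step_inc[of "Suc j" s2] V s r by simp
  have gt0: "z < (f ^^ s1) z" if "u0 \<le> z" "z \<le> th r0" for z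
    by (rule step_gt[of j s1]) (use inc0 that s r us in auto)
  have gt1: "z < (f ^^ s2) z" if "u1 \<le> z" "z \<le> th r1" for z
    by (rule step_gt[of "Suc j" s2]) (use inc1 that s r us in auto)
  have s21: "s2 \<le> s1"
  proof -
    have "v1 < hi (r1 + s1)" using gt0[of v1] H_end'(4)[of s1 r1] o V' lohis by auto
    then have "r2 \<le> r1 + s1" using rec_ge[of "r1 + s1" "Suc j"] rr by (simp add: vs r)
    then show ?thesis using sr by simp
  qed
  have s32: "s3 \<le> s2"
  proof -
    have "v2 < hi (r2 + s2)" using gt1[of v2] H_end'(4)[of s2 r2] o V' lohis by auto
    then have "r3 \<le> r2 + s2" using rec_ge[of "r2 + s2" "Suc (Suc j)"] rr by (simp add: vs r)
    then show ?thesis using sr by simp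
  qed
  \<comment> \<open>A strictly shorter time difference would give a periodic orbit that stays below \<open>u1\<close> and starts in an interval that is lifted above \<open>u2\<close>.\<close>
  have e1: "s2 = s1"
  proof (rule ccontr)
    assume "s2 \<noteq> s1"
    then have lt: "s2 < s1" using s21 by simp
    have "free s2 u0 v1" by (rule free_sub[OF T_free[of r0 s1]]) (use sr rr n3 Th o V' lt in auto)
    then obtain z where z: "v0 < z" "z < u1" "\<And>t. (f ^^ t) z \<le> u1"
      using fix_orbit[of s2 j] lt sr unfolding us vs r by auto
    have "tl (r0 + (r3 - r0)) < (f ^^ (r3 - r0)) z"
      by (rule T_map(1)) (use z o Th V' n3 rr in auto)
    then show False using z(3)[of "r3 - r0"] rr tn o by simp
  qed
  have e2: "s3 = s2"
  proof (rule ccontr)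
    assume "s3 \<noteq> s2"
    then have lt: "s3 < s2" using s32 by simp
    have "free s3 u1 v2" by (rule free_sub[OF T_free[of r1 s2]]) (use sr rr n3 Th o V' lt in auto)
    then obtain z where z: "v1 < z" "z < u2" "\<And>t. (f ^^ t) z \<le> u2"
      using fix_orbit[of s3 "Suc j"] lt sr unfolding us vs r by auto
    have "tl (r1 + (r3 - r1)) < (f ^^ (r3 - r1)) z"
      by (rule T_map(1)) (use z o Th V' n3 rr in auto)
    then show False using z(3)[of "r3 - r1"] rr tn by simp
  qed
  have fv2: "(f ^^ s2) v2 = v3"
  proof -
    have "(f ^^ s1) u2 < (f ^^ s1) v2" using inc0[of u2 v2] Th o V' by linarith
    then show ?thesis using H_end(1)[of s2 r2] H_end(2)[of s2 r2] lohi[of r3] e1 e2 sr lohis by auto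
  qed
  have V3: "v3 \<le> th r1" using T_mapc(2)[of r0 v2 s1] Th o V' sr rr n3 fv2 e1 by auto
  have s43: "r4 \<le> r3 + s2"
  proof -
    have "v3 < hi (r3 + s2)" using gt1[of v3] H_end'(4)[of s2 r3] o V3 lohis by auto
    then show ?thesis using rec_ge[of "r3 + s2" "Suc (Suc (Suc j))"] rr by (simp add: vs r)
  qed
  have e3: "r4 = r3 + s2"
  proof (rule ccontr)
    assume "r4 \<noteq> r3 + s2"
    define s4 where "s4 = r4 - r3"
    have lt: "s4 < s2" "r4 = r3 + s4" "1 \<le> s4" using \<open>r4 \<noteq> r3 + s2\<close> s43 rr by (auto simp: s4_def)
    have "free s4 u2 v3" by (rule free_sub[OF T_free[of r1 s2]]) (use sr rr n3 Th o V3 lt in auto)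
    then obtain z where z: "v2 < z" "z < u3" "\<And>t. (f ^^ t) z \<le> u3"
      using fix_orbit[of s4 "Suc (Suc j)"] lt sr e2 unfolding us vs r by auto
    have "(f ^^ s2) v2 < (f ^^ s2) z" by (rule inc1) (use z o Th V3 in auto)
    then show False using z(3)[of s2] fv2 o by simp
  qed
  have fv3: "(f ^^ s2) v3 = v4"
  proof -
    have "(f ^^ s2) u3 < (f ^^ s2) v3" using inc1[of u3 v3] Th o V3 by linarith
    then show ?thesis using H_end(1)[of s2 r3] H_end(2)[of s2 r3] lohi[of r4] e3 lohis by auto
  qed
  have V4: "v4 \<le> th r2" using T_mapc(2)[of r1 v3 s2] Th o V3 sr rr n3 fv3 by auto
  have inc2: "\<And>x y. tl r2 \<le> x \<Longrightarrow> x < y \<Longrightarrow> y \<le> th r2 \<Longrightarrow> (f ^^ s3) x < (f ^^ s3) y"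
  proof -
    have "smono (f ^^ s3) (tl r2) (th r2)" by (rule free_smono, rule T_free) (use sr n3 in auto)
    moreover have "(f ^^ s3) v2 < (f ^^ s3) v3" using fv2 fv3 e2 o by simp
    moreover have "tl r2 \<le> v2" "v2 < v3" "v3 \<le> th r2" using Th o V4 by linarith+
    ultimately show "\<And>x y. tl r2 \<le> x \<Longrightarrow> x < y \<Longrightarrow> y \<le> th r2 \<Longrightarrow> (f ^^ s3) x < (f ^^ s3) y"
      unfolding smono_def by (meson less_asym)
  qed
  have "v4 < (f ^^ s3) v4"
    by (rule step_gt[of "Suc (Suc j)" s3]) (use inc2 s r us o V4 in auto)
  moreover have "(f ^^ s3) v4 \<le> th (r2 + s3)"
    by (rule T_mapc(2)) (use V4 Th o sr n3 in auto)
  ultimately show False using sr tn by simp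
qed

text \<open>If \<open>x\<close> lies in the \<open>k\<^sub>0\<close>-th and in the \<open>l\<close>-th interval with \<open>k\<^sub>0 < l\<close>, moving both forward by \<open>n - l\<close>
shows that the interval at time \<open>k\<^sub>0 + n - l\<close> meets the window. By the preceding lemmas this
time is one of the last two record times before \<open>n\<close>, leaving two values for \<open>l\<close>.\<close>

lemma overlap_le_3: "card {k \<in> {1..n}. tl k < x \<and> x < th k} \<le> 3"
proof -
  define S where "S = {k \<in> {1..n}. tl k < x \<and> x < th k}"
  have fin: "finite S" by (simp add: S_def)
  show ?thesis
  proof (cases "S = {}")
    case True then show ?thesis unfolding S_def[symmetric] by simp
  next
    case False
    define k0 where "k0 = Min S"
    have k0: "k0 \<in> S" "\<And>l. l \<in> S \<Longrightarrow> k0 \<le> l" unfolding k0_def using fin False by auto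
    have "l \<in> {k0, k0 + n - N (j + 1), k0 + n - N (j + 2)}" if l: "l \<in> S" for l
    proof (cases "l = k0")
      case False
      then have lt: "k0 < l" "l \<le> n" "1 \<le> k0" using k0(2)[OF l] l k0(1) by (auto simp: S_def)
      have y1: "(f ^^ (n - l)) x < th (k0 + (n - l))"
        by (rule T_map(2)) (use k0(1) lt in \<open>auto simp: S_def\<close>)
      have "tl (l + (n - l)) < (f ^^ (n - l)) x"
        by (rule T_map(1)) (use l lt in \<open>auto simp: S_def\<close>)
      then have U: "u (j + 2) < th (k0 + (n - l))" using y1 lt T_n by simp
      have "1 \<le> k0 + (n - l)" "k0 + (n - l) < n" using lt by linarith+
      then obtain e where e: "e \<le> j + 2" "k0 + (n - l) = N e" using T_meet[OF _ _ U] by blast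
      have "\<not> e \<le> j" using reaches_on[of e] no_deep U e by auto
      then have "e = j + 1 \<or> e = j + 2" using e by linarith
      then show ?thesis using e(2) lt Nn[of e] e(1) by auto
    qed simp
    then have "S \<subseteq> {k0, k0 + n - N (j + 1), k0 + n - N (j + 2)}" by blast
    then have "card S \<le> card {k0, k0 + n - N (j + 1), k0 + n - N (j + 2)}" by (rule card_mono[rotated]) simp
    also have "\<dots> \<le> 3" by (simp add: card_insert_if)
    finally show ?thesis unfolding S_def .
  qed
qed

end

text \<open>Integrate the sum of the indicator functions.\<close>

lemma sum_intervals_le:
  fixes l r :: "'i \<Rightarrow> real"
  assumes fin: "finite S" and lr: "\<And>k. k \<in> S \<Longrightarrow> 0 \<le> l k \<and> l k \<le> r k \<and> r k \<le> 1"
    and mult: "\<And>x. card {k \<in> S. l k < x \<and> x < r k} \<le> m"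
  shows "(\<Sum>k\<in>S. r k - l k) \<le> real m"
proof -
  have int: "integrable lborel (indicator {l k<..<r k} :: real \<Rightarrow> real)" for k
    by (cases "l k \<le> r k") (auto simp: emeasure_lborel_box_eq)
  have pt: "(\<Sum>k\<in>S. indicator {l k<..<r k} x) \<le> real m * indicator {0..1} x" for x :: real
  proof -
    have "(\<Sum>k\<in>S. indicator {l k<..<r k} x) = (\<Sum>k\<in>S. if l k < x \<and> x < r k then 1 else (0::real))"
      by (intro sum.cong) (auto simp: indicator_def)
    also have "\<dots> = real (card {k \<in> S. l k < x \<and> x < r k})"
      using fin by (simp add: sum.If_cases Int_def)
    finally have e: "(\<Sum>k\<in>S. indicator {l k<..<r k} x) = real (card {k \<in> S. l k < x \<and> x < r k})" .
    show ?thesis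
    proof (cases "x \<in> {0..1}")
      case True then show ?thesis using e mult[of x] by simp
    next
      case False
      then have "{k \<in> S. l k < x \<and> x < r k} = {}" using lr by force
      then show ?thesis using e False by simp
    qed
  qed
  have "(\<Sum>k\<in>S. r k - l k) = (\<Sum>k\<in>S. \<integral>x. indicator {l k<..<r k} x \<partial>lborel)"
    by (intro sum.cong) (use lr in auto)
  also have "\<dots> = (\<integral>x. (\<Sum>k\<in>S. indicator {l k<..<r k} x) \<partial>lborel)"
    using int by (simp add: Bochner_Integration.integral_sum)
  also have "\<dots> \<le> (\<integral>x. real m * indicator {0..1} (x::real) \<partial>lborel)"
  proof (rule Bochner_Integration.integral_mono)
    show "integrable lborel (\<lambda>x. \<Sum>k\<in>S. indicator {l k<..<r k} x :: real)"
      using int by (intro Bochner_Integration.integrable_sum)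
    show "integrable lborel (\<lambda>x::real. real m * indicator {0..1} x)" by simp
  qed (rule pt)
  also have "\<dots> = real m" by simp
  finally show ?thesis .
qed

section \<open>Cross ratios, and accumulation of the orbit at the turning point\<close>

definition cross :: "real \<Rightarrow> real \<Rightarrow> real \<Rightarrow> real \<Rightarrow> real" where
  "cross a b x d = ((x - a) * (d - b)) / ((b - a) * (d - x))"

lemma cross_rev: "cross d x b a = cross a b x d"
proof -
  have "(b - d) * (a - x) = (x - a) * (d - b)" "(x - d) * (a - b) = (b - a) * (d - x)" by (auto simp: algebra_simps)
  then show ?thesis by (simp add: cross_def)
qed

text \<open>All the smoothness that the proof consumes: branches nearly expand cross ratios (\<open>cr\<close>), the
critical orders (\<open>powm\<close>, \<open>powp\<close>), and bounded distortion of slopes away from \<open>c\<close> (\<open>away\<close>).\<close>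

locale metric = fold +
  fixes K lm lp mm MM :: real
  assumes K0: "0 \<le> K" and lm1: "1 \<le> lm" and lp1: "1 \<le> lp" and mm0: "0 < mm"
    and cr: "\<And>a b x d. a < b \<Longrightarrow> b < x \<Longrightarrow> x < d \<Longrightarrow> 0 \<le> a \<Longrightarrow> d \<le> 1 \<Longrightarrow> d \<le> c \<or> c \<le> a \<Longrightarrow>
        exp (- K * (d - a)) * cross a b x d \<le> cross (f a) (f b) (f x) (f d)"
    and powm: "\<And>x. 0 \<le> x \<Longrightarrow> x \<le> c \<Longrightarrow> mm * (c - x) powr lm \<le> f c - f x \<and> f c - f x \<le> MM * (c - x) powr lm"
    and powp: "\<And>x. c \<le> x \<Longrightarrow> x \<le> 1 \<Longrightarrow> mm * (x - c) powr lp \<le> f c - f x \<and> f c - f x \<le> MM * (x - c) powr lp"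
    and away: "\<And>\<delta>. \<delta> > 0 \<Longrightarrow> \<exists>L\<ge>0. \<forall>p q r. (p < q \<and> q < r \<or> r < q \<and> q < p) \<and> p \<in> {0..1} \<and> r \<in> {0..1} \<and>
        (p \<le> c - \<delta> \<and> r \<le> c - \<delta> \<or> c + \<delta> \<le> p \<and> c + \<delta> \<le> r) \<longrightarrow>
        \<bar>f q - f p\<bar> * \<bar>r - q\<bar> \<le> exp (L * \<bar>r - p\<bar>) * \<bar>f r - f q\<bar> * \<bar>q - p\<bar>"
begin

lemma cross_nonneg: "a \<le> b \<Longrightarrow> b \<le> x \<Longrightarrow> x \<le> d \<Longrightarrow> 0 \<le> cross a b x d"
  unfolding cross_def by (auto intro!: divide_nonneg_nonneg mult_nonneg_nonneg)

lemma cross_it: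
  assumes "free n a d" "a < b" "b < x" "x < d"
  shows "exp (- K * (\<Sum>k<n. \<bar>(f ^^ k) d - (f ^^ k) a\<bar>)) * cross a b x d
    \<le> cross ((f ^^ n) a) ((f ^^ n) b) ((f ^^ n) x) ((f ^^ n) d)"
  using assms(1)
proof (induction n)
  case (Suc n)
  have frn: "free n a d" by (rule free_sub[OF Suc.prems]) (use assms in auto)
  let ?S = "\<Sum>k<n. \<bar>(f ^^ k) d - (f ^^ k) a\<bar>"
  let ?a = "(f ^^ n) a" and ?b = "(f ^^ n) b" and ?x = "(f ^^ n) x" and ?d = "(f ^^ n) d"
  have ad01: "a \<in> {0..1}" "d \<in> {0..1}" using assms unfolding free_def by auto
  have "exp (- K * \<bar>?d - ?a\<bar>) * cross ?a ?b ?x ?d \<le> cross (f ?a) (f ?b) (f ?x) (f ?d)"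
  proof -
    have side: "(?d \<le> c \<and> ?a \<le> c) \<or> (c \<le> ?a \<and> c \<le> ?d)"
      using free_side[OF Suc.prems] assms by auto
    have r01: "?a \<in> {0..1}" "?d \<in> {0..1}" using it_in ad01 by blast+
    from free_smono[OF frn] have "(?a < ?b \<and> ?b < ?x \<and> ?x < ?d) \<or> (?d < ?x \<and> ?x < ?b \<and> ?b < ?a)"
      unfolding smono_def using assms by auto
    then show ?thesis
    proof
      assume "?a < ?b \<and> ?b < ?x \<and> ?x < ?d"
      then show ?thesis using cr[of ?a ?b ?x ?d] side r01 by auto
    next
      assume h: "?d < ?x \<and> ?x < ?b \<and> ?b < ?a"
      then have "exp (- K * (?a - ?d)) * cross ?d ?x ?b ?a \<le> cross (f ?d) (f ?x) (f ?b) (f ?a)"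
        using cr[of ?d ?x ?b ?a] side r01 by auto
      then show ?thesis using h by (simp add: cross_rev)
    qed
  qed
  moreover have "exp (- K * \<bar>?d - ?a\<bar>) * (exp (- K * ?S) * cross a b x d) \<le> exp (- K * \<bar>?d - ?a\<bar>) * cross ?a ?b ?x ?d"
    using Suc.IH[OF frn] by (intro mult_left_mono) auto
  ultimately have "exp (- K * \<bar>?d - ?a\<bar>) * (exp (- K * ?S) * cross a b x d) \<le> cross (f ?a) (f ?b) (f ?x) (f ?d)"
    by linarith
  moreover have "exp (- K * (\<Sum>k<Suc n. \<bar>(f ^^ k) d - (f ^^ k) a\<bar>)) = exp (- K * \<bar>?d - ?a\<bar>) * exp (- K * ?S)"
    by (simp add: exp_add[symmetric] algebra_simps)
  ultimately show ?case by simp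
qed simp

end

locale wander_metric = wander + metric
begin

lemma sum_AB: "(\<Sum>k<n. B (M + k) - A (M + k)) \<le> 1"
proof -
  have "(\<Sum>k\<in>{..<n}. B (M + k) - A (M + k)) \<le> real 1"
  proof (rule sum_intervals_le)
    fix x
    have "{k \<in> {..<n}. A (M + k) < x \<and> x < B (M + k)} \<subseteq> {SOME k. A (M + k) < x \<and> x < B (M + k)}"
    proof
      fix k assume k: "k \<in> {k \<in> {..<n}. A (M + k) < x \<and> x < B (M + k)}"
      define k' where "k' = (SOME k. A (M + k) < x \<and> x < B (M + k))"
      have "A (M + k') < x \<and> x < B (M + k')" unfolding k'_def by (rule someI[of _ k]) (use k in auto)
      then have "k = k'" using disjAB[of "M + k" "M + k'"] k by force
      then show "k \<in> {SOME k. A (M + k) < x \<and> x < B (M + k)}" by (simp add: k'_def)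
    qed
    then show "card {k \<in> {..<n}. A (M + k) < x \<and> x < B (M + k)} \<le> 1"
      using card_mono[of "{SOME k. A (M + k) < x \<and> x < B (M + k)}"] by fastforce
  next
    fix k show "0 \<le> A (M + k) \<and> A (M + k) \<le> B (M + k) \<and> B (M + k) \<le> 1"
      using A_less[of "M + k"] A_ge[of "M + k"] B_le[of "M + k"] by linarith
  qed simp
  then show ?thesis by simp
qed

lemma AB_null: "(\<lambda>k. B k - A k) \<longlonglongrightarrow> 0"
proof (rule summable_LIMSEQ_zero)
  show "summable (\<lambda>k. B k - A k)"
  proof (rule summableI_nonneg_bounded)
    fix n show "0 \<le> B n - A n" using A_less[of n] by linarith
    show "(\<Sum>k<n. B k - A k) \<le> 1" using sum_AB[of 0 n] by simp
  qed
qed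

text \<open>The argument of Schwartz: if the orbit stayed away from \<open>c\<close>, slope distortion and
the summability of the lengths would allow every iterate to be extended monotonically to a fixed
larger interval, contradicting the maximality of the gap.\<close>

lemma accumulates_at_c: assumes d: "\<delta> > 0" shows "\<exists>m\<ge>M. \<bar>y m - c\<bar> < \<delta>"
proof (rule ccontr)
  assume "\<not> ?thesis"
  then have far: "\<delta> \<le> \<bar>y m - c\<bar>" if "M \<le> m" for m using that by force
  obtain M1 where M1: "\<And>m. M1 \<le> m \<Longrightarrow> B m - A m < \<delta> / 4"
    using order_tendstoD(2)[OF AB_null, of "\<delta> / 4"] d unfolding eventually_sequentially by auto
  obtain M0 where M0: "max M M1 \<le> M0" "0 < A M0" "B M0 < 1" using pick by blast
  define \<alpha> \<beta> where ab: "\<alpha> = A M0" "\<beta> = B M0"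
  have ab': "0 < \<alpha>" "\<alpha> < \<beta>" "\<beta> < 1" using M0 A_less[of M0] by (auto simp: ab)
  obtain L where L: "0 \<le> L" "\<And>p q r. (p < q \<and> q < r \<or> r < q \<and> q < p) \<Longrightarrow> p \<in> {0..1} \<Longrightarrow> r \<in> {0..1} \<Longrightarrow>
        (p \<le> c - \<delta>/2 \<and> r \<le> c - \<delta>/2 \<or> c + \<delta>/2 \<le> p \<and> c + \<delta>/2 \<le> r) \<Longrightarrow>
        \<bar>f q - f p\<bar> * \<bar>r - q\<bar> \<le> exp (L * \<bar>r - p\<bar>) * \<bar>f r - f q\<bar> * \<bar>q - p\<bar>"
    using away[of "\<delta>/2"] d by (metis half_gt_zero)
  define h where "h k = \<bar>(f ^^ k) \<beta> - (f ^^ k) \<alpha>\<bar>" for k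
  have inK: "(f ^^ k) x \<in> {A (M0 + k)..B (M0 + k)}" if "x \<in> {\<alpha>..\<beta>}" for x k
    using step[of x M0 k] that by (simp add: ab)
  have hle: "h k \<le> B (M0 + k) - A (M0 + k)" for k
    using inK[of \<alpha> k] inK[of \<beta> k] ab' by (auto simp: h_def)
  have hsum: "(\<Sum>k<n. 2 * h k) \<le> 2" for n
  proof -
    have "(\<Sum>k<n. h k) \<le> 1" using sum_mono[of "{..<n}" h "\<lambda>k. B (M0 + k) - A (M0 + k)"] hle sum_AB[of M0 n] by fastforce
    then show ?thesis by (simp add: sum_distrib_left[symmetric])
  qed
  have hpos: "0 < h k" for k
    using free_smono[OF freeAB[of k M0]] ab' unfolding smono_def h_def ab by fastforce
  \<comment> \<open>The extension is so short that, after the total distortion \<open>exp (2 * L)\<close>, its images are not longer than those of the gap.\<close>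
  define \<eta> where "\<eta> = min \<alpha> (exp (- 2 * L) * (\<beta> - \<alpha>))"
  have eta: "0 < \<eta>" "\<eta> \<le> \<alpha>" "\<eta> * exp (2 * L) \<le> \<beta> - \<alpha>"
  proof -
    show "0 < \<eta>" "\<eta> \<le> \<alpha>" using ab' by (auto simp: \<eta>_def)
    have "\<eta> * exp (2 * L) \<le> (exp (- 2 * L) * (\<beta> - \<alpha>)) * exp (2 * L)" by (intro mult_right_mono) (auto simp: \<eta>_def)
    also have "\<dots> = \<beta> - \<alpha>" by (simp add: exp_minus)
    finally show "\<eta> * exp (2 * L) \<le> \<beta> - \<alpha>" .
  qed
  define \<alpha>' where "\<alpha>' = \<alpha> - \<eta>"
  have a': "0 \<le> \<alpha>'" "\<alpha>' < \<alpha>" using eta by (auto simp: \<alpha>'_def)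
  have "free n \<alpha>' \<beta> \<and> (\<forall>x\<in>{\<alpha>'..\<alpha>}. \<bar>(f ^^ n) x - (f ^^ n) \<alpha>\<bar> * (\<beta> - \<alpha>) \<le> exp (L * (\<Sum>k<n. 2 * h k)) * (\<alpha> - x) * h n)" for n
  proof (induction n)
    case 0
    have "free 0 \<alpha>' \<beta>" using a' ab' by (simp add: free_def)
    then show ?case using ab' by (auto simp: h_def)
  next
    case (Suc n)
    then have frn: "free n \<alpha>' \<beta>" and IH: "\<And>x. x \<in> {\<alpha>'..\<alpha>} \<Longrightarrow> \<bar>(f ^^ n) x - (f ^^ n) \<alpha>\<bar> * (\<beta> - \<alpha>) \<le> exp (L * (\<Sum>k<n. 2 * h k)) * (\<alpha> - x) * h n"
      by blast+
    have small: "\<bar>(f ^^ n) x - (f ^^ n) \<alpha>\<bar> \<le> h n" if x: "x \<in> {\<alpha>'..\<alpha>}" for x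
    proof -
      have "exp (L * (\<Sum>k<n. 2 * h k)) \<le> exp (2 * L)" using hsum[of n] L(1) mult_left_mono[of "\<Sum>k<n. 2 * h k" 2 L] by simp
      moreover have "\<alpha> - x \<le> \<eta>" "0 \<le> \<alpha> - x" using x by (auto simp: \<alpha>'_def)
      ultimately have "exp (L * (\<Sum>k<n. 2 * h k)) * (\<alpha> - x) \<le> exp (2 * L) * \<eta>" by (intro mult_mono) auto
      also have "\<dots> \<le> \<beta> - \<alpha>" using eta by (simp add: mult.commute)
      finally have "exp (L * (\<Sum>k<n. 2 * h k)) * (\<alpha> - x) * h n \<le> (\<beta> - \<alpha>) * h n" using hpos[of n] by (intro mult_right_mono) auto
      with IH[OF x] have "\<bar>(f ^^ n) x - (f ^^ n) \<alpha>\<bar> * (\<beta> - \<alpha>) \<le> h n * (\<beta> - \<alpha>)" by (simp add: mult.commute)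
      then show ?thesis using ab' by simp
    qed
    have near: "\<bar>(f ^^ n) x - y (M0 + n)\<bar> \<le> \<delta> / 2" if x: "x \<in> {\<alpha>'..\<beta>}" for x
    proof -
      have 1: "B (M0 + n) - A (M0 + n) < \<delta> / 4" using M1[of "M0 + n"] M0 by simp
      have 2: "A (M0 + n) < y (M0 + n)" "y (M0 + n) < B (M0 + n)" by (rule A_less)+
      show ?thesis
      proof (cases "x \<le> \<alpha>")
        case True
        have "A (M0 + n) \<le> (f ^^ n) \<alpha>" "(f ^^ n) \<alpha> \<le> B (M0 + n)" using inK[of \<alpha> n] ab' by auto
        moreover have "\<bar>(f ^^ n) x - (f ^^ n) \<alpha>\<bar> \<le> h n" using small[of x] x True by auto
        ultimately show ?thesis using hle[of n] 1 2 by linarith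
      next
        case False
        then have "A (M0 + n) \<le> (f ^^ n) x" "(f ^^ n) x \<le> B (M0 + n)" using inK[of x n] x by auto
        then show ?thesis using 1 2 by linarith
      qed
    qed
    have far': "\<delta> \<le> \<bar>y (M0 + n) - c\<bar>" using far M0 by simp
    have side: "(\<forall>x\<in>{\<alpha>'..\<beta>}. (f ^^ n) x \<le> c - \<delta>/2) \<or> (\<forall>x\<in>{\<alpha>'..\<beta>}. c + \<delta>/2 \<le> (f ^^ n) x)"
    proof (cases "y (M0 + n) \<le> c")
      case True
      have "(f ^^ n) x \<le> c - \<delta>/2" if "x \<in> {\<alpha>'..\<beta>}" for x using near[OF that] far' True by linarith
      then show ?thesis by blast
    next
      case False
      have "c + \<delta>/2 \<le> (f ^^ n) x" if "x \<in> {\<alpha>'..\<beta>}" for x using near[OF that] far' False by linarith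
      then show ?thesis by blast
    qed
    have frS: "free (Suc n) \<alpha>' \<beta>"
    proof -
      have "(f ^^ n) x \<noteq> c" if x: "\<alpha>' < x" "x < \<beta>" for x
      proof -
        have "x \<in> {\<alpha>'..\<beta>}" using x by simp
        with side have "(f ^^ n) x \<le> c - \<delta>/2 \<or> c + \<delta>/2 \<le> (f ^^ n) x" by blast
        then show ?thesis using d by auto
      qed
      then show ?thesis using frn unfolding free_def less_Suc_eq by blast
    qed
    have "\<bar>(f ^^ Suc n) x - (f ^^ Suc n) \<alpha>\<bar> * (\<beta> - \<alpha>) \<le> exp (L * (\<Sum>k<Suc n. 2 * h k)) * (\<alpha> - x) * h (Suc n)"
      if x: "x \<in> {\<alpha>'..\<alpha>}" for x
    proof (cases "x = \<alpha>")
      case True then show ?thesis by simp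
    next
      case False
      let ?p = "(f ^^ n) x" and ?q = "(f ^^ n) \<alpha>" and ?r = "(f ^^ n) \<beta>"
      have xl: "\<alpha>' \<le> x" "x < \<alpha>" using x False by auto
      have ord: "?p < ?q \<and> ?q < ?r \<or> ?r < ?q \<and> ?q < ?p"
        using free_smono[OF frn] xl ab' unfolding smono_def by auto
      have p01: "?p \<in> {0..1}" "?r \<in> {0..1}" using it_in[of x n] it_in[of \<beta> n] xl a' ab' by auto
      have "\<bar>f ?q - f ?p\<bar> * \<bar>?r - ?q\<bar> \<le> exp (L * \<bar>?r - ?p\<bar>) * \<bar>f ?r - f ?q\<bar> * \<bar>?q - ?p\<bar>"
      proof (rule L(2)[OF ord p01])
        have "x \<in> {\<alpha>'..\<beta>}" "\<beta> \<in> {\<alpha>'..\<beta>}" using xl ab' a' by auto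
        with side show "?p \<le> c - \<delta>/2 \<and> ?r \<le> c - \<delta>/2 \<or> c + \<delta>/2 \<le> ?p \<and> c + \<delta>/2 \<le> ?r" by blast
      qed
      moreover have "exp (L * \<bar>?r - ?p\<bar>) \<le> exp (L * (2 * h n))"
      proof -
        have "\<bar>?r - ?p\<bar> \<le> 2 * h n" using small[OF x] abs_triangle_ineq[of "?r - ?q" "?q - ?p"] by (simp add: h_def abs_minus_commute)
        then show ?thesis using L(1) by (simp add: mult_left_mono)
      qed
      ultimately have s1: "\<bar>f ?q - f ?p\<bar> * h n \<le> exp (L * (2 * h n)) * h (Suc n) * \<bar>?q - ?p\<bar>"
        using mult_right_mono[of "exp (L * \<bar>?r - ?p\<bar>)" "exp (L * (2 * h n))" "\<bar>f ?r - f ?q\<bar> * \<bar>?q - ?p\<bar>"]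
        by (simp add: h_def mult.assoc)
      have "\<bar>f ?q - f ?p\<bar> * (\<beta> - \<alpha>) * h n = (\<bar>f ?q - f ?p\<bar> * h n) * (\<beta> - \<alpha>)" by simp
      also have "\<dots> \<le> (exp (L * (2 * h n)) * h (Suc n) * \<bar>?q - ?p\<bar>) * (\<beta> - \<alpha>)"
        using s1 ab' by (intro mult_right_mono) auto
      also have "\<dots> = exp (L * (2 * h n)) * h (Suc n) * (\<bar>?p - ?q\<bar> * (\<beta> - \<alpha>))" by (simp add: abs_minus_commute)
      also have "\<dots> \<le> exp (L * (2 * h n)) * h (Suc n) * (exp (L * (\<Sum>k<n. 2 * h k)) * (\<alpha> - x) * h n)"
        using IH[OF x] hpos[of "Suc n"] by (intro mult_left_mono) auto
      also have "\<dots> = exp (L * (\<Sum>k<Suc n. 2 * h k)) * (\<alpha> - x) * h (Suc n) * h n"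
        by (simp add: exp_add[symmetric] distrib_left mult_ac)
      finally show ?thesis using hpos[of n] by (simp add: abs_minus_commute)
    qed
    with frS show ?case by blast
  qed
  then have frall: "free n \<alpha>' \<beta>" for n by blast
  obtain p where p: "p \<in> precrit" "\<alpha>' < p" "p \<le> A M0" using A_approx[of \<alpha>' M0] a' M0 by (auto simp: ab)
  then obtain n where "(f ^^ n) p = c" unfolding precrit_def by blast
  with frall[of "Suc n"] p ab' show False unfolding free_def ab by auto
qed

end

section \<open>Records approach the critical value superexponentially\<close>

locale gap_metric = gap + metric
begin

definition h :: "nat \<Rightarrow> real" where "h i = v i - u i"

lemma h_pos: "0 < h i" using uv[of i] by (simp add: h_def)

lemma u_lim: "u \<longlonglongrightarrow> f c"
proof -
  have "(\<lambda>i. u (Suc i)) \<longlonglongrightarrow> f c"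
    by (rule tendsto_sandwich[OF _ _ v_lim LIMSEQ_Suc[OF v_lim]])
      (use N_Suc(2) uv less_imp_le in \<open>auto intro!: always_eventually\<close>)
  then show ?thesis by (simp add: filterlim_sequentially_Suc)
qed

lemma h_lim: "h \<longlonglongrightarrow> 0"
  using tendsto_diff[OF v_lim u_lim] by (simp add: h_def[abs_def])

text \<open>The two factors multiply to the cross ratio of a record inside the window spanned by its neighbours.
In the domain, the corresponding cross ratio is at least \<open>(b - a) / (a - p)\<close>, and \<open>p\<close> is as close to
\<open>a\<close> as desired because precritical points accumulate there.\<close>

lemma space_blowup:
  "\<exists>I. \<forall>j\<ge>I. C \<le> (1 + h (j + 3) / (u (j + 3) - u (j + 2))) * (1 + h (j + 3) / (v (j + 4) - v (j + 3)))"
proof -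
  define C' where "C' = max C 1"
  define e where "e = a - exp (- K * 4) * (b - a) / C'"
  have "e < a" using ab by (simp add: e_def C'_def)
  then obtain p0 k where p0: "0 \<le> p0" "e < p0" "p0 \<le> a" "(f ^^ k) p0 = c" using left by blast
  obtain q0 l where q0: "q0 \<le> 1" "b \<le> q0" "(f ^^ l) q0 = c" using right[of "b + 1"] by auto
  have main: "C \<le> (1 + h (j + 3) / (u (j + 3) - u (j + 2))) * (1 + h (j + 3) / (v (j + 4) - v (j + 3)))"
    if j: "k + l \<le> j" for j
  proof -
    have E: "j + 3 = Suc (j + 2)" "j + 4 = Suc (j + 3)" by simp_all
    have kl: "k < N (j + 3)" "l < N (j + 3)" using N_gt[of "j + 3"] j by auto
    have W: "v (j + 3) < v (j + 4)" "v (j + 4) \<le> f c"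
      using N_Suc(2)[of "j + 3", folded E(2)] uv[of "j + 4"] v_top[of "j + 4"] by linarith+
    have W': "v (Suc (j + 2)) < v (j + 4)" using W(1) by (simp only: E(1)[symmetric])
    have n': "N (j + 3) = N (Suc (j + 2))" by (simp only: E(1)[symmetric])
    obtain p q where pq: "p0 \<le> p" "p < a" "b < q" "q \<le> q0" "free (N (j + 3)) p q"
      "(f ^^ N (j + 3)) p = u (j + 2) \<or> (f ^^ N (j + 3)) p = v (j + 4)"
      "(f ^^ N (j + 3)) q = u (j + 2) \<or> (f ^^ N (j + 3)) q = v (j + 4)"
      "\<And>x. p < x \<Longrightarrow> x < q \<Longrightarrow> u (j + 2) < (f ^^ N (j + 3)) x \<and> (f ^^ N (j + 3)) x < v (j + 4)"
      by (rule pull_ex[OF W' W(2) n' p0(1) p0(3) p0(4) kl(1) q0(1) q0(2) q0(3) kl(2)]) (rule that)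
    interpret P: pull f c a b j p q
      by (unfold_locales; (rule pq(5) pq(2) pq(3) pq(6) pq(7)))
    have np: "P.n = N (j + 3)" by (simp add: P.n_def)
    let ?g = "f ^^ P.n"
    have sum4: "(\<Sum>k<P.n. \<bar>(f ^^ k) q - (f ^^ k) p\<bar>) \<le> 4"
    proof -
      have "(\<Sum>k<P.n. \<bar>(f ^^ k) q - (f ^^ k) p\<bar>) \<le> (\<Sum>k\<in>insert 0 {1..P.n}. \<bar>(f ^^ k) q - (f ^^ k) p\<bar>)"
        by (rule sum_mono2) auto
      also have "\<dots> = \<bar>q - p\<bar> + (\<Sum>k\<in>{1..P.n}. \<bar>(f ^^ k) q - (f ^^ k) p\<bar>)" by simp
      also have "(\<Sum>k\<in>{1..P.n}. \<bar>(f ^^ k) q - (f ^^ k) p\<bar>) = (\<Sum>k\<in>{1..P.n}. P.th k - P.tl k)"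
        by (intro sum.cong) (auto simp: P.th_def P.tl_def)
      also have "\<dots> \<le> real 3"
      proof (rule sum_intervals_le)
        fix k assume "k \<in> {1..P.n}"
        then show "0 \<le> P.tl k \<and> P.tl k \<le> P.th k \<and> P.th k \<le> 1"
          using P.T01[of k] P.tlth[of k] by auto
      qed (use P.overlap_le_3 in auto)
      finally show ?thesis using P.pq01 by auto
    qed
    have cr1: "exp (- K * (\<Sum>k<P.n. \<bar>(f ^^ k) q - (f ^^ k) p\<bar>)) * cross p a b q \<le> cross (?g p) (?g a) (?g b) (?g q)"
      by (rule cross_it) (use P.frn[of P.n] pq ab in auto)
    have crp: "(b - a) / (a - p) \<le> cross p a b q"
    proof -
      have "(b - a) / (a - p) \<le> (b - p) / (a - p)" using pq ab by (intro divide_right_mono) auto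
      also have "\<dots> \<le> (b - p) / (a - p) * ((q - a) / (q - b))"
        using pq ab mult_left_mono[of 1 "(q - a) / (q - b)" "(b - p) / (a - p)"] by auto
      finally show ?thesis by (simp add: cross_def)
    qed
    have img: "cross (?g p) (?g a) (?g b) (?g q) = cross (u (j + 2)) (u (j + 3)) (v (j + 3)) (v (j + 4))"
    proof -
      have ga: "?g a = u (j + 3) \<and> ?g b = v (j + 3) \<or> ?g a = v (j + 3) \<and> ?g b = u (j + 3)"
        unfolding np u_def v_def lo_def hi_def by (auto simp: min_def max_def)
      have o: "u (j + 2) < u (j + 3)" "u (j + 3) < v (j + 3)" "v (j + 3) < v (j + 4)"
        using uv[of "j + 2"] uv[of "j + 3"] N_Suc(2)[of "j + 2", folded E(1)] W by linarith+
      have ge: "?g p = u (j + 2) \<or> ?g p = v (j + 4)" "?g q = u (j + 2) \<or> ?g q = v (j + 4)" using pq np by auto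
      from free_smono[OF P.frn[OF order_refl]] have "(?g p < ?g a \<and> ?g a < ?g b \<and> ?g b < ?g q) \<or> (?g q < ?g b \<and> ?g b < ?g a \<and> ?g a < ?g p)"
        unfolding smono_def using pq ab by auto
      then show ?thesis
      proof
        assume i: "?g p < ?g a \<and> ?g a < ?g b \<and> ?g b < ?g q"
        then have "?g a = u (j + 3)" "?g b = v (j + 3)" using ga o by auto
        moreover have "?g p = u (j + 2)" "?g q = v (j + 4)" using ge i o calculation by auto
        ultimately show ?thesis by simp
      next
        assume i: "?g q < ?g b \<and> ?g b < ?g a \<and> ?g a < ?g p"
        then have "?g b = u (j + 3)" "?g a = v (j + 3)" using ga o by auto
        moreover have "?g q = u (j + 2)" "?g p = v (j + 4)" using ge i o calculation by auto
        ultimately show ?thesis by (simp add: cross_rev)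
      qed
    qed
    have "C' \<le> exp (- K * 4) * ((b - a) / (a - p))"
    proof -
      have "a - p \<le> exp (- K * 4) * (b - a) / C'" using p0(2) pq(1) by (simp add: e_def)
      then have "C' * (a - p) \<le> exp (- K * 4) * (b - a)" by (simp add: C'_def field_simps)
      then show ?thesis using pq(2) by (simp add: field_simps)
    qed
    also have "\<dots> \<le> exp (- K * (\<Sum>k<P.n. \<bar>(f ^^ k) q - (f ^^ k) p\<bar>)) * cross p a b q"
      using sum4 K0 crp pq ab by (intro mult_mono) (auto intro: mult_left_mono)
    also have "\<dots> \<le> cross (u (j + 2)) (u (j + 3)) (v (j + 3)) (v (j + 4))" using cr1 img by simp
    also have "\<dots> = (1 + h (j + 3) / (u (j + 3) - u (j + 2))) * (1 + h (j + 3) / (v (j + 4) - v (j + 3)))"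
    proof -
      have "u (j + 2) < u (j + 3)" "v (j + 3) < v (j + 4)"
        using uv[of "j + 2"] N_Suc(2)[of "j + 2", folded E(1)] W by linarith+
      then show ?thesis unfolding cross_def h_def by (simp add: field_simps)
    qed
    finally show ?thesis by (simp add: C'_def)
  qed
  then show ?thesis by blast
qed

text \<open>By the previous lemma each record is long compared with its distance to one of its neighbours. As the lengths tend to 0, there is a
record not longer than its predecessor; its left distance is then not small, so the right one is, and
therefore the next record is much shorter. The situation perpetuates itself, and the distances to
\<open>f c\<close> sum like a geometric series.\<close>

lemma records_near_top: assumes eps: "0 < \<epsilon>" shows "\<exists>I. \<forall>i\<ge>I. f c - v i \<le> \<epsilon> * h i"
proof -
  define d where "d = min (\<epsilon> / 2) (1 / 2)"
  have d: "0 < d" "d \<le> 1 / 2" "2 * d \<le> \<epsilon>" using eps by (auto simp: d_def)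
  define R where "R i = v (Suc i) - v i" for i
  define L where "L i = u (Suc i) - u i" for i
  have hR: "h (Suc i) \<le> R i" and hL: "h i \<le> L i" for i
    using N_Suc(2)[of i] uv[of i] by (auto simp: h_def R_def L_def)
  have RL: "0 < R i" "0 < L i" for i using hR[of i] hL[of i] h_pos[of i] h_pos[of "Suc i"] by linarith+
  obtain I where I: "\<And>j. I \<le> j \<Longrightarrow> (1 + 1 / d)\<^sup>2 + 1 \<le> (1 + h (j + 3) / (u (j + 3) - u (j + 2))) * (1 + h (j + 3) / (v (j + 4) - v (j + 3)))"
    using space_blowup[of "(1 + 1 / d)\<^sup>2 + 1"] by blast
  have alt: "L i < d * h (Suc i) \<or> R (Suc i) < d * h (Suc i)" if i: "I + 2 \<le> i" for i
  proof (rule ccontr)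
    assume "\<not> ?thesis"
    then have "h (Suc i) / L i \<le> 1 / d" "h (Suc i) / R (Suc i) \<le> 1 / d"
      using RL[of i] RL[of "Suc i"] d by (auto simp: field_simps)
    then have "(1 + h (Suc i) / L i) * (1 + h (Suc i) / R (Suc i)) \<le> (1 + 1 / d) * (1 + 1 / d)"
      using RL[of i] RL[of "Suc i"] d h_pos[of "Suc i"] by (intro mult_mono) auto
    moreover have "(1 + 1 / d)\<^sup>2 + 1 \<le> (1 + h (Suc i) / L i) * (1 + h (Suc i) / R (Suc i))"
    proof -
      obtain k where k: "i = k + 2" "I \<le> k" using that[of "i - 2"] i by auto
      then have e: "k + 3 = Suc i" "k + 2 = i" "k + 4 = Suc (Suc i)" by auto
      show ?thesis using I[OF k(2)] unfolding e L_def R_def .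
    qed
    ultimately show False by (simp add: power2_eq_square)
  qed
  obtain i1 where i1: "I + 2 \<le> i1" "h (Suc i1) \<le> h i1"
  proof -
    have "\<exists>i\<ge>I + 2. h (Suc i) \<le> h i"
    proof (rule ccontr)
      assume "\<not> ?thesis"
      then have up: "h i \<le> h (Suc i)" if "I + 2 \<le> i" for i using that by force
      have ge: "h (I + 2) \<le> h i" if "I + 2 \<le> i" for i
        using that
      proof (induction rule: dec_induct)
        case (step i) then show ?case using up[of i] by simp
      qed simp
      have "h (I + 2) \<le> 0" by (rule LIMSEQ_le_const[OF h_lim]) (use ge in blast)
      then show False using h_pos[of "I + 2"] by simp
    qed
    then show ?thesis using that by blast
  qed
  \<comment> \<open>Once a record is not longer than its predecessor, this persists, with small right distance.\<close>
  have shrink: "h (Suc i) \<le> h i \<and> R (Suc i) \<le> d * h (Suc i)" if "i1 \<le> i" for i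
    using that
  proof (induction rule: dec_induct)
    case base
    have "\<not> L i1 < d * h (Suc i1)"
    proof
      assume "L i1 < d * h (Suc i1)"
      moreover have "d * h (Suc i1) \<le> 1 * h (Suc i1)" using d h_pos[of "Suc i1"] by (intro mult_right_mono) auto
      ultimately show False using hL[of i1] i1 by simp
    qed
    then show ?case using alt[of i1] i1 by auto
  next
    case (step i)
    have dh: "d * h (Suc i) \<le> 1 * h (Suc i)" "d * h (Suc (Suc i)) \<le> 1 * h (Suc (Suc i))"
      using d h_pos[of "Suc i"] h_pos[of "Suc (Suc i)"] by (auto intro!: mult_right_mono)
    have le: "h (Suc (Suc i)) \<le> h (Suc i)" using hR[of "Suc i"] step dh by linarith
    have "\<not> L (Suc i) < d * h (Suc (Suc i))" using hL[of "Suc i"] le dh by linarith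
    then show ?case using alt[of "Suc i"] i1 step le by auto
  qed
  have tele: "v (i + k) - v i \<le> 2 * d * h i" if "Suc i1 \<le> i" for i k
    using that
  proof (induction k arbitrary: i)
    case 0 then show ?case using d h_pos[of i] by (simp add: less_imp_le)
  next
    case (Suc k)
    obtain i' where i': "i = Suc i'" "i1 \<le> i'" using Suc.prems by (cases i) auto
    have R: "R i \<le> d * h i" using shrink[OF i'(2)] i' by simp
    have "v (Suc i + k) - v (Suc i) \<le> 2 * d * h (Suc i)" using Suc.IH[of "Suc i"] Suc.prems by simp
    also have "\<dots> \<le> 2 * d * (d * h i)" using hR[of i] R d by (intro mult_left_mono) auto
    also have "\<dots> \<le> 2 * d * (1 / 2 * h i)" using d h_pos[of i] by (intro mult_left_mono mult_right_mono) auto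
    finally show ?case using R by (simp add: R_def)
  qed
  have "f c - v i \<le> \<epsilon> * h i" if i: "Suc i1 \<le> i" for i
  proof -
    have "(\<lambda>k. v (k + i)) \<longlonglongrightarrow> f c" by (rule LIMSEQ_ignore_initial_segment[OF v_lim])
    moreover have "v (k + i) \<le> v i + 2 * d * h i" for k using tele[OF i, of k] by (simp add: add.commute)
    ultimately have "f c \<le> v i + 2 * d * h i" using LIMSEQ_le_const2 by blast
    moreover have "2 * d * h i \<le> \<epsilon> * h i" using d h_pos[of i] by (intro mult_right_mono) auto
    ultimately show ?thesis by linarith
  qed
  then show ?thesis by blast
qed

end

section \<open>The passage from one record to the next\<close>

lemma cross_scale: "s \<noteq> 0 \<Longrightarrow> cross (s * (a - c)) (s * (b - c)) (s * (x - c)) (s * (d - c)) = cross a b x d"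
proof -
  assume s: "s \<noteq> 0"
  have "s * p - s * q = s * (p - q)" for p q :: real by (simp add: algebra_simps)
  then show ?thesis using s by (simp add: cross_def)
qed

context gap_metric begin

definition s :: "nat \<Rightarrow> nat" where "s j = N (Suc j) - N j"

text \<open>The passage from record \<open>j\<close> to record \<open>j + 1\<close> takes \<open>s j\<close> steps: a branch \<open>branch j\<close>, monotone near
the record, and one application of \<open>f\<close> near \<open>c\<close>. Applied to the record itself, the branch lands on the side of \<open>c\<close> given by
\<open>right_side j\<close>, and \<open>sdist j z\<close> is the signed distance of \<open>branch j z\<close> from \<open>c\<close>, positive on that side.\<close>

definition branch :: "nat \<Rightarrow> real \<Rightarrow> real" where "branch j = f ^^ (s j - 1)"

text \<open>The whole piece from the record up to the critical value comes back above \<open>u j\<close> after \<open>s j\<close> steps, as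
happens for renormalizable maps.\<close>

definition returning :: "nat \<Rightarrow> bool" where "returning j \<longleftrightarrow> (\<forall>x\<in>{v j..f c}. u j < (f ^^ s j) x)"
definition right_side :: "nat \<Rightarrow> bool" where "right_side j \<longleftrightarrow> c \<le> lo (N (Suc j) - 1)"
definition sdist :: "nat \<Rightarrow> real \<Rightarrow> real" where "sdist j z = (if right_side j then 1 else -1) * (branch j z - c)"
definition depth_v :: "nat \<Rightarrow> real" where "depth_v j = f c - v j"
definition depth_u :: "nat \<Rightarrow> real" where "depth_u j = f c - u j"
definition onside :: "bool \<Rightarrow> real \<Rightarrow> bool" where "onside si x \<longleftrightarrow> (if si then c \<le> x else x \<le> c)"

text \<open>The distance to \<open>c\<close> of the point at height \<open>f c - y\<close> on the side \<open>si\<close> (\<open>True\<close> for the right side); it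
behaves like \<open>y\<close> to the inverse of the critical order of that side.\<close>

definition radius :: "bool \<Rightarrow> real \<Rightarrow> real" where
  "radius si y = (THE d. 0 \<le> d \<and> (\<exists>x\<in>{0..1}. onside si x \<and> d = \<bar>x - c\<bar> \<and> f x = f c - y))"

lemma c01: "c \<in> {0..1}" using c0 c1 by auto
lemma fc01: "f c \<in> {0..1}" by (rule self[OF c01])

lemma far_iff: assumes "onside si x" "onside si y" "x \<in> {0..1}" "y \<in> {0..1}"
  shows "f y < f x \<longleftrightarrow> \<bar>x - c\<bar> < \<bar>y - c\<bar>"
proof (cases si)
  case True
  then show ?thesis using assms dec[of x y] dec[of y x] unfolding onside_def
    by (cases x y rule: linorder_cases) auto
next
  case False
  then show ?thesis using assms inc[of x y] inc[of y x] unfolding onside_def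
    by (cases x y rule: linorder_cases) auto
qed

lemma radius_eq: assumes "x \<in> {0..1}" "onside si x" shows "radius si (f c - f x) = \<bar>x - c\<bar>"
  unfolding radius_def
proof (rule the_equality)
  show "0 \<le> \<bar>x - c\<bar> \<and> (\<exists>x'\<in>{0..1}. onside si x' \<and> \<bar>x - c\<bar> = \<bar>x' - c\<bar> \<and> f x' = f c - (f c - f x))"
    using assms by auto
next
  fix d assume "0 \<le> d \<and> (\<exists>x'\<in>{0..1}. onside si x' \<and> d = \<bar>x' - c\<bar> \<and> f x' = f c - (f c - f x))"
  then obtain x' where x': "x' \<in> {0..1}" "onside si x'" "d = \<bar>x' - c\<bar>" "f x' = f x" by auto
  then show "d = \<bar>x - c\<bar>" using far_iff[of si x x'] far_iff[of si x' x] assms by auto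
qed

lemma s1: "1 \<le> s j" and sN: "N j + s j = N (Suc j)"
  using N_Suc(1)[of j] by (auto simp: s_def)

lemma branch_f: "f (branch j z) = (f ^^ s j) z"
  using s1[of j] unfolding branch_def by (cases "s j") auto

lemma branch_in: "z \<in> {0..1} \<Longrightarrow> branch j z \<in> {0..1}" unfolding branch_def by (rule it_in)

lemma idx_le: "1 \<le> m \<Longrightarrow> m < s j \<Longrightarrow> hi (N j + m) \<le> u j"
  using rec_lt[of "N j + m" j] sN[of j] N_ge[of j] by auto

lemma uv01: "0 \<le> u j" "u j < v j" "v j < f c" "v j \<le> 1"
  using lohi01(1)[of "N j"] uv[of j] v_top[of j] fc01 by (auto simp: u_def)

lemma fc1: "f c \<le> 1" using fc01 by simp

lemma on_h: assumes "z \<in> {u j..v j}" shows "u j < (f ^^ s j) z"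
proof -
  have "lo (N j + s j) \<le> (f ^^ s j) z" using H_mapc(1)[of "N j" z "s j"] assms by (auto simp: u_def v_def)
  then show ?thesis using sN[of j] N_Suc(2)[of j] uv[of j] by (simp add: u_def)
qed

text \<open>An earlier iterate lifting \<open>x\<close> above \<open>u j\<close> would meet the record at some \<open>z\<close> between; but the record stays
low for fewer than \<open>s j\<close> further steps, whereas \<open>z\<close> returns high by assumption.\<close>

lemma seg_low:
  assumes x: "x \<in> {0..1}" and m: "1 \<le> m" "m < s j"
    and high: "\<And>z. min x (u j) \<le> z \<Longrightarrow> z \<le> max x (v j) \<Longrightarrow> u j < (f ^^ s j) z"
  shows "(f ^^ m) x \<le> u j"
proof (rule ccontr)
  assume "\<not> ?thesis"
  then have hx: "u j < (f ^^ m) x" by simp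
  define w where "w = (u j + v j) / 2"
  have w: "u j < w" "w < v j" "w \<in> {0..1}" using uv01[of j] by (auto simp: w_def)
  have "(f ^^ m) w < hi (N j + m)" using H_map(2)[of "N j" w m] w by (simp add: u_def v_def)
  then have wl: "(f ^^ m) w < u j" using idx_le[OF m] by linarith
  define t where "t = (u j + min (v j) ((f ^^ m) x)) / 2"
  have t: "u j < t" "t < v j" "t < (f ^^ m) x" using hx uv01[of j] by (auto simp: t_def)
  obtain z where z: "min w x < z" "z < max w x" "(f ^^ m) z = t"
    using ivt[OF w(3) x, of m t] wl t by auto
  have "(f ^^ s j) z = (f ^^ (s j - m)) t" using it_diff[of m "s j" z] m z by simp
  also have "\<dots> < hi (N j + (s j - m))" using H_map(2)[of "N j" t "s j - m"] t by (simp add: u_def v_def)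
  also have "\<dots> \<le> u j" by (rule idx_le) (use m in auto)
  finally have "(f ^^ s j) z < u j" .
  moreover have "min x (u j) \<le> z" "z \<le> max x (v j)" using z w by auto
  ultimately show False using high[of z] by simp
qed

lemma seg_high:
  assumes "\<And>z. al < z \<Longrightarrow> z < u j \<Longrightarrow> u j < (f ^^ s j) z" "\<And>z. v j < z \<Longrightarrow> z < e \<Longrightarrow> u j < (f ^^ s j) z"
    and "al < z" "z < e"
  shows "u j < (f ^^ s j) z"
  using assms on_h[of z j] by (cases "z < u j"; cases "v j < z") auto

text \<open>All images of \<open>(al, e)\<close> at the times strictly between 0 and \<open>s j\<close> lie below \<open>u j\<close>, hence avoid \<open>f c\<close>, so the
branch is monotone. If two images overlapped, moving the common point forward would make it both low and, at
time \<open>s j\<close>, high; so the images are disjoint.\<close>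

lemma seg_free:
  assumes al: "0 \<le> al" "al < u j" and e: "v j < e" "e \<le> f c"
    and hl: "\<And>z. al < z \<Longrightarrow> z < u j \<Longrightarrow> u j < (f ^^ s j) z" and hr: "\<And>z. v j < z \<Longrightarrow> z < e \<Longrightarrow> u j < (f ^^ s j) z"
  shows "\<And>x m. al < x \<Longrightarrow> x < e \<Longrightarrow> 1 \<le> m \<Longrightarrow> m < s j \<Longrightarrow> (f ^^ m) x \<le> u j"
    and "free (s j - 1) al e"
    and "(\<Sum>k<s j - 1. \<bar>(f ^^ k) e - (f ^^ k) al\<bar>) \<le> 1"
proof -
  have o: "u j < v j" "f c \<le> 1" using uv01[of j] fc1 by auto
  have high: "u j < (f ^^ s j) z" if "al < z" "z < e" for z
    by (rule seg_high[OF _ _ that]) (rule hl hr; assumption)+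
  show low: "(f ^^ m) x \<le> u j" if "al < x" "x < e" "1 \<le> m" "m < s j" for x m
  proof (rule seg_low[OF _ that(3,4)])
    show "x \<in> {0..1}" using that al e o by auto
    fix z assume "min x (u j) \<le> z" "z \<le> max x (v j)"
    then show "u j < (f ^^ s j) z" using high[of z] that al e by auto
  qed
  show fr1: "free (s j - 1) al e"
    unfolding free_def
  proof (intro conjI allI impI)
    fix k x assume kx: "k < s j - 1" "al < x \<and> x < e"
    show "(f ^^ k) x \<noteq> c"
    proof
      assume "(f ^^ k) x = c"
      then have "(f ^^ Suc k) x = f c" by simp
      moreover have "Suc k < s j" using kx(1) by linarith
      ultimately show False using low[of x "Suc k"] kx uv01[of j] by auto
    qed
  qed (use al e o in auto)
  have ae: "al < e" "al \<in> {0..1}" "e \<in> {0..1}" using al e o by auto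
  have frk: "free k al e" if "k < s j" for k
    by (rule free_sub[OF fr1]) (use that ae in auto)
  have ex: "\<exists>x'. al < x' \<and> x' < e \<and> (f ^^ k) x' = t" 
    if t: "min ((f ^^ k) al) ((f ^^ k) e) < t" "t < max ((f ^^ k) al) ((f ^^ k) e)" for k t
  proof (cases "(f ^^ k) al \<le> (f ^^ k) e")
    case True
    with t have "(f ^^ k) al < t" "t < (f ^^ k) e" by auto
    from ivt[OF ae(2,3) this] obtain x' where "min al e < x'" "x' < max al e" "(f ^^ k) x' = t" .
    then show ?thesis using ae by auto
  next
    case False
    with t have "(f ^^ k) e < t" "t < (f ^^ k) al" by auto
    from ivt[OF ae(3,2) this] obtain x' where "min e al < x'" "x' < max e al" "(f ^^ k) x' = t" .
    then show ?thesis using ae by auto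
  qed
  let ?l = "\<lambda>k. min ((f ^^ k) al) ((f ^^ k) e)" and ?r = "\<lambda>k. max ((f ^^ k) al) ((f ^^ k) e)"
  have one: False if kl: "k < l" "l < s j - 1" and x: "?l k < x" "x < ?r k" "?l l < x" "x < ?r l" for k l x
  proof -
    obtain x1 where x1: "al < x1" "x1 < e" "(f ^^ k) x1 = x" using ex x by blast
    obtain x2 where x2: "al < x2" "x2 < e" "(f ^^ l) x2 = x" using ex x by blast
    have "(f ^^ (s j - l + k)) x1 = (f ^^ s j) x2"
    proof -
      have "(f ^^ (s j - l + k)) x1 = (f ^^ (s j - l)) x" unfolding it_add x1(3) ..
      also have "\<dots> = (f ^^ s j) x2" using it_diff[of l "s j" x2] kl x2 by simp
      finally show ?thesis .
    qed
    moreover have "u j < (f ^^ s j) x2" by (rule high) (use x2 in auto)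
    moreover have "(f ^^ (s j - l + k)) x1 \<le> u j" by (rule low) (use x1 kl in auto)
    ultimately show False by simp
  qed
  have "(\<Sum>k\<in>{..<s j - 1}. ?r k - ?l k) \<le> real 1"
  proof (rule sum_intervals_le)
    fix k show "0 \<le> ?l k \<and> ?l k \<le> ?r k \<and> ?r k \<le> 1" using it_in[OF ae(2), of k] it_in[OF ae(3), of k] by auto
  next
    fix x
    let ?S = "{k \<in> {..<s j - 1}. ?l k < x \<and> x < ?r k}"
    have "k = l" if "k \<in> ?S" "l \<in> ?S" for k l
    proof -
      have "\<not> k < l" "\<not> l < k" using one[of k l x] one[of l k x] that by blast+
      then show ?thesis by simp
    qed
    then show "card ?S \<le> 1" using card_le_Suc0_iff_eq[of ?S] by auto
  qed simp
  moreover have "(\<Sum>k<s j - 1. \<bar>(f ^^ k) e - (f ^^ k) al\<bar>) = (\<Sum>k\<in>{..<s j - 1}. ?r k - ?l k)"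
    by (intro sum.cong) auto
  ultimately show "(\<Sum>k<s j - 1. \<bar>(f ^^ k) e - (f ^^ k) al\<bar>) \<le> 1" by simp
qed

lemma seg_cross:
  assumes al: "0 \<le> al" "al < u j" and e: "v j < e" "e \<le> f c"
    and hl: "\<And>z. al < z \<Longrightarrow> z < u j \<Longrightarrow> u j < (f ^^ s j) z" and hr: "\<And>z. v j < z \<Longrightarrow> z < e \<Longrightarrow> u j < (f ^^ s j) z"
    and xy: "al < x" "x < y" "y < e"
  shows "exp (- K) * cross al x y e \<le> cross (sdist j al) (sdist j x) (sdist j y) (sdist j e)"
proof -
  have "exp (- K) \<le> exp (- K * (\<Sum>k<s j - 1. \<bar>(f ^^ k) e - (f ^^ k) al\<bar>))"
    using seg_free(3)[OF al e hl hr] K0 mult_left_mono[of "(\<Sum>k<s j - 1. \<bar>(f ^^ k) e - (f ^^ k) al\<bar>)" 1 K] by auto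
  moreover have "0 \<le> cross al x y e" using xy by (intro cross_nonneg) auto
  ultimately have "exp (- K) * cross al x y e \<le> exp (- K * (\<Sum>k<s j - 1. \<bar>(f ^^ k) e - (f ^^ k) al\<bar>)) * cross al x y e"
    by (rule mult_right_mono)
  also have "\<dots> \<le> cross (branch j al) (branch j x) (branch j y) (branch j e)"
    unfolding branch_def by (rule cross_it[OF seg_free(2)[OF al e hl hr] xy])
  also have "\<dots> = cross (sdist j al) (sdist j x) (sdist j y) (sdist j e)"
    unfolding sdist_def by (rule cross_scale[symmetric]) auto
  finally show ?thesis .
qed

text \<open>One of the two preceding records is not mapped to record \<open>j\<close> by \<open>f ^^ s j\<close>, so it is mapped below \<open>u j\<close>:
the graph must cross the level \<open>u j\<close> on the left of the record. The number 2 serves as an upper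
bound which is never attained.\<close>

lemma al_ex: assumes "2 \<le> j"
  obtains al where "0 \<le> al" "al < u j" "(f ^^ s j) al = u j" "\<And>z. al < z \<Longrightarrow> z < u j \<Longrightarrow> u j < (f ^^ s j) z"
proof -
  obtain i where i: "i < j" "N i + s j \<noteq> N j"
  proof -
    have "N (j - 2) < N (j - 1)" by (rule N_mono) (use assms in auto)
    then have "N (j - 1) + s j \<noteq> N j \<or> N (j - 2) + s j \<noteq> N j" by auto
    then show ?thesis using that[of "j - 1"] that[of "j - 2"] assms by auto
  qed
  have Ni: "N i + s j < N (Suc j)" using N_mono[OF i(1)] sN[of j] by linarith
  have low: "(f ^^ s j) (u i) \<le> u j"
    using H_end'(2)[of "s j" "N i"] rec_lt[OF _ Ni i(2)] N_ge[of i] by (simp add: u_def)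
  have uij: "0 \<le> u i" "u i \<le> u j" using uv01(1)[of i] u_mono[of i j] i by auto
  have hi1: "(f ^^ s j) x < 2" if "x \<in> {0..1}" for x using it_in[OF that, of "s j"] by auto
  have uj1: "u j \<in> {0..1}" using uv01[of j] by auto
  have "\<exists>p. u i \<le> p \<and> p < u j \<and> ((f ^^ s j) p = u j \<or> (f ^^ s j) p = 2) \<and> (\<forall>x. p < x \<longrightarrow> x \<le> u j \<longrightarrow> u j < (f ^^ s j) x \<and> (f ^^ s j) x < 2)"
  proof (rule last_exit[where ?p0.0 = 0 and g = "f ^^ s j" and U = "u j" and W = 2 and ?x0.0 = "u i" and a = "u j"])
    show "continuous_on {0..u j} (f ^^ s j)" using uj1 by (intro it_cont_sub) auto
    show "u j < (f ^^ s j) (u j)" using on_h[of "u j" j] uv01[of j] by auto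
    show "(f ^^ s j) (u j) < 2" by (rule hi1[OF uj1])
  qed (use low uij in auto)
  then obtain p where p: "u i \<le> p" "p < u j" "(f ^^ s j) p = u j \<or> (f ^^ s j) p = 2"
      "\<forall>x. p < x \<longrightarrow> x \<le> u j \<longrightarrow> u j < (f ^^ s j) x \<and> (f ^^ s j) x < 2" by blast
  have "(f ^^ s j) p = u j" using p(3) hi1[of p] p(1,2) uij uj1 by auto
  then show ?thesis using that[of p] p uij by auto
qed

lemma e_ex: assumes "\<not> returning j"
  obtains e where "v j < e" "e \<le> f c" "(f ^^ s j) e = u j" "\<And>z. v j < z \<Longrightarrow> z < e \<Longrightarrow> u j < (f ^^ s j) z"
proof -
  obtain x where x: "x \<in> {v j..f c}" "(f ^^ s j) x \<le> u j" using assms unfolding returning_def by force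
  have hi1: "(f ^^ s j) x < 2" if "x \<in> {0..1}" for x using it_in[OF that, of "s j"] by auto
  have o: "0 \<le> u j" "u j < v j" "v j < f c" "f c \<le> 1" by (rule uv01 fc1)+
  have "\<exists>q. q \<le> x \<and> v j < q \<and> ((f ^^ s j) q = u j \<or> (f ^^ s j) q = 2) \<and> (\<forall>z. v j \<le> z \<longrightarrow> z < q \<longrightarrow> u j < (f ^^ s j) z \<and> (f ^^ s j) z < 2)"
  proof (rule first_exit[where b = "v j" and ?q0.0 = "f c" and g = "f ^^ s j" and U = "u j" and W = 2 and ?x0.0 = x])
    show "continuous_on {v j..f c} (f ^^ s j)" using o by (intro it_cont_sub) auto
    show "u j < (f ^^ s j) (v j)" using on_h[of "v j" j] o by auto
    show "(f ^^ s j) (v j) < 2" by (rule hi1) (use o in auto)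
  qed (use x in auto)
  then obtain q where q: "q \<le> x" "v j < q" "(f ^^ s j) q = u j \<or> (f ^^ s j) q = 2"
    "\<forall>z. v j \<le> z \<longrightarrow> z < q \<longrightarrow> u j < (f ^^ s j) z \<and> (f ^^ s j) z < 2" by blast
  have "(f ^^ s j) q = u j" using q(3) hi1[of q] q(1,2) o x by auto
  then show ?thesis using that[of q] q x by auto
qed

lemma sdist_abs: "onside (right_side j) (branch j z) \<Longrightarrow> sdist j z = \<bar>branch j z - c\<bar>"
  and sdist_abs': "onside (\<not> right_side j) (branch j z) \<Longrightarrow> sdist j z = - \<bar>branch j z - c\<bar>"
  by (auto simp: sdist_def onside_def split: if_splits)

lemma sdist_side: "0 \<le> sdist j z \<longleftrightarrow> onside (right_side j) (branch j z)" "sdist j z \<le> 0 \<longleftrightarrow> onside (\<not> right_side j) (branch j z)"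
  by (auto simp: sdist_def onside_def)

lemma sdist_zero: "sdist j z = 0 \<longleftrightarrow> branch j z = c"
  by (auto simp: sdist_def)

lemma sdist_smono:
  assumes "free (s j - 1) al e" shows "smono (sdist j) al e"
  using free_smono[OF assms] unfolding smono_def sdist_def branch_def by auto

lemma sdist_cont: "0 \<le> a' \<Longrightarrow> b' \<le> 1 \<Longrightarrow> continuous_on {a'..b'} (sdist j)"
  unfolding sdist_def branch_def by (intro continuous_intros it_cont_sub)

lemma sdist_D: assumes "z \<in> {0..1}" "0 \<le> sdist j z" shows "sdist j z = radius (right_side j) (f c - (f ^^ s j) z)"
  using radius_eq[of "branch j z" "right_side j"] branch_in[OF assms(1)] sdist_side(1) assms(2) sdist_abs by (simp add: branch_f)

lemma sdist_D': assumes "z \<in> {0..1}" "sdist j z \<le> 0" shows "- sdist j z = radius (\<not> right_side j) (f c - (f ^^ s j) z)"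
  using radius_eq[of "branch j z" "\<not> right_side j"] branch_in[OF assms(1)] sdist_side(2) assms(2) sdist_abs' by (simp add: branch_f)

lemma level_pos:
  assumes "z \<in> {0..1}" "w \<in> {0..1}" "0 \<le> sdist j z" "0 \<le> sdist j w"
  shows "(f ^^ s j) w < (f ^^ s j) z \<longleftrightarrow> sdist j z < sdist j w"
  using far_iff[of "right_side j" "branch j z" "branch j w"] branch_in assms sdist_side(1) sdist_abs by (simp add: branch_f)

lemma level_neg:
  assumes "z \<in> {0..1}" "w \<in> {0..1}" "sdist j z \<le> 0" "sdist j w \<le> 0"
  shows "(f ^^ s j) w < (f ^^ s j) z \<longleftrightarrow> sdist j w < sdist j z"
  using far_iff[of "\<not> right_side j" "branch j z" "branch j w"] branch_in assms sdist_side(2) sdist_abs' by (simp add: branch_f)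

lemma Z_level:
  "(f ^^ s j) (u j) = u (Suc j) \<and> (f ^^ s j) (v j) = v (Suc j) \<or> (f ^^ s j) (u j) = v (Suc j) \<and> (f ^^ s j) (v j) = u (Suc j)"
proof -
  have "free (s j) (u j) (v j)" unfolding u_def v_def
    unfolding free_def
  proof (intro conjI allI impI)
    fix k x assume kx: "k < s j" "lo (N j) < x \<and> x < hi (N j)"
    then obtain z where "a < z" "z < b" "(f ^^ N j) z = x" using H_ex by blast
    then show "(f ^^ k) x \<noteq> c" using fr[of "Suc (k + N j)"] unfolding free_def by (metis it_add lessI)
  qed (use lohi01[of "N j"] lohi[of "N j"] in auto)
  then have "(f ^^ s j) (u j) \<noteq> (f ^^ s j) (v j)"
    using free_smono uv[of j] unfolding smono_def by fastforce
  then show ?thesis using H_end[of "s j" "N j"] sN[of j] by (auto simp: u_def v_def)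
qed

lemma Zside: assumes "z \<in> {u j..v j}" shows "0 < sdist j z"
proof -
  have idx: "N j + (s j - 1) = N (Suc j) - 1" using sN[of j] s1[of j] by simp
  have r: "lo (N (Suc j) - 1) \<le> branch j z" "branch j z \<le> hi (N (Suc j) - 1)"
    using H_mapc[of "N j" z "s j - 1"] assms idx by (auto simp: branch_def u_def v_def)
  have "c \<le> lo (N (Suc j) - 1) \<or> hi (N (Suc j) - 1) \<le> c"
  proof (rule ccontr)
    assume "\<not> ?thesis"
    then obtain z where "a < z" "z < b" "(f ^^ (N (Suc j) - 1)) z = c" using H_ex[of "N (Suc j) - 1" c] by force
    then show False using fr[of "Suc (N (Suc j) - 1)"] unfolding free_def by auto
  qed
  then have "0 \<le> sdist j z" using r by (auto simp: sdist_def right_side_def)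
  moreover have "(f ^^ s j) z < f c"
  proof -
    have "(f ^^ s j) z \<le> hi (N j + s j)" using H_mapc(2)[of "N j" z "s j"] assms by (auto simp: u_def v_def)
    then show ?thesis using sN[of j] v_top[of "Suc j"] by (simp add: v_def)
  qed
  then have "sdist j z \<noteq> 0" using sdist_zero branch_f[of j z] by auto
  ultimately show ?thesis by simp
qed

lemma h_in01: "z \<in> {u j..v j} \<Longrightarrow> z \<in> {0..1}" using uv01[of j] by auto

lemma Zvals:
  "min (sdist j (u j)) (sdist j (v j)) = radius (right_side j) (depth_v (Suc j))" "max (sdist j (u j)) (sdist j (v j)) = radius (right_side j) (depth_u (Suc j))"
  "0 < radius (right_side j) (depth_v (Suc j))" "radius (right_side j) (depth_v (Suc j)) < radius (right_side j) (depth_u (Suc j))"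
proof -
  have in_: "u j \<in> {u j..v j}" "v j \<in> {u j..v j}" using uv[of j] by auto
  note radius = sdist_D[OF h_in01[OF in_(1)] less_imp_le[OF Zside[OF in_(1)]]] sdist_D[OF h_in01[OF in_(2)] less_imp_le[OF Zside[OF in_(2)]]]
  note L = level_pos[OF h_in01[OF in_(1)] h_in01[OF in_(2)] less_imp_le[OF Zside[OF in_(1)]] less_imp_le[OF Zside[OF in_(2)]]]
    level_pos[OF h_in01[OF in_(2)] h_in01[OF in_(1)] less_imp_le[OF Zside[OF in_(2)]] less_imp_le[OF Zside[OF in_(1)]]]
  have uv': "u (Suc j) < v (Suc j)" by (rule uv)
  have pos: "0 < sdist j (u j)" "0 < sdist j (v j)" using Zside in_ by auto
  have "min (sdist j (u j)) (sdist j (v j)) = radius (right_side j) (depth_v (Suc j)) \<and> max (sdist j (u j)) (sdist j (v j)) = radius (right_side j) (depth_u (Suc j)) \<and>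
    radius (right_side j) (depth_v (Suc j)) < radius (right_side j) (depth_u (Suc j)) \<and> 0 < radius (right_side j) (depth_v (Suc j))"
    using Z_level[of j]
  proof
    assume h: "(f ^^ s j) (u j) = u (Suc j) \<and> (f ^^ s j) (v j) = v (Suc j)"
    then have "sdist j (v j) < sdist j (u j)" using L uv' by simp
    then show ?thesis using radius h pos by (simp add: depth_v_def depth_u_def)
  next
    assume h: "(f ^^ s j) (u j) = v (Suc j) \<and> (f ^^ s j) (v j) = u (Suc j)"
    then have "sdist j (u j) < sdist j (v j)" using L uv' by simp
    then show ?thesis using radius h pos by (simp add: depth_v_def depth_u_def)
  qed
  then show "min (sdist j (u j)) (sdist j (v j)) = radius (right_side j) (depth_v (Suc j))" "max (sdist j (u j)) (sdist j (v j)) = radius (right_side j) (depth_u (Suc j))"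
  "0 < radius (right_side j) (depth_v (Suc j))" "radius (right_side j) (depth_v (Suc j)) < radius (right_side j) (depth_u (Suc j))" by auto
qed

lemma high_ends: "z \<in> {0..1} \<Longrightarrow> (f ^^ s j) z = u j \<Longrightarrow> sdist j z \<noteq> 0"
  using sdist_zero branch_f[of j z] v_top[of j] uv[of j] by fastforce

lemma returning_high: "returning j \<Longrightarrow> z \<in> {u j..f c} \<Longrightarrow> u j < (f ^^ s j) z"
  using on_h[of z j] unfolding returning_def by (cases "z \<le> v j") auto

lemma some_wild: assumes "\<zeta> < f c" obtains w where "\<zeta> < w" "w < f c" "wild w"
proof -
  obtain k where "\<zeta> < u k" using order_tendstoD(1)[OF u_lim assms] by (auto simp: eventually_sequentially)
  moreover obtain w where "lo (N k) < w" "w < hi (N k)" "wild w" by (rule H_wild)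
  ultimately show ?thesis using that[of w] v_top[of k] by (auto simp: u_def v_def)
qed

text \<open>If the branch kept \<open>[u j, f c]\<close> on one side of \<open>c\<close>, then \<open>f ^^ s j\<close> would be monotone there and, as
\<open>j\<close> is returning, trap it. So \<open>c\<close> is crossed between the record and \<open>f c\<close>.\<close>

lemma returning_facts:
  assumes j: "2 \<le> j" and r: "returning j"
  obtains al where "0 \<le> al" "al < u j" "(f ^^ s j) al = u j" "\<And>z. al < z \<Longrightarrow> z < u j \<Longrightarrow> u j < (f ^^ s j) z"
    "\<And>x y. al \<le> x \<Longrightarrow> x < y \<Longrightarrow> y \<le> f c \<Longrightarrow> sdist j y < sdist j x"
    "sdist j al = radius (right_side j) (depth_u j)" "sdist j (u j) = radius (right_side j) (depth_u (Suc j))" "sdist j (v j) = radius (right_side j) (depth_v (Suc j))"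
    "sdist j (f c) < 0" "free (s j - 1) al (f c)"
proof -
  obtain al where al: "0 \<le> al" "al < u j" "(f ^^ s j) al = u j" and
    hl: "\<And>z. al < z \<Longrightarrow> z < u j \<Longrightarrow> u j < (f ^^ s j) z" using al_ex[OF j] by blast
  have hr: "u j < (f ^^ s j) z" if "v j < z" "z < f c" for z using r that unfolding returning_def by auto
  have o: "u j < v j" "v j < f c" "f c \<le> 1" "0 \<le> u j" using uv01[of j] fc1 by auto
  have fre: "free (s j - 1) al (f c)"
    by (rule seg_free(2)[OF al(1,2) o(2) order_refl]) (rule hl hr; assumption)+
  have sm: "smono (sdist j) al (f c)" by (rule sdist_smono[OF fre])
  have pos: "0 < sdist j (u j)" "0 < sdist j (v j)" using Zside[of "u j" j] Zside[of "v j" j] o by auto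
  have neg: "sdist j (f c) < 0"
  proof (rule ccontr)
    assume "\<not> ?thesis"
    then have nn: "0 \<le> sdist j (f c)" by simp
    have ps: "0 < sdist j z" if z: "u j \<le> z" "z < f c" for z
    proof (cases "z = u j")
      case False
      have "sdist j (u j) < sdist j z \<or> sdist j (f c) < sdist j z"
      proof (rule disjE[OF sm[unfolded smono_def]])
        assume H: "\<forall>x y. al \<le> x \<and> x < y \<and> y \<le> f c \<longrightarrow> sdist j x < sdist j y"
        show ?thesis using H[rule_format, of "u j" z] z al False by auto
      next
        assume H: "\<forall>x y. al \<le> x \<and> x < y \<and> y \<le> f c \<longrightarrow> sdist j y < sdist j x"
        show ?thesis using H[rule_format, of z "f c"] z al by auto
      qed
      then show ?thesis using nn pos by auto
    qed (use pos in simp)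
    have frs: "free (s j) (u j) (f c)"
    proof -
      have "(f ^^ k) x \<noteq> c" if k: "k < s j" and x: "u j < x" "x < f c" for k x
      proof (cases "k = s j - 1")
        case True then show ?thesis using ps[of x] x sdist_zero[of j x] by (auto simp: branch_def)
      next
        case False
        then have "k < s j - 1" using k by linarith
        then show ?thesis using fre x al unfolding free_def by auto
      qed
      then show ?thesis using o unfolding free_def by auto
    qed
    have map: "(f ^^ s j) x \<in> {u j..f c}" if x: "x \<in> {u j..f c}" for x
    proof -
      have x1: "x \<in> {0..1}" using x o by auto
      have "(f ^^ s j) x \<le> f c" using top_le[OF branch_in[OF x1, of j]] by (simp add: branch_f)
      then show ?thesis using returning_high[OF r x] by simp
    qed
    obtain w where "u j < w" "w < f c" "wild w" using some_wild[of "u j"] o by auto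
    then show False using no_trap[OF frs s1 map, of w] by auto
  qed
  have dec': "\<And>x y. al \<le> x \<Longrightarrow> x < y \<Longrightarrow> y \<le> f c \<Longrightarrow> sdist j y < sdist j x"
  proof -
    have "\<not> sdist j (u j) < sdist j (f c)" using neg pos by simp
    then show "\<And>x y. al \<le> x \<Longrightarrow> x < y \<Longrightarrow> y \<le> f c \<Longrightarrow> sdist j y < sdist j x"
      using sm o al unfolding smono_def by (meson less_imp_le less_trans order_refl)
  qed
  have "sdist j (v j) < sdist j (u j)" using dec'[of "u j" "v j"] al o by simp
  then have Zv: "sdist j (u j) = radius (right_side j) (depth_u (Suc j))" "sdist j (v j) = radius (right_side j) (depth_v (Suc j))"
    using Zvals(1,2)[of j] by auto
  have "sdist j (u j) < sdist j al" using dec'[of al "u j"] al o by simp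
  then have "sdist j al = radius (right_side j) (depth_u j)" using sdist_D[of al j] al pos o by (simp add: depth_u_def)
  with that[OF al hl dec' _ Zv neg fre] show ?thesis by blast
qed

lemma record_estimate_alg:
  fixes o' PA PB \<omega> :: real
  assumes "0 \<le> PA" "PA < PB" "PB \<le> o' / 2" "0 < PA + \<omega>"
  shows "((o' - PA) * (PB + \<omega>)) / ((o' - PB) * (PA + \<omega>)) \<le> 2 * ((PB + \<omega>) / (PA + \<omega>))"
proof -
  have "(o' - PA) / (o' - PB) \<le> 2" using assms by (simp add: field_simps)
  then have "(o' - PA) / (o' - PB) * ((PB + \<omega>) / (PA + \<omega>)) \<le> 2 * ((PB + \<omega>) / (PA + \<omega>))"
    using assms by (intro mult_right_mono) auto
  then show ?thesis by simp
qed

lemma dom_low: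
  assumes "al < u j" "v j < e" "e \<le> f c" shows "depth_u j / depth_v j \<le> cross al (u j) (v j) e"
proof -
  have o: "u j < v j" "v j < f c" using uv01[of j] by auto
  have "depth_u j / depth_v j \<le> (e - u j) / (e - v j)" using o assms mult_nonneg_nonneg[of "f c - e" "v j - u j"] unfolding depth_v_def depth_u_def by (simp add: field_simps)
  also have "\<dots> \<le> (v j - al) / (u j - al) * ((e - u j) / (e - v j))"
    using o assms mult_right_mono[of 1 "(v j - al) / (u j - al)" "(e - u j) / (e - v j)"] by auto
  finally show ?thesis by (simp add: cross_def)
qed

text \<open>The central inequality. In the domain take the record inside the maximal interval \<open>(al, e)\<close> that returns
above \<open>u j\<close>; its cross ratio is at least \<open>depth_u j / depth_v j\<close> because \<open>e \<le> f c\<close>. In the range take signed distances: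
the branch crosses \<open>c\<close>, one end is at radius \<open>radius (right_side j) (depth_u j)\<close> on the record's side and the
other at distance \<open>\<omega>\<close> on the opposite side. In the returning case \<open>e = f c\<close>.\<close>

lemma record_estimate:
  assumes j: "2 \<le> j" and half: "radius (right_side j) (depth_u (Suc j)) \<le> radius (right_side j) (depth_u j) / 2"
  obtains \<omega> where "0 \<le> \<omega>" "depth_u j / depth_v j * (radius (right_side j) (depth_v (Suc j)) + \<omega>) \<le> 2 * exp K * (radius (right_side j) (depth_u (Suc j)) + \<omega>)"
    "\<not> returning j \<Longrightarrow> \<omega> = radius (\<not> right_side j) (depth_u j)" "returning j \<Longrightarrow> \<omega> = - sdist j (f c)"
proof -
  let ?PA = "radius (right_side j) (depth_v (Suc j))" and ?PB = "radius (right_side j) (depth_u (Suc j))" and ?o = "radius (right_side j) (depth_u j)"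
  have P: "0 < ?PA" "?PA < ?PB" by (rule Zvals)+
  have fin: "depth_u j / depth_v j * (?PA + \<omega>) \<le> 2 * exp K * (?PB + \<omega>)"
    if w: "0 \<le> \<omega>" and e: "exp (- K) * (depth_u j / depth_v j) \<le> ((?o - ?PA) * (?PB + \<omega>)) / ((?o - ?PB) * (?PA + \<omega>))" for \<omega>
  proof -
    have "exp (- K) * (depth_u j / depth_v j) \<le> 2 * ((?PB + \<omega>) / (?PA + \<omega>))"
      using e record_estimate_alg[of ?PA ?PB ?o \<omega>] P w half by simp
    then have "exp K * (exp (- K) * (depth_u j / depth_v j)) \<le> exp K * (2 * ((?PB + \<omega>) / (?PA + \<omega>)))" by (intro mult_left_mono) auto
    then have "depth_u j / depth_v j \<le> 2 * exp K * ((?PB + \<omega>) / (?PA + \<omega>))" by (simp add: exp_minus field_simps)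
    then have "depth_u j / depth_v j * (?PA + \<omega>) \<le> 2 * exp K * ((?PB + \<omega>) / (?PA + \<omega>)) * (?PA + \<omega>)"
      using P w by (intro mult_right_mono) auto
    then show ?thesis using P w by simp
  qed
  show ?thesis
  proof (cases "returning j")
    case True
    obtain al where al: "0 \<le> al" "al < u j" "(f ^^ s j) al = u j" "\<And>z. al < z \<Longrightarrow> z < u j \<Longrightarrow> u j < (f ^^ s j) z"
      "sdist j al = ?o" "sdist j (u j) = ?PB" "sdist j (v j) = ?PA" "sdist j (f c) < 0" using returning_facts[OF j True] by metis
    have hr: "u j < (f ^^ s j) z" if "v j < z" "z < f c" for z using True that unfolding returning_def by auto
    have "exp (- K) * cross al (u j) (v j) (f c) \<le> cross (sdist j al) (sdist j (u j)) (sdist j (v j)) (sdist j (f c))"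
      by (rule seg_cross[OF al(1,2) uv01(3) order_refl]) (use al(4) hr al(2) uv01[of j] in auto)
    also have "\<dots> = ((?o - ?PA) * (?PB + - sdist j (f c))) / ((?o - ?PB) * (?PA + - sdist j (f c)))"
    proof -
      have "(?PA - ?o) * (sdist j (f c) - ?PB) = (?o - ?PA) * (?PB + - sdist j (f c))"
        "(?PB - ?o) * (sdist j (f c) - ?PA) = (?o - ?PB) * (?PA + - sdist j (f c))" by (auto simp: algebra_simps)
      then show ?thesis by (simp add: cross_def al)
    qed
    finally have "exp (- K) * (depth_u j / depth_v j) \<le> ((?o - ?PA) * (?PB + - sdist j (f c))) / ((?o - ?PB) * (?PA + - sdist j (f c)))"
      using mult_left_mono[OF dom_low[OF al(2) uv01(3)[of j] order_refl], of "exp (- K)"] by simp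
    from fin[OF _ this] al(8) True that[of "- sdist j (f c)"] show ?thesis by auto
  next
    case False
    obtain al where al: "0 \<le> al" "al < u j" "(f ^^ s j) al = u j" "\<And>z. al < z \<Longrightarrow> z < u j \<Longrightarrow> u j < (f ^^ s j) z"
      using al_ex[OF j] by blast
    obtain e where e: "v j < e" "e \<le> f c" "(f ^^ s j) e = u j" "\<And>z. v j < z \<Longrightarrow> z < e \<Longrightarrow> u j < (f ^^ s j) z"
      using e_ex[OF False] by blast
    have o: "u j < v j" "v j < f c" "f c \<le> 1" "0 \<le> u j" using uv01[of j] fc1 by auto
    have in1: "al \<in> {0..1}" "e \<in> {0..1}" using al e o by auto
    have fre: "free (s j - 1) al e"
      by (rule seg_free(2)[OF al(1,2) e(1,2)]) (rule al(4) e(4); assumption)+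
    have sm: "smono (sdist j) al e" by (rule sdist_smono[OF fre])
    have cr2: "exp (- K) * (depth_u j / depth_v j) \<le> cross (sdist j al) (sdist j (u j)) (sdist j (v j)) (sdist j e)"
    proof -
      have "exp (- K) * cross al (u j) (v j) e \<le> cross (sdist j al) (sdist j (u j)) (sdist j (v j)) (sdist j e)"
        by (rule seg_cross[OF al(1,2) e(1,2)]) (use al(4) e(4) al(2) o e(1) in auto)
      then show ?thesis using mult_left_mono[OF dom_low[OF al(2) e(1,2)], of "exp (- K)"] by simp
    qed
    have nz: "sdist j al \<noteq> 0" "sdist j e \<noteq> 0" using high_ends in1 al(3) e(3) by auto
    have alt: "(sdist j al < sdist j e \<and> sdist j (u j) < sdist j (v j)) \<or> (sdist j e < sdist j al \<and> sdist j (v j) < sdist j (u j))"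
    proof (rule disjE[OF sm[unfolded smono_def]])
      assume H: "\<forall>x y. al \<le> x \<and> x < y \<and> y \<le> e \<longrightarrow> sdist j x < sdist j y"
      show ?thesis using H[rule_format, of "u j" "v j"] H[rule_format, of al e] al(2) e(1) o by auto
    next
      assume H: "\<forall>x y. al \<le> x \<and> x < y \<and> y \<le> e \<longrightarrow> sdist j y < sdist j x"
      show ?thesis using H[rule_format, of "u j" "v j"] H[rule_format, of al e] al(2) e(1) o by auto
    qed
    have ne: "sdist j al \<noteq> sdist j e" using alt by auto
    have not_both: "\<not> (0 < sdist j al \<and> 0 < sdist j e)" "\<not> (sdist j al < 0 \<and> sdist j e < 0)"
      using level_pos[of al e j] level_pos[of e al j] level_neg[of al e j] level_neg[of e al j] in1 al(3) e(3) ne by auto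
    have posv: "sdist j z = ?o" if "z \<in> {al, e}" "0 < sdist j z" for z
      using sdist_D[of z j] that in1 al(3) e(3) by (auto simp: depth_u_def)
    have negv: "sdist j z = - radius (\<not> right_side j) (depth_u j)" if "z \<in> {al, e}" "sdist j z < 0" for z
      using sdist_D'[of z j] that in1 al(3) e(3) by (auto simp: depth_u_def)
    let ?w = "radius (\<not> right_side j) (depth_u j)"
    have "exp (- K) * (depth_u j / depth_v j) \<le> ((?o - ?PA) * (?PB + ?w)) / ((?o - ?PB) * (?PA + ?w)) \<and> 0 \<le> ?w"
    proof (cases "0 < sdist j al")
      case True
      then have v: "sdist j al = ?o" "sdist j e = - ?w" using posv negv nz not_both by (auto simp: not_less less_le)
      have w0: "0 \<le> ?w" using v(2) nz not_both True by auto
      have "sdist j (v j) < sdist j (u j)"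
        using alt v w0 P half by linarith
      then have "sdist j (u j) = ?PB" "sdist j (v j) = ?PA" using Zvals(1,2)[of j] by auto
      moreover have "(?PA - ?o) * (- ?w - ?PB) = (?o - ?PA) * (?PB + ?w)"
        "(?PB - ?o) * (- ?w - ?PA) = (?o - ?PB) * (?PA + ?w)" by (auto simp: algebra_simps)
      ultimately show ?thesis using cr2 v w0 by (simp add: cross_def)
    next
      case False
      then have v: "sdist j al = - ?w" "sdist j e = ?o" using posv negv nz not_both by (auto simp: not_less less_le)
      have w0: "0 \<le> ?w" using v(1) nz not_both False by auto
      have "sdist j (u j) < sdist j (v j)"
        using alt v w0 P half by linarith
      then have "sdist j (u j) = ?PA" "sdist j (v j) = ?PB" using Zvals(1,2)[of j] by auto
      moreover have "(?PB + ?w) * (?o - ?PA) = (?o - ?PA) * (?PB + ?w)"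
        "(?PA + ?w) * (?o - ?PB) = (?o - ?PB) * (?PA + ?w)" by (auto simp: algebra_simps)
      ultimately show ?thesis using cr2 v w0 by (simp add: cross_def mult.commute)
    qed
    with fin[of ?w] that[of ?w] False show ?thesis by blast
  qed
qed

end

section \<open>Returning records\<close>

text \<open>Normalise by \<open>l ^ k\<close>: the quantity \<open>(E + q) / l ^ k\<close> is nonnegative and decreasing, yet it drops by at
least 1 infinitely often, since \<open>Dd\<close> grows like \<open>l ^ k\<close>.\<close>

lemma growth_absurd:
  fixes Dd E :: "nat \<Rightarrow> real"
  assumes l: "1 < l" and c: "0 \<le> c" and E0: "\<And>j. J \<le> j \<Longrightarrow> 0 \<le> E j"
    and D1: "\<And>j. J \<le> j \<Longrightarrow> l * Dd j - c \<le> Dd (Suc j)"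
    and E1: "\<And>j. J \<le> j \<Longrightarrow> E (Suc j) \<le> l * E j + c"
    and E2: "\<And>m. \<exists>j\<ge>m. E (Suc j) \<le> l * E j - l * Dd j + c"
    and Dinf: "\<exists>j\<ge>J. c / (l - 1) + 1 \<le> Dd j"
  shows False
proof -
  define q where "q = c / (l - 1)"
  have q: "c + q = l * q" "0 \<le> q" using l c by (auto simp: q_def field_simps)
  obtain J1 where J1: "J \<le> J1" "q + 1 \<le> Dd J1" using Dinf by (auto simp: q_def)
  have Dg: "l ^ k + q \<le> Dd (J1 + k)" for k
  proof (induction k)
    case (Suc k)
    have "l * (l ^ k + q) \<le> l * Dd (J1 + k)" using Suc l by (intro mult_left_mono) auto
    moreover have "l * Dd (J1 + k) - c \<le> Dd (J1 + Suc k)" using D1[of "J1 + k"] J1 by simp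
    ultimately show ?case using q(1) by (simp add: algebra_simps)
  qed (use J1 in simp)
  define F where "F k = (E (J1 + k) + q) / l ^ k" for k
  have lk: "0 < l ^ k" for k using l by simp
  have F0: "0 \<le> F k" for k unfolding F_def using E0[of "J1 + k"] J1 q lk by (intro divide_nonneg_pos) auto
  have Fs: "F (Suc k) \<le> F k" for k
  proof -
    have "E (J1 + Suc k) + q \<le> l * (E (J1 + k) + q)" using E1[of "J1 + k"] J1 q(1) by (simp add: algebra_simps)
    then have "F (Suc k) \<le> (l * (E (J1 + k) + q)) / l ^ Suc k" unfolding F_def using lk[of "Suc k"] by (intro divide_right_mono) auto
    also have "\<dots> = F k" using l by (simp add: F_def)
    finally show ?thesis .
  qed
  have Fm: "F (k + i) \<le> F k" for k i
  proof (induction i)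
    case (Suc i) then show ?case using Fs[of "k + i"] by simp
  qed simp
  have Fd: "F (Suc k) \<le> F k - 1" if "E (Suc (J1 + k)) \<le> l * E (J1 + k) - l * Dd (J1 + k) + c" for k
  proof -
    have "l * (l ^ k) \<le> l * Dd (J1 + k)" using Dg[of k] q l by (intro mult_left_mono) auto
    then have "E (J1 + Suc k) + q \<le> l * (E (J1 + k) + q) - l ^ Suc k" using that q(1) by (simp add: algebra_simps)
    then have "F (Suc k) \<le> (l * (E (J1 + k) + q) - l ^ Suc k) / l ^ Suc k" unfolding F_def using lk[of "Suc k"] by (intro divide_right_mono) auto
    also have "\<dots> = F k - 1" using l by (simp add: F_def diff_divide_distrib)
    finally show ?thesis .
  qed
  have "\<exists>k. F k \<le> F 0 - real m" for m
  proof (induction m)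
    case 0 then show ?case by auto
  next
    case (Suc m)
    then obtain k where k: "F k \<le> F 0 - real m" by blast
    obtain j where j: "J1 + k \<le> j" "E (Suc j) \<le> l * E j - l * Dd j + c" using E2 by blast
    define i where "i = j - J1 - k"
    have ji: "j = J1 + (k + i)" using j by (simp add: i_def)
    have "F (Suc (k + i)) \<le> F (k + i) - 1" by (rule Fd) (use j ji in simp)
    then have "F (Suc (k + i)) \<le> F 0 - real (Suc m)" using Fm[of k i] k by simp
    then show ?case by blast
  qed
  moreover obtain m where "F 0 < real m" using reals_Archimedean2 by blast
  ultimately show False using F0 by (meson diff_less_0_iff_less dual_order.strict_trans1 not_le)
qed

context gap_metric begin

lemma returning_s_ge: assumes "returning j" shows "s j \<le> s (Suc j)"
proof (rule ccontr)
  assume lt: "\<not> s j \<le> s (Suc j)"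
  define z where "z = (u (Suc j) + v (Suc j)) / 2"
  have z: "u (Suc j) < z" "z < v (Suc j)" using uv[of "Suc j"] by (auto simp: z_def)
  have zz: "v j < z" "z < f c" using z N_Suc(2)[of j] v_top[of "Suc j"] by auto
  have "(f ^^ s (Suc j)) z \<le> u j"
  proof (rule seg_low)
    show "z \<in> {0..1}" using z uv01[of "Suc j"] by auto
    fix x assume "min z (u j) \<le> x" "x \<le> max z (v j)"
    then have "x \<in> {u j..f c}" using zz uv01[of j] by auto
    then show "u j < (f ^^ s j) x" by (rule returning_high[OF assms])
  qed (use lt s1[of "Suc j"] in auto)
  moreover have "u (Suc (Suc j)) < (f ^^ s (Suc j)) z"
    using H_map(1)[of "N (Suc j)" z "s (Suc j)"] z sN[of "Suc j"] by (simp add: u_def v_def)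
  ultimately show False using u_mono[of j "Suc (Suc j)"] by simp
qed

lemma returning_level: assumes "2 \<le> j" "returning j" shows "(f ^^ s j) (u j) = u (Suc j)"
proof -
  obtain al where al: "al < u j" "\<And>x y. al \<le> x \<Longrightarrow> x < y \<Longrightarrow> y \<le> f c \<Longrightarrow> sdist j y < sdist j x"
    using returning_facts[OF assms] by metis
  have "sdist j (v j) < sdist j (u j)" using al(2)[of "u j" "v j"] al(1) uv01[of j] by simp
  then have "(f ^^ s j) (u j) < (f ^^ s j) (v j)"
    using level_pos[of "v j" "u j" j] Zside[of "u j" j] Zside[of "v j" j] uv01[of j] by simp
  then show ?thesis using Z_level[of j] uv[of "Suc j"] by auto
qed

text \<open>If moreover \<open>f c\<close> returns above the next record, all of \<open>[v j, f c]\<close> does, and so does the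
next record itself. Thus the next passage takes the same time.\<close>

lemma returning_next:
  assumes j: "2 \<le> j" and r: "returning j" and x: "u (Suc j) < (f ^^ s j) (f c)"
  shows "s (Suc j) = s j" "returning (Suc j)"
proof -
  obtain al where al: "al < u j" "\<And>x y. al \<le> x \<Longrightarrow> x < y \<Longrightarrow> y \<le> f c \<Longrightarrow> sdist j y < sdist j x" "sdist j (f c) < 0"
    using returning_facts[OF j r] by metis
  have o: "u j < v j" "v j < f c" "0 \<le> u j" "f c \<le> 1" using uv01[of j] fc1 by auto
  have high: "u (Suc j) < (f ^^ s j) z" if z: "z \<in> {v j..f c}" for z
  proof (cases "0 \<le> sdist j z")
    case True
    have "sdist j z < sdist j (u j)" using al(1) al(2)[of "u j" z] z o by auto
    then show ?thesis using level_pos[of z "u j" j] True Zside[of "u j" j] o z returning_level[OF j r] by auto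
  next
    case False
    show ?thesis
    proof (cases "z = f c")
      case z: False
      then have "sdist j (f c) < sdist j z" using al(1) al(2)[of z "f c"] \<open>z \<in> _\<close> o by auto
      then have "(f ^^ s j) (f c) < (f ^^ s j) z" using level_neg[of z "f c" j] False al(3) o \<open>z \<in> _\<close> by auto
      then show ?thesis using x by simp
    qed (use x in simp)
  qed
  define z where "z = (u (Suc j) + v (Suc j)) / 2"
  have z: "u (Suc j) < z" "z < v (Suc j)" using uv[of "Suc j"] by (auto simp: z_def)
  have zz: "z \<in> {v j..f c}" using z N_Suc(2)[of j] v_top[of "Suc j"] by auto
  have "(f ^^ s j) z < hi (N (Suc j) + s j)" using H_map(2)[of "N (Suc j)" z "s j"] z by (simp add: u_def v_def)
  then have "u (Suc j) < hi (N (Suc j) + s j)" using high[OF zz] by simp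
  then have "N (Suc (Suc j)) \<le> N (Suc j) + s j" using rec_ge'[of "N (Suc j) + s j" "Suc j"] s1[of j] by auto
  then show seq: "s (Suc j) = s j" using returning_s_ge[OF r] sN[of "Suc j"] by linarith
  show "returning (Suc j)" unfolding returning_def seq using high N_Suc(2)[of j] uv[of "Suc j"] by auto
qed

text \<open>Otherwise \<open>f ^^ s j\<close> would map the piece between the preimage of \<open>c\<close> and \<open>f c\<close> monotonically into itself.\<close>

lemma returning_side:
  assumes j: "2 \<le> j" and r: "returning j"
  shows "0 \<le> sdist j ((f ^^ s j) (f c))"
proof (rule ccontr)
  assume neg: "\<not> ?thesis"
  obtain al where al: "0 \<le> al" "al < u j" "\<And>x y. al \<le> x \<Longrightarrow> x < y \<Longrightarrow> y \<le> f c \<Longrightarrow> sdist j y < sdist j x" "sdist j (f c) < 0" "free (s j - 1) al (f c)"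
    using returning_facts[OF j r] by metis
  have o: "u j < v j" "v j < f c" "0 \<le> u j" "f c \<le> 1" using uv01[of j] fc1 by auto
  have pv: "0 < sdist j (v j)" using Zside[of "v j" j] o by auto
  have "\<exists>z. v j \<le> z \<and> z \<le> f c \<and> sdist j z = 0"
    by (rule IVT2') (use pv al(4) o in \<open>auto intro!: sdist_cont\<close>)
  then obtain \<zeta> where z: "v j \<le> \<zeta>" "\<zeta> \<le> f c" "sdist j \<zeta> = 0" by blast
  have zs: "\<zeta> < f c" using z al(4) by (cases "\<zeta> = f c") auto
  let ?w = "(f ^^ s j) (f c)"
  have w: "u j < ?w" "?w \<le> f c"
    using returning_high[OF r, of "f c"] o top_le[OF branch_in[OF fc01, of j]] by (auto simp: branch_f)
  have zw: "\<zeta> < ?w"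
  proof (rule ccontr)
    assume "\<not> ?thesis"
    then have "sdist j \<zeta> \<le> sdist j ?w" using al(3)[of ?w \<zeta>] al(2) w z by (cases "?w = \<zeta>") auto
    with neg z show False by simp
  qed
  have ng: "sdist j x < 0" if "\<zeta> < x" "x \<le> f c" for x using al(3)[of \<zeta> x] al(2) o z that by auto
  have fre: "free (s j) \<zeta> (f c)"
  proof -
    have "(f ^^ k) x \<noteq> c" if k: "k < s j" and x: "\<zeta> < x" "x < f c" for k x
    proof (cases "k = s j - 1")
      case True then show ?thesis using ng[of x] x sdist_zero[of j x] by (auto simp: branch_def)
    next
      case False
      then have "k < s j - 1" using k by linarith
      then show ?thesis using al(5) x z o al(2) unfolding free_def by auto
    qed
    then show ?thesis using o z unfolding free_def by auto
  qed
  have map: "(f ^^ s j) x \<in> {\<zeta>..f c}" if x: "x \<in> {\<zeta>..f c}" for x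
  proof -
    have x1: "x \<in> {0..1}" using x o z by auto
    have "(f ^^ s j) x \<le> f c" using top_le[OF branch_in[OF x1, of j]] by (simp add: branch_f)
    moreover have "?w \<le> (f ^^ s j) x"
    proof (cases "x = f c")
      case False
      then have "sdist j (f c) < sdist j x" using al(3)[of x "f c"] x al(2) o z by auto
      moreover have "sdist j x \<le> 0" using ng[of x] x z by (cases "x = \<zeta>") auto
      ultimately show ?thesis using level_neg[of x "f c" j] x1 al(4) fc01 by auto
    qed simp
    ultimately show ?thesis using zw by simp
  qed
  obtain w' where "\<zeta> < w'" "w' < f c" "wild w'" using some_wild[OF zs] by auto
  then show False using no_trap[OF fre s1 map, of w'] by auto
qed

text \<open>The cross ratio inequality once more, now with the point \<open>(f ^^ s j) (f c)\<close> in the place of \<open>v j\<close>. By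
\<open>returning_side\<close> this point has nonnegative signed distance, so its image term can be discarded. The outcome
bounds the overshoot \<open>\<omega>\<close> of \<open>f c\<close> across \<open>c\<close> linearly in the depth \<open>Y\<close> of its return.\<close>

lemma returning_low:
  assumes j: "2 \<le> j" and r: "returning j" and half: "radius (right_side j) (depth_u (Suc j)) \<le> radius (right_side j) (depth_u j) / 2"
  defines "Y \<equiv> f c - (f ^^ s j) (f c)" and "\<omega> \<equiv> - sdist j (f c)"
  shows "0 < Y" "Y \<le> depth_u j" "\<omega> = radius (\<not> right_side j) Y" "0 < \<omega>" "depth_u j * \<omega> \<le> 2 * exp K * (radius (right_side j) (depth_u (Suc j)) + \<omega>) * Y"
proof -
  let ?PB = "radius (right_side j) (depth_u (Suc j))" and ?o = "radius (right_side j) (depth_u j)"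
  obtain al where al: "0 \<le> al" "al < u j" "\<And>z. al < z \<Longrightarrow> z < u j \<Longrightarrow> u j < (f ^^ s j) z"
     "\<And>x y. al \<le> x \<Longrightarrow> x < y \<Longrightarrow> y \<le> f c \<Longrightarrow> sdist j y < sdist j x" "sdist j al = ?o" "sdist j (u j) = ?PB" "sdist j (f c) < 0"
    using returning_facts[OF j r] by metis
  have o: "u j < v j" "v j < f c" "0 \<le> u j" "f c \<le> 1" using uv01[of j] fc1 by auto
  let ?w = "(f ^^ s j) (f c)"
  have w: "u j < ?w" using returning_high[OF r, of "f c"] o by auto
  show om: "0 < \<omega>" using al by (simp add: \<omega>_def)
  have "branch j (f c) \<noteq> c" using sdist_zero[of j "f c"] al by auto
  then have w2: "?w < f c" using top_less[OF branch_in[OF fc01, of j]] by (simp add: branch_f)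
  then show Y: "0 < Y" by (simp add: Y_def)
  show "Y \<le> depth_u j" using w by (simp add: Y_def depth_u_def)
  show "\<omega> = radius (\<not> right_side j) Y" using sdist_D'[OF fc01, of j] al by (simp add: \<omega>_def Y_def)
  have hr: "u j < (f ^^ s j) z" if "v j < z" "z < f c" for z using r that unfolding returning_def by auto
  have d2: "0 \<le> sdist j ?w" by (rule returning_side[OF j r])
  have tw: "sdist j ?w < ?PB" using al(4)[of "u j" ?w] al w w2 by simp
  have PBo: "0 < ?PB" using Zvals(3,4)[of j] by linarith
  have "exp (- K) * cross al (u j) ?w (f c) \<le> cross (sdist j al) (sdist j (u j)) (sdist j ?w) (sdist j (f c))"
    by (rule seg_cross[OF al(1,2) o(2) order_refl]) (use al(3) hr al(2) w w2 in auto)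
  also have "\<dots> = ((?o - sdist j ?w) / (?o - ?PB)) * ((?PB + \<omega>) / (sdist j ?w + \<omega>))"
  proof -
    have "(sdist j ?w - ?o) * (sdist j (f c) - ?PB) = (?o - sdist j ?w) * (?PB + \<omega>)"
      "(?PB - ?o) * (sdist j (f c) - sdist j ?w) = (?o - ?PB) * (sdist j ?w + \<omega>)" by (auto simp: algebra_simps \<omega>_def)
    then show ?thesis by (simp add: cross_def al)
  qed
  also have "\<dots> \<le> 2 * ((?PB + \<omega>) / \<omega>)"
  proof (rule mult_mono)
    show "(?o - sdist j ?w) / (?o - ?PB) \<le> 2" using half PBo d2 by (simp add: field_simps)
    show "(?PB + \<omega>) / (sdist j ?w + \<omega>) \<le> (?PB + \<omega>) / \<omega>" using om d2 PBo by (intro divide_left_mono) auto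
    show "0 \<le> (?PB + \<omega>) / (sdist j ?w + \<omega>)" using om d2 PBo by auto
  qed simp
  finally have c1: "exp (- K) * cross al (u j) ?w (f c) \<le> 2 * ((?PB + \<omega>) / \<omega>)" .
  have "depth_u j / Y \<le> (?w - al) / (u j - al) * ((f c - u j) / (f c - ?w))"
    using al w w2 mult_right_mono[of 1 "(?w - al) / (u j - al)" "(f c - u j) / (f c - ?w)"] by (auto simp: depth_u_def Y_def)
  then have "depth_u j / Y \<le> cross al (u j) ?w (f c)" by (simp add: cross_def)
  then have "exp (- K) * (depth_u j / Y) \<le> 2 * ((?PB + \<omega>) / \<omega>)" using c1 mult_left_mono[of "depth_u j / Y" _ "exp (- K)"] by (meson exp_ge_zero order_trans)
  then have "exp K * (exp (- K) * (depth_u j / Y)) \<le> exp K * (2 * ((?PB + \<omega>) / \<omega>))" by (intro mult_left_mono) auto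
  then have "depth_u j / Y \<le> 2 * exp K * ((?PB + \<omega>) / \<omega>)" by (simp add: exp_minus field_simps)
  then show "depth_u j * \<omega> \<le> 2 * exp K * (?PB + \<omega>) * Y" using Y om by (simp add: field_simps)
qed

text \<open>Suppose both are returning. The second passage is longer than the first, by \<open>t\<close> say. If \<open>t < s j\<close>, the extra iterates stay low; if
\<open>t = s j\<close>, the point \<open>f c\<close> ends on the wrong side of \<open>c\<close>; if \<open>t > s j\<close>, the time \<open>2 * s j\<close> is both low and
high.\<close>

lemma returning_stop:
  assumes j: "2 \<le> j" and r: "returning j" and x: "(f ^^ s j) (f c) \<le> u (Suc j)" and right_side: "right_side (Suc j) = right_side j"
  shows "\<not> returning (Suc j)"
proof
  assume r': "returning (Suc j)"
  have o: "u j < v j" "v j < f c" "0 \<le> u j" "f c \<le> 1" using uv01[of j] fc1 by auto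
  have fcin: "f c \<in> {u j..f c}" "f c \<in> {u (Suc j)..f c}" using uv01[of j] uv01[of "Suc j"] by auto
  let ?w = "(f ^^ s j) (f c)"
  have w: "u j < ?w" by (rule returning_high[OF r fcin(1)])
  have x': "u (Suc j) < (f ^^ s (Suc j)) (f c)" by (rule returning_high[OF r' fcin(2)])
  have w01: "?w \<in> {0..1}" by (rule it_in[OF fc01])
  have wle: "?w \<le> f c" using top_le[OF branch_in[OF fc01, of j]] by (simp add: branch_f)
  have uu: "u j < u (Suc j)" using uv[of j] N_Suc(2)[of j] by simp
  have ge: "s j \<le> s (Suc j)" by (rule returning_s_ge[OF r])
  have ne: "s (Suc j) \<noteq> s j" using x x' by auto
  define t where "t = s (Suc j) - s j"
  have t: "s (Suc j) = t + s j" "1 \<le> t" using ge ne by (auto simp: t_def)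
  have ft: "(f ^^ s (Suc j)) (f c) = (f ^^ t) ?w" using t by (simp add: it_add)
  have rs: "0 \<le> sdist j ?w" by (rule returning_side[OF j r])
  consider "t < s j" | "t = s j" | "s j < t" by linarith
  then show False
  proof cases
    case 1
    have "(f ^^ t) ?w \<le> u j"
    proof (rule seg_low[OF w01 t(2) 1])
      fix z assume "min ?w (u j) \<le> z" "z \<le> max ?w (v j)"
      then have "z \<in> {u j..f c}" using w wle o by auto
      then show "u j < (f ^^ s j) z" by (rule returning_high[OF r])
    qed
    then show False using x' ft uu by simp
  next
    case 2
    have "sdist (Suc j) (f c) < 0" using returning_facts[OF _ r'] j by (metis le_SucI)
    moreover have "branch (Suc j) (f c) = branch j ?w"
    proof -
      have "s (Suc j) - 1 = (s j - 1) + s j" using t 2 s1[of j] by simp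
      then show ?thesis unfolding branch_def by (simp only: it_add)
    qed
    ultimately show False using rs right_side by (simp add: sdist_def)
  next
    case 3
    have "(f ^^ (s j + s j)) (f c) \<le> u (Suc j)"
    proof (rule seg_low[OF fc01])
      fix z assume "min (f c) (u (Suc j)) \<le> z" "z \<le> max (f c) (v (Suc j))"
      then have "z \<in> {u (Suc j)..f c}" using uv01[of "Suc j"] by auto
      then show "u (Suc j) < (f ^^ s (Suc j)) z" by (rule returning_high[OF r'])
    qed (use 3 t s1[of j] in auto)
    moreover have "u (Suc j) < (f ^^ s j) ?w"
    proof -
      obtain al where al: "al < u j" "\<And>x y. al \<le> x \<Longrightarrow> x < y \<Longrightarrow> y \<le> f c \<Longrightarrow> sdist j y < sdist j x"
        using returning_facts[OF j r] by metis
      have "sdist j ?w < sdist j (u j)" using al(2)[of "u j" ?w] al(1) w wle by simp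
      then show ?thesis using level_pos[of ?w "u j" j] rs Zside[of "u j" j] w01 o returning_level[OF j r] by auto
    qed
    ultimately show False by (simp add: it_add)
  qed
qed

section \<open>Comparison of the two critical orders\<close>

definition crit_order :: "bool \<Rightarrow> real" where "crit_order si = (if si then lp else lm)"
definition Y0 :: real where "Y0 = f c - max (f 0) (f 1)"

lemma el1: "1 \<le> crit_order si" using lm1 lp1 by (simp add: crit_order_def)

lemma Y0_pos: "0 < Y0"
  using top_less[of 0] top_less[of 1] c0 c1 by (auto simp: Y0_def)

lemma radius_ex: assumes "0 \<le> y" "y \<le> Y0" obtains x where "x \<in> {0..1}" "onside si x" "f x = f c - y"
proof (cases si)
  case True
  have "\<exists>x. c \<le> x \<and> x \<le> 1 \<and> f x = f c - y"
  proof (rule IVT2')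
    show "continuous_on {c..1} f" using c0 by (intro continuous_on_subset[OF cont]) auto
  qed (use assms c1 in \<open>auto simp: Y0_def\<close>)
  then show ?thesis using that True c0 by (auto simp: onside_def)
next
  case False
  have "\<exists>x. 0 \<le> x \<and> x \<le> c \<and> f x = f c - y"
  proof (rule IVT')
    show "continuous_on {0..c} f" using c1 by (intro continuous_on_subset[OF cont]) auto
  qed (use assms c0 in \<open>auto simp: Y0_def\<close>)
  then show ?thesis using that False c1 by (auto simp: onside_def)
qed

lemma radius_bounds: assumes "0 \<le> y" "y \<le> Y0"
  shows "0 \<le> radius si y" "mm * radius si y powr crit_order si \<le> y" "y \<le> MM * radius si y powr crit_order si"
proof -
  obtain x where x: "x \<in> {0..1}" "onside si x" "f x = f c - y" using radius_ex[OF assms] .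
  have radius: "radius si y = \<bar>x - c\<bar>" using radius_eq[OF x(1,2)] x(3) by simp
  have y: "f c - f x = y" using x(3) by simp
  have "mm * \<bar>x - c\<bar> powr crit_order si \<le> y \<and> y \<le> MM * \<bar>x - c\<bar> powr crit_order si"
  proof (cases si)
    case True
    then have cx: "c \<le> x" "x \<le> 1" using x(1,2) by (simp_all add: onside_def)
    then have "\<bar>x - c\<bar> = x - c" "crit_order si = lp" using True by (simp_all add: crit_order_def)
    then show ?thesis using powp[OF cx] y by simp
  next
    case False
    then have cx: "0 \<le> x" "x \<le> c" using x(1,2) by (simp_all add: onside_def)
    then have "\<bar>x - c\<bar> = c - x" "crit_order si = lm" using False by (simp_all add: crit_order_def)
    then show ?thesis using powm[OF cx] y by simp
  qed
  then show "0 \<le> radius si y" "mm * radius si y powr crit_order si \<le> y" "y \<le> MM * radius si y powr crit_order si"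
    unfolding radius by simp_all
qed

lemma MM_pos: "0 < MM"
proof -
  have "mm * (1 - c) powr lp \<le> MM * (1 - c) powr lp" using powp[of 1] c0 c1 by linarith
  moreover have "0 < (1 - c) powr lp" using c1 by simp
  ultimately have "mm \<le> MM" by (rule mult_right_le_imp_le)
  then show ?thesis using mm0 by simp
qed

lemma radius_pow: obtains k1 k2 where "0 < k1" "0 < k2"
  "\<And>si y. 0 \<le> y \<Longrightarrow> y \<le> Y0 \<Longrightarrow> k1 * y powr (1 / crit_order si) \<le> radius si y \<and> radius si y \<le> k2 * y powr (1 / crit_order si)"
proof -
  define k1 where "k1 = min ((1 / MM) powr (1 / crit_order True)) ((1 / MM) powr (1 / crit_order False))"
  define k2 where "k2 = max ((1 / mm) powr (1 / crit_order True)) ((1 / mm) powr (1 / crit_order False))"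
  have k: "0 < k1" "0 < k2" using mm0 MM_pos by (auto simp: k1_def k2_def less_max_iff_disj)
  have bound: "k1 * y powr (1 / crit_order si) \<le> radius si y \<and> radius si y \<le> k2 * y powr (1 / crit_order si)" if y: "0 \<le> y" "y \<le> Y0" for si y
  proof -
    note B = radius_bounds[OF y, of si]
    have root: "(radius si y powr crit_order si) powr (1 / crit_order si) = radius si y"
      using B(1) el1[of si] by (simp add: powr_powr)
    have "radius si y powr crit_order si \<le> (1 / mm) * y" using B(2) mm0 by (simp add: field_simps)
    then have "(radius si y powr crit_order si) powr (1 / crit_order si) \<le> ((1 / mm) * y) powr (1 / crit_order si)"
      using el1[of si] by (intro powr_mono2) auto
    also have "\<dots> = (1 / mm) powr (1 / crit_order si) * y powr (1 / crit_order si)" by (rule powr_mult)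
    also have "\<dots> \<le> k2 * y powr (1 / crit_order si)" by (intro mult_right_mono) (cases si; auto simp: k2_def)+
    finally have 1: "radius si y \<le> k2 * y powr (1 / crit_order si)" using root by simp
    have "(1 / MM) * y \<le> radius si y powr crit_order si" using B(3) MM_pos by (simp add: field_simps)
    then have "((1 / MM) * y) powr (1 / crit_order si) \<le> (radius si y powr crit_order si) powr (1 / crit_order si)"
      using el1[of si] y MM_pos by (intro powr_mono2) auto
    moreover have "((1 / MM) * y) powr (1 / crit_order si) = (1 / MM) powr (1 / crit_order si) * y powr (1 / crit_order si)"
      by (rule powr_mult)
    moreover have "k1 * y powr (1 / crit_order si) \<le> (1 / MM) powr (1 / crit_order si) * y powr (1 / crit_order si)"
      by (intro mult_right_mono) (cases si; auto simp: k1_def)+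
    ultimately show ?thesis using 1 root by simp
  qed
  show ?thesis by (rule that[OF k bound])
qed

lemma AB_pos: "0 < depth_v j" "depth_v j < depth_u j" "depth_u j \<le> 1" "depth_u (Suc j) \<le> depth_v j"
  using uv01[of j] N_Suc(2)[of j] fc1 by (auto simp: depth_v_def depth_u_def)

lemma depth_u_mono: "depth_u (Suc j) \<le> depth_u j" using AB_pos(2,4)[of j] by simp

lemma ratio_null: assumes "0 < \<epsilon>" shows "\<exists>J. \<forall>j\<ge>J. depth_v j \<le> \<epsilon> * depth_u j"
proof -
  obtain I where I: "\<And>i. I \<le> i \<Longrightarrow> f c - v i \<le> \<epsilon> * h i" using records_near_top[OF assms] by blast
  have "depth_v j \<le> \<epsilon> * depth_u j" if "I \<le> j" for j
  proof -
    have "h j \<le> depth_u j" using uv01[of j] by (auto simp: h_def depth_u_def)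
    then have "\<epsilon> * h j \<le> \<epsilon> * depth_u j" using assms by (intro mult_left_mono) auto
    then show ?thesis using I[OF that] by (simp add: depth_v_def)
  qed
  then show ?thesis by blast
qed

lemma depth_u_null: assumes "0 < \<epsilon>" shows "\<exists>J. \<forall>j\<ge>J. depth_u j \<le> \<epsilon>"
proof -
  have "\<forall>\<^sub>F j in sequentially. f c - \<epsilon> < u j" by (rule order_tendstoD(1)[OF u_lim]) (use assms in simp)
  then obtain J where J: "\<And>j. J \<le> j \<Longrightarrow> f c - \<epsilon> < u j" unfolding eventually_sequentially by blast
  have "depth_u j \<le> \<epsilon>" if "J \<le> j" for j using J[OF that] by (simp add: depth_u_def)
  then show ?thesis by blast
qed

text \<open>Take \<open>j\<close> so large that \<open>r j = depth_v j / depth_u j\<close> is below all constants. The estimate bounds the radius at depth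
\<open>depth_v (Suc j)\<close> plus the overshoot \<open>\<omega>\<close> by \<open>C * r j\<close> times the radius at depth \<open>depth_u (Suc j)\<close>. (i) The overshoot is at least the opposite radius at depth
\<open>depth_u (Suc j)\<close> unless \<open>f c\<close> returns above the next record; comparing exponents, the record's side is strictly
flatter. (ii) A run of returning records of the latter kind keeps time and side and must end, because
\<open>f c\<close> returns to a given height strictly below the top; so all late records are on one and the same flatter side. (iii) By
\<open>returning_stop\<close> nonreturning records occur infinitely often. (iv) Taking logarithms yields the recursive
inequalities excluded by \<open>growth_absurd\<close>.\<close>

lemma contradiction: False
proof -
  obtain k1 k2 where k: "0 < k1" "0 < k2" and
    Dp: "\<And>si y. 0 \<le> y \<Longrightarrow> y \<le> Y0 \<Longrightarrow> k1 * y powr (1 / crit_order si) \<le> radius si y \<and> radius si y \<le> k2 * y powr (1 / crit_order si)"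
    using radius_pow by blast
  define C where "C = 4 * exp K"
  have C: "0 < C" by (simp add: C_def)
  define \<kappa> where "\<kappa> = k1 / (2 * k2)"
  have kap: "0 < \<kappa>" using k by (simp add: \<kappa>_def)
  define \<epsilon> where "\<epsilon> = min (min (\<kappa> powr lp) (\<kappa> powr lm)) (min (1 / C) (k1 / (2 * C * k2)))"
  have eps: "0 < \<epsilon>" using kap C k by (simp add: \<epsilon>_def)
  obtain Ja where Ja: "\<And>j. Ja \<le> j \<Longrightarrow> depth_v j \<le> \<epsilon> * depth_u j" using ratio_null[OF eps] by blast
  obtain Jb where Jb: "\<And>j. Jb \<le> j \<Longrightarrow> depth_u j \<le> Y0" using depth_u_null[OF Y0_pos] by blast
  define J where "J = max 2 (max Ja Jb)"
  define r where "r j = depth_v j / depth_u j" for j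
  have Bpos: "0 < depth_u j" for j using AB_pos(1,2)[of j] by linarith
  have rpos: "0 < r j" for j using AB_pos(1)[of j] Bpos[of j] by (simp add: r_def)
  have reps: "r j \<le> \<epsilon>" if "J \<le> j" for j using Ja[of j] that Bpos[of j] by (simp add: r_def J_def field_simps)
  have BY: "depth_u j \<le> Y0" if "J \<le> j" for j using Jb[of j] that by (simp add: J_def)
  have AY: "depth_v j \<le> Y0" if "J \<le> j" for j using BY[OF that] AB_pos(2)[of j] by simp
  have half: "radius si (depth_u (Suc j)) \<le> radius si (depth_u j) / 2" if j: "J \<le> j" for si j
  proof -
    have "depth_u (Suc j) \<le> \<epsilon> * depth_u j" using AB_pos(4)[of j] Ja[of j] j by (simp add: J_def)
    also have "\<dots> \<le> \<kappa> powr crit_order si * depth_u j" using Bpos[of j] by (intro mult_right_mono) (auto simp: \<epsilon>_def crit_order_def)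
    finally have "depth_u (Suc j) powr (1 / crit_order si) \<le> (\<kappa> powr crit_order si * depth_u j) powr (1 / crit_order si)"
      using Bpos[of "Suc j"] el1[of si] by (intro powr_mono2) auto
    also have "\<dots> = (\<kappa> powr crit_order si) powr (1 / crit_order si) * depth_u j powr (1 / crit_order si)" by (rule powr_mult)
    also have "(\<kappa> powr crit_order si) powr (1 / crit_order si) = \<kappa>" using kap el1[of si] by (simp add: powr_powr)
    finally have p: "depth_u (Suc j) powr (1 / crit_order si) \<le> \<kappa> * depth_u j powr (1 / crit_order si)" .
    have "radius si (depth_u (Suc j)) \<le> k2 * depth_u (Suc j) powr (1 / crit_order si)" using Dp[of "depth_u (Suc j)" si] Bpos[of "Suc j"] BY[of "Suc j"] j by simp
    also have "\<dots> \<le> k2 * (\<kappa> * depth_u j powr (1 / crit_order si))" using p k by (intro mult_left_mono) auto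
    also have "\<dots> = k1 * depth_u j powr (1 / crit_order si) / 2" using k by (simp add: \<kappa>_def)
    also have "\<dots> \<le> radius si (depth_u j) / 2" using Dp[of "depth_u j" si] Bpos[of j] BY[OF j] by (intro divide_right_mono) auto
    finally show ?thesis .
  qed
  have J2: "2 \<le> j" if "J \<le> j" for j using that by (simp add: J_def)
  have main: "\<exists>\<omega>\<ge>0. radius (right_side j) (depth_v (Suc j)) + \<omega> \<le> C * r j * radius (right_side j) (depth_u (Suc j)) \<and> \<omega> \<le> radius (right_side j) (depth_u (Suc j)) \<and>
      (\<not> returning j \<longrightarrow> \<omega> = radius (\<not> right_side j) (depth_u j)) \<and> (returning j \<longrightarrow> \<omega> = - sdist j (f c))" if j: "J \<le> j" for j
  proof -
    let ?PA = "radius (right_side j) (depth_v (Suc j))" and ?PB = "radius (right_side j) (depth_u (Suc j))"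
    obtain \<omega> where w: "0 \<le> \<omega>" "depth_u j / depth_v j * (?PA + \<omega>) \<le> 2 * exp K * (?PB + \<omega>)"
      "\<not> returning j \<Longrightarrow> \<omega> = radius (\<not> right_side j) (depth_u j)" "returning j \<Longrightarrow> \<omega> = - sdist j (f c)"
      by (rule record_estimate[OF J2[OF j] half[OF j]]) (rule that)
    have P: "0 < ?PA" "?PA < ?PB" by (rule Zvals)+
    have "r j * (depth_u j / depth_v j * (?PA + \<omega>)) \<le> r j * (2 * exp K * (?PB + \<omega>))" using w(2) rpos[of j] by (intro mult_left_mono) auto
    moreover have "r j * (depth_u j / depth_v j * (?PA + \<omega>)) = ?PA + \<omega>" using Bpos[of j] AB_pos(1)[of j] by (simp add: r_def)
    ultimately have 1: "?PA + \<omega> \<le> C * r j / 2 * (?PB + \<omega>)" by (simp add: C_def mult_ac)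
    have Cr: "C * r j \<le> 1" using reps[OF j] C by (simp add: \<epsilon>_def field_simps)
    have "C * r j / 2 * (?PB + \<omega>) \<le> 1 / 2 * (?PB + \<omega>)" using Cr P w(1) by (intro mult_right_mono) auto
    with 1 have "?PA + \<omega> \<le> 1 / 2 * (?PB + \<omega>)" by (rule order_trans)
    then have 2: "\<omega> \<le> ?PB" using P(1) by simp
    have "C * r j / 2 * (?PB + \<omega>) \<le> C * r j / 2 * (2 * ?PB)" using 2 C rpos[of j] by (intro mult_left_mono) auto
    with 1 have "?PA + \<omega> \<le> C * r j / 2 * (2 * ?PB)" by (rule order_trans)
    then have "?PA + \<omega> \<le> C * r j * ?PB" by simp
    then show ?thesis using w 2 by blast
  qed
  \<comment> \<open>If the opposite side were at least as flat, the overshoot would exceed the small multiple of the radius that bounds it.\<close>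
  have flat1: "crit_order (\<not> right_side j) < crit_order (right_side j)" if j: "J \<le> j" and st: "\<not> returning j \<or> (f ^^ s j) (f c) \<le> u (Suc j)" for j
  proof (rule ccontr)
    assume "\<not> ?thesis"
    then have le: "crit_order (right_side j) \<le> crit_order (\<not> right_side j)" by simp
    let ?B = "depth_u (Suc j)"
    obtain \<omega> where w: "0 \<le> \<omega>" "radius (right_side j) (depth_v (Suc j)) + \<omega> \<le> C * r j * radius (right_side j) ?B"
      "\<not> returning j \<Longrightarrow> \<omega> = radius (\<not> right_side j) (depth_u j)" "returning j \<Longrightarrow> \<omega> = - sdist j (f c)" using main[OF j] by blast
    have "\<exists>Y. ?B \<le> Y \<and> Y \<le> depth_u j \<and> \<omega> = radius (\<not> right_side j) Y"
    proof (cases "returning j")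
      case True
      then have "?B \<le> f c - (f ^^ s j) (f c)" using st by (auto simp: depth_u_def)
      then show ?thesis using returning_low(2,3)[OF J2[OF j] True half[OF j]] w(4)[OF True] by auto
    qed (use w(3) depth_u_mono in auto)
    then obtain Y where Y: "?B \<le> Y" "Y \<le> depth_u j" "\<omega> = radius (\<not> right_side j) Y" by blast
    have B1: "0 < ?B" "?B \<le> 1" using Bpos AB_pos by auto
    have "k1 * ?B powr (1 / crit_order (\<not> right_side j)) \<le> k1 * Y powr (1 / crit_order (\<not> right_side j))"
      using Y B1 k el1[of "\<not> right_side j"] by (intro mult_left_mono powr_mono2) auto
    also have "\<dots> \<le> \<omega>" using Dp[of Y "\<not> right_side j"] Y B1 BY[OF j] by auto
    also have "\<dots> \<le> C * r j * radius (right_side j) ?B" using w(2) Zvals(3)[of j] by linarith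
    also have "\<dots> \<le> C * r j * (k2 * ?B powr (1 / crit_order (right_side j)))"
      using Dp[of ?B "right_side j"] B1 BY[of "Suc j"] j C rpos[of j] by (intro mult_left_mono) auto
    also have "\<dots> \<le> C * r j * (k2 * ?B powr (1 / crit_order (\<not> right_side j)))"
    proof -
      have "1 / crit_order (\<not> right_side j) \<le> 1 / crit_order (right_side j)" using le el1[of "right_side j"] by (simp add: frac_le)
      then have "?B powr (1 / crit_order (right_side j)) \<le> ?B powr (1 / crit_order (\<not> right_side j))" using B1 by (intro powr_mono') auto
      then show ?thesis using C rpos[of j] k by (intro mult_left_mono) auto
    qed
    finally have "k1 * ?B powr (1 / crit_order (\<not> right_side j)) \<le> (C * r j * k2) * ?B powr (1 / crit_order (\<not> right_side j))" by simp
    then have "k1 \<le> C * r j * k2" using B1 by simp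
    also have "\<dots> \<le> C * (k1 / (2 * C * k2)) * k2" using reps[OF j] C k by (intro mult_right_mono mult_left_mono) (auto simp: \<epsilon>_def)
    also have "\<dots> = k1 / 2" using C k by simp
    finally show False using k by simp
  qed
  have neg: "sdist j (f c) < 0" if "J \<le> j" "returning j" for j using returning_facts[OF J2[OF that(1)] that(2)] by metis
  have step': "s (Suc j) = s j \<and> returning (Suc j) \<and> right_side (Suc j) = right_side j" if j: "J \<le> j" "returning j" "u (Suc j) < (f ^^ s j) (f c)" for j
  proof -
    have n: "s (Suc j) = s j" "returning (Suc j)" using returning_next[OF J2[OF j(1)] j(2,3)] by auto
    have "branch (Suc j) (f c) = branch j (f c)" using n by (simp add: branch_def)
    then have "right_side (Suc j) = right_side j" using neg[OF j(1,2)] neg[of "Suc j"] n j(1) by (auto simp: sdist_def split: if_splits)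
    with n show ?thesis by simp
  qed
  have wlt: "(f ^^ s j) (f c) < f c" if "J \<le> j" "returning j" for j
    using returning_low(1)[OF J2[OF that(1)] that(2) half[OF that(1)]] by simp
  have run: "s (j + k) = s j \<and> returning (j + k) \<and> right_side (j + k) = right_side j"
    if "J \<le> j" "returning j" "\<And>i. i < k \<Longrightarrow> u (Suc (j + i)) < (f ^^ s j) (f c)" for j k
    using that(3)
  proof (induction k)
    case (Suc k)
    then have IH: "s (j + k) = s j" "returning (j + k)" "right_side (j + k) = right_side j" by auto
    then show ?case using step'[of "j + k"] that(1) Suc.prems[of k] by simp
  qed (use that in simp)
  have flat: "crit_order (\<not> right_side j) < crit_order (right_side j)" if j: "J \<le> j" for j
  proof (cases "returning j")
    case True
    let ?w = "(f ^^ s j) (f c)"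
    have "\<exists>k. ?w \<le> u (Suc (j + k))"
    proof -
      obtain k where "?w < u k" using order_tendstoD(1)[OF u_lim wlt[OF j True]] by (auto simp: eventually_sequentially)
      then show ?thesis using u_mono[of k "Suc (j + k)"] by (intro exI[of _ k]) auto
    qed
    then obtain k where k: "?w \<le> u (Suc (j + k))" "\<And>i. i < k \<Longrightarrow> \<not> ?w \<le> u (Suc (j + i))"
      using exists_least_iff[of "\<lambda>k. ?w \<le> u (Suc (j + k))"] by blast
    have R: "s (j + k) = s j" "returning (j + k)" "right_side (j + k) = right_side j" using run[OF j True, of k] k(2) by force+
    show ?thesis using flat1[of "j + k"] R k(1) j by simp
  qed (use flat1[OF j] in simp)
  define g where "g = right_side J"
  have sdg: "right_side j = g" if j: "J \<le> j" for j
    using flat[OF j] flat[of J] by (cases "right_side j"; cases "right_side J"; simp add: g_def)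
  define l where "l = crit_order g"
  define l' where "l' = crit_order (\<not> g)"
  have l1: "1 \<le> l'" "l' < l" using flat[of J] el1 by (auto simp: l_def l'_def g_def)
  \<comment> \<open>If all late records were returning, \<open>f c\<close> would return above every later record although it returns strictly below \<open>f c\<close>.\<close>
  have infnon: "\<exists>j\<ge>m. \<not> returning j" for m
  proof (rule ccontr)
    assume "\<not> ?thesis"
    then have all: "returning j" if "m \<le> j" for j using that by blast
    define m' where "m' = max m J"
    have up: "u (Suc j) < (f ^^ s j) (f c)" if j: "m' \<le> j" for j
    proof (rule ccontr)
      assume "\<not> ?thesis"
      then have "\<not> returning (Suc j)" using returning_stop[OF J2 all] sdg[of j] sdg[of "Suc j"] j by (auto simp: m'_def)
      then show False using all[of "Suc j"] j by (simp add: m'_def)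
    qed
    let ?w = "(f ^^ s m') (f c)"
    have ss: "s (m' + k) = s m'" for k
    proof (induction k)
      case (Suc k)
      then show ?case using step'[of "m' + k"] all[of "m' + k"] up[of "m' + k"] by (simp add: m'_def)
    qed simp
    have ub: "u (Suc (m' + k)) < ?w" for k using up[of "m' + k"] ss[of k] by simp
    have "?w < f c" using wlt[of m'] all[of m'] by (simp add: m'_def)
    then obtain k where "?w < u k" using order_tendstoD(1)[OF u_lim] by (auto simp: eventually_sequentially)
    then show False using ub[of k] u_mono[of k "Suc (m' + k)"] by simp
  qed
  define cc where "cc = max 0 (ln (C * k2 / k1))"
  define Dd where "Dd j = ln (depth_u j) - ln (depth_v j)" for j
  define E where "E j = - ln (depth_u j)" for j
  have lnr: "ln (r j) = - Dd j" for j using AB_pos(1)[of j] Bpos[of j] by (simp add: r_def Dd_def ln_div)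
  have E0: "0 \<le> E j" for j using AB_pos(3)[of j] Bpos[of j] by (simp add: E_def)
  have Bup: "radius g (depth_u (Suc j)) \<le> k2 * depth_u (Suc j) powr (1 / l)" if "J \<le> j" for j
    using Dp[of "depth_u (Suc j)" g] Bpos[of "Suc j"] BY[of "Suc j"] that by (simp add: l_def)
  have lnstep: "ln y / e \<le> cc - Dd j + ln (depth_u (Suc j)) / l"
    if j: "J \<le> j" and y: "0 < y" and le: "k1 * y powr (1 / e) \<le> C * r j * radius g (depth_u (Suc j))" for j y e
  proof -
    have "k1 * y powr (1 / e) \<le> C * r j * (k2 * depth_u (Suc j) powr (1 / l))"
      using le Bup[OF j] C rpos[of j] by (meson mult_left_mono order_trans mult_nonneg_nonneg less_imp_le)
    then have "ln (k1 * y powr (1 / e)) \<le> ln (C * r j * (k2 * depth_u (Suc j) powr (1 / l)))"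
      using k y by (intro ln_mono) auto
    then have "ln k1 + ln y / e \<le> ln C + ln (r j) + (ln k2 + ln (depth_u (Suc j)) / l)"
      using k y C rpos[of j] Bpos[of "Suc j"] by (simp add: ln_mult ln_powr)
    moreover have "ln (C * k2 / k1) = ln C + ln k2 - ln k1" using k C by (simp add: ln_mult ln_div)
    ultimately show ?thesis using lnr[of j] by (simp add: cc_def)
  qed
  have crit_order_ratio: "l / l' * E j \<le> l * E j" for j
  proof -
    have "l / l' \<le> l" using l1 by (simp add: field_simps)
    then show ?thesis using E0[of j] by (rule mult_right_mono)
  qed
  show False
  proof (rule growth_absurd[of l "l * cc" J E Dd])
    show "1 < l" "0 \<le> l * cc" using l1 by (auto simp: cc_def)
    show "0 \<le> E j" for j by (rule E0)
    show "l * Dd j - l * cc \<le> Dd (Suc j)" if j: "J \<le> j" for j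
    proof -
      have "radius g (depth_v (Suc j)) \<le> C * r j * radius g (depth_u (Suc j))" using main[OF j] sdg[OF j] by auto
      moreover have "k1 * depth_v (Suc j) powr (1 / l) \<le> radius g (depth_v (Suc j))"
        using Dp[of "depth_v (Suc j)" g] AB_pos(1)[of "Suc j"] AY[of "Suc j"] j by (simp add: l_def)
      ultimately have "ln (depth_v (Suc j)) / l \<le> cc - Dd j + ln (depth_u (Suc j)) / l"
        using lnstep[OF j AB_pos(1)[of "Suc j"]] by simp
      then have "l * (ln (depth_v (Suc j)) / l) \<le> l * (cc - Dd j + ln (depth_u (Suc j)) / l)" using l1 by (intro mult_left_mono) auto
      then show ?thesis using l1 by (simp add: Dd_def[of "Suc j"] algebra_simps)
    qed
    show "E (Suc j) \<le> l * E j + l * cc" if j: "J \<le> j" for j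
    proof (cases "returning j")
      case False
      then have "radius (\<not> g) (depth_u j) \<le> C * r j * radius g (depth_u (Suc j))" using main[OF j] sdg[OF j] Zvals(3)[of j] by auto
      moreover have "k1 * depth_u j powr (1 / l') \<le> radius (\<not> g) (depth_u j)" using Dp[of "depth_u j" "\<not> g"] Bpos[of j] BY[OF j] by (simp add: l'_def)
      ultimately have "ln (depth_u j) / l' \<le> cc - Dd j + ln (depth_u (Suc j)) / l" using lnstep[OF j Bpos[of j]] by simp
      moreover have "0 \<le> Dd j" using AB_pos(1,2)[of j] by (simp add: Dd_def)
      ultimately have "l * (ln (depth_u j) / l') \<le> l * (cc + ln (depth_u (Suc j)) / l)" using l1 by (intro mult_left_mono) auto
      then show ?thesis using l1 crit_order_ratio[of j] by (simp add: E_def algebra_simps)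
    next
      case True
      define Y where "Y = f c - (f ^^ s j) (f c)"
      define \<omega> where "\<omega> = - sdist j (f c)"
      note R = returning_low[OF J2[OF j] True half[OF j], folded Y_def \<omega>_def]
      have "\<omega> \<le> radius g (depth_u (Suc j))" using main[OF j] sdg[OF j] True by (auto simp: \<omega>_def)
      then have "2 * exp K * (radius g (depth_u (Suc j)) + \<omega>) * Y \<le> 2 * exp K * (2 * radius g (depth_u (Suc j))) * Y"
        using R(1) by (intro mult_right_mono mult_left_mono) auto
      with R(5)[unfolded sdg[OF j]] have "depth_u j * \<omega> \<le> 2 * exp K * (2 * radius g (depth_u (Suc j))) * Y" by (rule order_trans)
      then have "depth_u j * \<omega> \<le> C * radius g (depth_u (Suc j)) * Y" by (simp add: C_def)
      also have "\<dots> \<le> C * (k2 * depth_u (Suc j) powr (1 / l)) * Y"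
        using Bup[OF j] C R(1) by (intro mult_right_mono mult_left_mono) auto
      finally have "depth_u j * \<omega> \<le> C * (k2 * depth_u (Suc j) powr (1 / l)) * Y" .
      moreover have "k1 * Y powr (1 / l') \<le> \<omega>"
        using Dp[of Y "\<not> g"] R(1-3) BY[OF j] sdg[OF j] by (simp add: l'_def)
      ultimately have "depth_u j * (k1 * Y powr (1 / l')) \<le> C * (k2 * depth_u (Suc j) powr (1 / l)) * Y"
        using Bpos[of j] by (meson mult_left_mono order_trans less_imp_le)
      then have "ln (depth_u j * (k1 * Y powr (1 / l'))) \<le> ln (C * (k2 * depth_u (Suc j) powr (1 / l)) * Y)"
        using k R(1) Bpos[of j] by (intro ln_mono) auto
      then have "ln (depth_u j) + (ln k1 + ln Y / l') \<le> ln C + (ln k2 + ln (depth_u (Suc j)) / l) + ln Y"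
        using k C R(1) Bpos[of j] Bpos[of "Suc j"] by (simp add: ln_mult ln_powr)
      moreover have "ln (C * k2 / k1) = ln C + ln k2 - ln k1" using k C by (simp add: ln_mult ln_div)
      ultimately have q: "ln (depth_u j) - (1 - 1 / l') * ln Y \<le> cc + ln (depth_u (Suc j)) / l"
        by (simp add: cc_def algebra_simps)
      have "(1 - 1 / l') * ln Y \<le> (1 - 1 / l') * ln (depth_u j)"
        using R(1,2) l1 by (intro mult_left_mono ln_mono) auto
      then have "ln (depth_u j) / l' \<le> cc + ln (depth_u (Suc j)) / l" using q by (simp add: algebra_simps)
      then have "l * (ln (depth_u j) / l') \<le> l * (cc + ln (depth_u (Suc j)) / l)" using l1 by (intro mult_left_mono) auto
      then show ?thesis using l1 crit_order_ratio[of j] by (simp add: E_def algebra_simps)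
    qed
    show "\<exists>j\<ge>m. E (Suc j) \<le> l * E j - l * Dd j + l * cc" for m
    proof -
      obtain j where j: "max m J \<le> j" "\<not> returning j" using infnon by blast
      then have jJ: "J \<le> j" by simp
      have "radius (\<not> g) (depth_u j) \<le> C * r j * radius g (depth_u (Suc j))" using main[OF jJ] sdg[OF jJ] Zvals(3)[of j] j(2) by auto
      moreover have "k1 * depth_u j powr (1 / l') \<le> radius (\<not> g) (depth_u j)" using Dp[of "depth_u j" "\<not> g"] Bpos[of j] BY[OF jJ] by (simp add: l'_def)
      ultimately have "ln (depth_u j) / l' \<le> cc - Dd j + ln (depth_u (Suc j)) / l" using lnstep[OF jJ Bpos[of j]] by simp
      then have "l * (ln (depth_u j) / l') \<le> l * (cc - Dd j + ln (depth_u (Suc j)) / l)" using l1 by (intro mult_left_mono) auto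
      then have "E (Suc j) \<le> l * E j - l * Dd j + l * cc" using l1 crit_order_ratio[of j] by (simp add: E_def algebra_simps)
      then show ?thesis using j by auto
    qed
    show "\<exists>j\<ge>J. l * cc / (l - 1) + 1 \<le> Dd j"
    proof -
      let ?q = "l * cc / (l - 1) + 1"
      obtain J' where J': "\<And>j. J' \<le> j \<Longrightarrow> depth_v j \<le> exp (- ?q) * depth_u j" using ratio_null[of "exp (- ?q)"] by auto
      have "depth_v (max J J') \<le> exp (- ?q) * depth_u (max J J')" using J' by simp
      then have "ln (depth_v (max J J')) \<le> ln (exp (- ?q) * depth_u (max J J'))" using AB_pos(1) by (intro ln_mono) auto
      also have "\<dots> = - ?q + ln (depth_u (max J J'))" using Bpos[of "max J J'"] by (simp add: ln_mult)
      finally show ?thesis by (intro exI[of _ "max J J'"]) (simp add: Dd_def)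
    qed
  qed
qed

end

section \<open>Powers expand cross ratios\<close>

text \<open>The numerator of the derivative vanishes at 0 and has derivative \<open>(l\<^sup>2 - 1) * sinh (l * x) * sinh x\<close>.\<close>

lemma sinh_ratio_mono:
  fixes l :: real
  assumes l: "1 \<le> l" and PQ: "0 < Q" "Q \<le> P"
  shows "sinh (l * Q) / sinh Q \<le> sinh (l * P) / sinh P"
proof -
  define n where "n x = l * cosh (l * x) * sinh x - sinh (l * x) * cosh x" for x :: real
  have n0: "0 \<le> n x" if x: "0 \<le> x" for x
  proof -
    have "n 0 \<le> n x"
    proof (rule DERIV_nonneg_imp_nondecreasing[OF x])
      fix t :: real assume t: "0 \<le> t" "t \<le> x"
      have "DERIV n t :> (l\<^sup>2 - 1) * (sinh (l * t) * sinh t)"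
        unfolding n_def by (auto intro!: derivative_eq_intros simp: algebra_simps power2_eq_square)
      moreover have "0 \<le> (l\<^sup>2 - 1) * (sinh (l * t) * sinh t)"
        using l t by (intro mult_nonneg_nonneg) auto
      ultimately show "\<exists>y. DERIV n t :> y \<and> 0 \<le> y" by blast
    qed
    then show ?thesis by (simp add: n_def)
  qed
  show ?thesis
  proof (rule DERIV_nonneg_imp_nondecreasing[OF PQ(2)])
    fix t assume t: "Q \<le> t" "t \<le> P"
    then have s: "sinh t \<noteq> 0" using PQ by auto
    have "DERIV (\<lambda>t. sinh (l * t) / sinh t) t :> n t / (sinh t)\<^sup>2"
      using s unfolding n_def by (auto intro!: derivative_eq_intros simp: power2_eq_square algebra_simps)
    then show "\<exists>y. DERIV (\<lambda>t. sinh (l * t) / sinh t) t :> y \<and> 0 \<le> y" using n0[of t] t PQ by auto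
  qed
qed

lemma exp_diff_sinh: "exp x - exp y = 2 * exp ((x + y) / 2) * sinh ((x - y) / 2)" for x y :: real
proof -
  have "2 * exp ((x + y) / 2) * sinh ((x - y) / 2) = exp ((x + y) / 2) * exp ((x - y) / 2) - exp ((x + y) / 2) * exp (- ((x - y) / 2))"
    by (simp add: sinh_def algebra_simps)
  also have "\<dots> = exp ((x + y) / 2 + (x - y) / 2) - exp ((x + y) / 2 + - ((x - y) / 2))" by (simp only: exp_add)
  also have "(x + y) / 2 + (x - y) / 2 = x" by (simp add: field_simps)
  also have "(x + y) / 2 + - ((x - y) / 2) = y" by (simp add: field_simps)
  finally show ?thesis by simp
qed

text \<open>In logarithmic coordinates a power is a linear map, and the cross ratio becomes a product of two
quotients \<open>sinh P / sinh Q\<close> with \<open>Q < P\<close>, each of which grows under scaling.\<close>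

lemma cross_exp:
  "cross (exp a) (exp b) (exp x) (exp d) = (sinh ((x - a) / 2) / sinh ((b - a) / 2)) * (sinh ((d - b) / 2) / sinh ((d - x) / 2))"
proof -
  have e: "exp ((x + a) / 2) * exp ((d + b) / 2) = exp ((b + a) / 2) * exp ((d + x) / 2)"
    by (simp add: exp_add[symmetric] field_simps)
  have "cross (exp a) (exp b) (exp x) (exp d) =
    (4 * (exp ((x + a) / 2) * exp ((d + b) / 2)) * (sinh ((x - a) / 2) * sinh ((d - b) / 2))) /
    (4 * (exp ((b + a) / 2) * exp ((d + x) / 2)) * (sinh ((b - a) / 2) * sinh ((d - x) / 2)))"
    unfolding cross_def exp_diff_sinh[of x a] exp_diff_sinh[of d b] exp_diff_sinh[of b a] exp_diff_sinh[of d x] by (simp add: mult_ac)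
  also have "\<dots> = (sinh ((x - a) / 2) * sinh ((d - b) / 2)) / (sinh ((b - a) / 2) * sinh ((d - x) / 2))"
    unfolding e by simp
  finally show ?thesis by simp
qed

lemma cross_powr_pos:
  assumes l: "1 \<le> l" and o: "0 < a" "a < b" "b < x" "x < d"
  shows "cross a b x d \<le> cross (a powr l) (b powr l) (x powr l) (d powr l)"
proof -
  define A B X D where "A = ln a" "B = ln b" "X = ln x" "D = ln d"
  have e: "a = exp A" "b = exp B" "x = exp X" "d = exp D" using o by (auto simp: A_B_X_D_def)
  have o': "A < B" "B < X" "X < D" using o by (auto simp: e)
  have p: "exp y powr l = exp (l * y)" for y by (simp add: powr_def)
  have r: "sinh P / sinh Q \<le> sinh (l * P) / sinh (l * Q)" if "0 < Q" "Q < P" for P Q :: real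
  proof -
    have "sinh (l * Q) / sinh Q \<le> sinh (l * P) / sinh P" using sinh_ratio_mono[OF l] that by simp
    moreover have "0 < sinh P" "0 < sinh Q" "0 < sinh (l * Q)" using that l by auto
    ultimately show ?thesis by (simp add: field_simps)
  qed
  have h: "(l * y - l * z) / 2 = l * ((y - z) / 2)" for y z by (simp add: field_simps)
  show ?thesis
    unfolding e p cross_exp h
  proof (rule mult_mono)
    show "sinh ((X - A) / 2) / sinh ((B - A) / 2) \<le> sinh (l * ((X - A) / 2)) / sinh (l * ((B - A) / 2))"
      by (rule r) (use o' in auto)
    show "sinh ((D - B) / 2) / sinh ((D - X) / 2) \<le> sinh (l * ((D - B) / 2)) / sinh (l * ((D - X) / 2))"
      by (rule r) (use o' in auto)
    show "0 \<le> sinh (l * ((X - A) / 2)) / sinh (l * ((B - A) / 2))" "0 \<le> sinh ((D - B) / 2) / sinh ((D - X) / 2)"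
      using o' l by (auto intro!: divide_nonneg_nonneg)
  qed
qed

text \<open>At \<open>a = 0\<close> logarithmic coordinates fail; pass to the limit.\<close>

lemma cross_powr:
  assumes l: "1 \<le> l" and o: "0 \<le> a" "a < b" "b < x" "x < d"
  shows "cross a b x d \<le> cross (a powr l) (b powr l) (x powr l) (d powr l)"
proof (cases "a = 0")
  case False then show ?thesis using cross_powr_pos[OF l] o by simp
next
  case True
  have bl: "0 < b powr l" "x powr l < d powr l" using o True l by (auto intro: powr_less_mono2)
  let ?F = "\<lambda>t. cross (t powr l) (b powr l) (x powr l) (d powr l)" and ?G = "\<lambda>t. cross t b x d"
  have p: "((\<lambda>t. t powr l) \<longlongrightarrow> 0 powr l) (at_right 0)"
    by (rule tendsto_powr') (use l in \<open>auto simp: eventually_at_right_less intro!: tendsto_eq_intros eventually_at_right_less[THEN eventually_mono]\<close>)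
  have F: "(?F \<longlongrightarrow> ?F 0) (at_right 0)" unfolding cross_def
    by (intro tendsto_intros p) (use bl l o in auto)
  have G: "(?G \<longlongrightarrow> ?G 0) (at_right 0)" unfolding cross_def
    by (intro tendsto_intros) (use o True in auto)
  have "\<forall>\<^sub>F t in at_right 0. ?G t \<le> ?F t"
    using eventually_at_right_real[of 0 b] o True by (auto elim!: eventually_mono intro!: cross_powr_pos[OF l])
  from tendsto_le[OF _ F G this] show ?thesis using True by simp
qed

text \<open>\<open>F\<close> describes one side of the turning point, parametrised by the distance \<open>t\<close> to it. The derivative
of the inner map \<open>ch\<close> is only required inside the interval; its Lipschitz constant is uniform up to both ends.\<close>

definition side_ok :: "(real \<Rightarrow> real) \<Rightarrow> real \<Rightarrow> real \<Rightarrow> bool" where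
  "side_ok F L l \<longleftrightarrow> continuous_on {0..L} F \<and> (\<exists>ch ch1 m Lc. 0 < m \<and> 0 \<le> Lc \<and> continuous_on {0..L} ch \<and> ch 0 = 0 \<and>
     (\<forall>t\<in>{0<..<L}. (ch has_real_derivative ch1 t) (at t) \<and> m \<le> ch1 t) \<and>
     (\<forall>s\<in>{0<..<L}. \<forall>t\<in>{0<..<L}. \<bar>ch1 s - ch1 t\<bar> \<le> Lc * \<bar>s - t\<bar>) \<and>
     (\<forall>t\<in>{0..L}. \<bar>F t - F 0\<bar> = ch t powr l))"

text \<open>Up to a factor \<open>exp (C * length)\<close> the inner map \<open>ch\<close> is affine, because the quotient of two values of its
derivative is bounded in that way; composing with the power gives (1) via \<open>cross_powr\<close>, and the others by the mean
value theorem.\<close>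

lemma side_consequences:
  assumes s: "side_ok F L l" and L: "0 < L" and l: "1 \<le> l"
  shows "\<exists>K\<ge>0. \<forall>a b x d. 0 \<le> a \<and> a < b \<and> b < x \<and> x < d \<and> d \<le> L \<longrightarrow>
      exp (- K * (d - a)) * cross a b x d \<le> cross \<bar>F a - F 0\<bar> \<bar>F b - F 0\<bar> \<bar>F x - F 0\<bar> \<bar>F d - F 0\<bar>"
    and "\<exists>mm>0. \<exists>MM. \<forall>t\<in>{0..L}. mm * t powr l \<le> \<bar>F t - F 0\<bar> \<and> \<bar>F t - F 0\<bar> \<le> MM * t powr l"
    and "\<forall>\<delta>>0. \<exists>K\<ge>0. \<forall>p q r. (p < q \<and> q < r \<or> r < q \<and> q < p) \<and> p \<in> {\<delta>..L} \<and> r \<in> {\<delta>..L} \<longrightarrow>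
      \<bar>\<bar>F q - F 0\<bar> - \<bar>F p - F 0\<bar>\<bar> * \<bar>r - q\<bar> \<le> exp (K * \<bar>r - p\<bar>) * \<bar>\<bar>F r - F 0\<bar> - \<bar>F q - F 0\<bar>\<bar> * \<bar>q - p\<bar>"
    and "\<And>a b. 0 \<le> a \<Longrightarrow> a < b \<Longrightarrow> b \<le> L \<Longrightarrow> \<bar>F a - F 0\<bar> < \<bar>F b - F 0\<bar>"
proof -
  obtain ch ch1 m Lc where m: "0 < m" and La: "0 \<le> Lc" and ct: "continuous_on {0..L} ch" and z: "ch 0 = 0"
    and d1: "\<And>t. t \<in> {0<..<L} \<Longrightarrow> (ch has_real_derivative ch1 t) (at t)" and m1: "\<And>t. t \<in> {0<..<L} \<Longrightarrow> m \<le> ch1 t"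
    and lip: "\<And>s t. s \<in> {0<..<L} \<Longrightarrow> t \<in> {0<..<L} \<Longrightarrow> \<bar>ch1 s - ch1 t\<bar> \<le> Lc * \<bar>s - t\<bar>"
    and F: "\<And>t. t \<in> {0..L} \<Longrightarrow> \<bar>F t - F 0\<bar> = ch t powr l"
    using s unfolding side_ok_def by blast
  have mvt: "\<exists>\<xi>. p < \<xi> \<and> \<xi> < q \<and> ch q - ch p = (q - p) * ch1 \<xi>" if pq: "0 \<le> p" "p < q" "q \<le> L" for p q
  proof -
    have "\<exists>l z. p < z \<and> z < q \<and> DERIV ch z :> l \<and> ch q - ch p = (q - p) * l"
    proof (rule MVT[OF pq(2)])
      show "continuous_on {p..q} ch" by (rule continuous_on_subset[OF ct]) (use pq in auto)
    next
      fix t assume "p < t" "t < q"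
      then show "ch differentiable (at t)" using d1[of t] pq by (auto simp: real_differentiable_def)
    qed
    then obtain l z where "p < z" "z < q" "DERIV ch z :> l" "ch q - ch p = (q - p) * l" by blast
    moreover from this have "l = ch1 z" using d1[of z] pq by (auto intro: DERIV_unique)
    ultimately show ?thesis by blast
  qed
  have rat: "ch1 s \<le> exp (Lc / m * \<bar>s - t\<bar>) * ch1 t" if st: "s \<in> {0<..<L}" "t \<in> {0<..<L}" for s t
  proof -
    have "ch1 s \<le> ch1 t + Lc * \<bar>s - t\<bar>" using lip[OF st] by linarith
    also have "\<dots> \<le> ch1 t + Lc * \<bar>s - t\<bar> * (ch1 t / m)"
      using m1[OF st(2)] m La mult_left_mono[of 1 "ch1 t / m" "Lc * \<bar>s - t\<bar>"] by simp
    also have "\<dots> = (1 + Lc / m * \<bar>s - t\<bar>) * ch1 t" using m by (simp add: field_simps)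
    also have "\<dots> \<le> exp (Lc / m * \<bar>s - t\<bar>) * ch1 t"
      using m1[OF st(2)] m by (intro mult_right_mono exp_ge_add_one_self) auto
    finally show ?thesis .
  qed
  have smo: "ch p < ch q" if pq: "0 \<le> p" "p < q" "q \<le> L" for p q
  proof -
    obtain \<xi> where x: "p < \<xi>" "\<xi> < q" "ch q - ch p = (q - p) * ch1 \<xi>" using mvt[OF pq] by blast
    then have "0 < ch1 \<xi>" using m1[of \<xi>] m pq by auto
    then have "0 < (q - p) * ch1 \<xi>" using pq by simp
    then show ?thesis using x(3) by linarith
  qed
  have nn: "0 \<le> ch t" if "t \<in> {0..L}" for t using smo[of 0 t] that z by (cases "t = 0") auto
  define M where "M = ch1 (L / 2) + Lc * L"
  have M: "ch1 t \<le> M" if "t \<in> {0<..<L}" for t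
  proof -
    have "\<bar>ch1 t - ch1 (L / 2)\<bar> \<le> Lc * \<bar>t - L / 2\<bar>" using lip[of t "L / 2"] that L by simp
    also have "\<dots> \<le> Lc * L" using La that L by (intro mult_left_mono) (auto simp: abs_if)
    finally show ?thesis by (simp add: M_def)
  qed
  have mM: "m \<le> M" using m1[of "L / 2"] M[of "L / 2"] L by auto
  have lin: "m * t \<le> ch t \<and> ch t \<le> M * t" if t: "t \<in> {0..L}" for t
  proof (cases "t = 0")
    case False
    then obtain \<xi> where x: "0 < \<xi>" "\<xi> < t" "ch t - ch 0 = (t - 0) * ch1 \<xi>" using mvt[of 0 t] t by auto
    then have "ch t = ch1 \<xi> * t" "m \<le> ch1 \<xi>" "ch1 \<xi> \<le> M" using m1[of \<xi>] M[of \<xi>] t z by auto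
    then show ?thesis using t by (auto intro: mult_right_mono)
  qed (use z in simp)
  show "\<bar>F a - F 0\<bar> < \<bar>F b - F 0\<bar>" if "0 \<le> a" "a < b" "b \<le> L" for a b
    using F[of a] F[of b] smo[OF that] nn[of a] that l by (auto intro!: powr_less_mono2)
  show "\<exists>K\<ge>0. \<forall>a b x d. 0 \<le> a \<and> a < b \<and> b < x \<and> x < d \<and> d \<le> L \<longrightarrow>
      exp (- K * (d - a)) * cross a b x d \<le> cross \<bar>F a - F 0\<bar> \<bar>F b - F 0\<bar> \<bar>F x - F 0\<bar> \<bar>F d - F 0\<bar>"
  proof (intro exI[of _ "2 * (Lc / m)"] conjI allI impI)
    show "0 \<le> 2 * (Lc / m)" using La m by simp
    fix a b x d assume h: "0 \<le> a \<and> a < b \<and> b < x \<and> x < d \<and> d \<le> L"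
    obtain y1 where y1: "a < y1" "y1 < x" "ch x - ch a = (x - a) * ch1 y1" using mvt[of a x] h by auto
    obtain y2 where y2: "b < y2" "y2 < d" "ch d - ch b = (d - b) * ch1 y2" using mvt[of b d] h by auto
    obtain y3 where y3: "a < y3" "y3 < b" "ch b - ch a = (b - a) * ch1 y3" using mvt[of a b] h by auto
    obtain y4 where y4: "x < y4" "y4 < d" "ch d - ch x = (d - x) * ch1 y4" using mvt[of x d] h by auto
    have in_: "y1 \<in> {0<..<L}" "y2 \<in> {0<..<L}" "y3 \<in> {0<..<L}" "y4 \<in> {0<..<L}" using y1 y2 y3 y4 h by auto
    have pos: "0 < ch1 y1" "0 < ch1 y2" "0 < ch1 y3" "0 < ch1 y4" using m1[OF in_(1)] m1[OF in_(2)] m1[OF in_(3)] m1[OF in_(4)] m by auto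
    let ?e = "exp (- (Lc / m * (d - a)))"
    have lowr: "?e \<le> ch1 s / ch1 t" if st: "s \<in> {0<..<L}" "t \<in> {0<..<L}" "\<bar>t - s\<bar> \<le> d - a" for s t
    proof -
      have p: "0 < ch1 s" "0 < ch1 t" using m1[OF st(1)] m1[OF st(2)] m by auto
      have "ch1 t \<le> exp (Lc / m * \<bar>t - s\<bar>) * ch1 s" by (rule rat) (use st in auto)
      also have "\<dots> \<le> exp (Lc / m * (d - a)) * ch1 s"
        using st(3) La m p by (intro mult_right_mono) (auto intro!: divide_right_mono mult_left_mono)
      finally have "?e * ch1 t \<le> ?e * (exp (Lc / m * (d - a)) * ch1 s)" by (intro mult_left_mono) auto
      also have "\<dots> = ch1 s" by (simp add: mult.assoc[symmetric] exp_add[symmetric])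
      finally show ?thesis using p by (simp add: field_simps)
    qed
    have "?e * ?e \<le> (ch1 y1 / ch1 y3) * (ch1 y2 / ch1 y4)"
      by (intro mult_mono lowr in_) (use y1 y2 y3 y4 h pos in auto)
    moreover have "0 \<le> cross a b x d" unfolding cross_def using h by auto
    ultimately have "?e * ?e * cross a b x d \<le> (ch1 y1 / ch1 y3) * (ch1 y2 / ch1 y4) * cross a b x d" by (rule mult_right_mono)
    also have "\<dots> = cross (ch a) (ch b) (ch x) (ch d)"
      unfolding cross_def y1 y2 y3 y4 by (simp add: mult_ac)
    also have "\<dots> \<le> cross (ch a powr l) (ch b powr l) (ch x powr l) (ch d powr l)"
      by (rule cross_powr[OF l]) (use h nn smo in auto)
    also have "?e * ?e = exp (- (2 * (Lc / m)) * (d - a))"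
    proof -
      have "- (z * (d - a)) + - (z * (d - a)) = - (2 * z) * (d - a)" for z by (simp add: algebra_simps)
      then show ?thesis by (simp only: exp_add[symmetric])
    qed
    finally show "exp (- (2 * (Lc / m)) * (d - a)) * cross a b x d \<le> cross \<bar>F a - F 0\<bar> \<bar>F b - F 0\<bar> \<bar>F x - F 0\<bar> \<bar>F d - F 0\<bar>"
      using F h by auto
  qed
  show "\<exists>mm>0. \<exists>MM. \<forall>t\<in>{0..L}. mm * t powr l \<le> \<bar>F t - F 0\<bar> \<and> \<bar>F t - F 0\<bar> \<le> MM * t powr l"
  proof (rule exI[of _ "m powr l"], intro conjI exI[of _ "M powr l"] ballI)
    show "0 < m powr l" using m by simp
    fix t assume t: "t \<in> {0..L}"
    have "(m * t) powr l \<le> ch t powr l" "ch t powr l \<le> (M * t) powr l"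
      using lin[OF t] nn[OF t] l m t by (auto intro!: powr_mono2)
    then show "m powr l * t powr l \<le> \<bar>F t - F 0\<bar>" "\<bar>F t - F 0\<bar> \<le> M powr l * t powr l"
      using F[OF t] by (simp_all add: powr_mult)
  qed
  show "\<forall>\<delta>>0. \<exists>K\<ge>0. \<forall>p q r. (p < q \<and> q < r \<or> r < q \<and> q < p) \<and> p \<in> {\<delta>..L} \<and> r \<in> {\<delta>..L} \<longrightarrow>
      \<bar>\<bar>F q - F 0\<bar> - \<bar>F p - F 0\<bar>\<bar> * \<bar>r - q\<bar> \<le> exp (K * \<bar>r - p\<bar>) * \<bar>\<bar>F r - F 0\<bar> - \<bar>F q - F 0\<bar>\<bar> * \<bar>q - p\<bar>"
  proof (intro allI impI)
    fix \<delta> :: real assume dl: "0 < \<delta>"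
    define \<Phi> where "\<Phi> t = l * ch t powr (l - 1) * ch1 t" for t
    define K where "K = Lc / m + (l - 1) * (M / (m * \<delta>))"
    have K0: "0 \<le> K" using La m l mM dl by (auto simp: K_def)
    have chp: "m * \<delta> \<le> ch t" "0 < ch t" if "t \<in> {\<delta>..L}" for t
    proof -
      have "m * \<delta> \<le> m * t" using that m by simp
      then show "m * \<delta> \<le> ch t" using lin[of t] that dl by auto
      then show "0 < ch t" using m dl mult_pos_pos[of m \<delta>] by linarith
    qed
    have mvt2: "\<exists>\<xi>. p < \<xi> \<and> \<xi> < q \<and> ch q powr l - ch p powr l = (q - p) * \<Phi> \<xi>" if pq: "\<delta> \<le> p" "p < q" "q \<le> L" for p q
    proof -
      have der: "((\<lambda>t. ch t powr l) has_real_derivative \<Phi> t) (at t)" if "p < t" "t < q" for t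
        using d1[of t] chp(2)[of t] that pq dl unfolding \<Phi>_def by (auto intro!: derivative_eq_intros)
      have "\<exists>l' z. p < z \<and> z < q \<and> DERIV (\<lambda>t. ch t powr l) z :> l' \<and> ch q powr l - ch p powr l = (q - p) * l'"
      proof (rule MVT[OF pq(2)])
        have "continuous_on {p..q} ch" by (rule continuous_on_subset[OF ct]) (use pq dl in auto)
        then show "continuous_on {p..q} (\<lambda>t. ch t powr l)"
        proof (intro continuous_on_powr continuous_on_const ballI)
          fix t assume "t \<in> {p..q}"
          then show "ch t \<noteq> 0" using chp(2)[of t] pq by auto
        qed
      next
        fix t assume "p < t" "t < q"
        then show "(\<lambda>t. ch t powr l) differentiable (at t)" using der[of t] by (auto simp: real_differentiable_def)
      qed
      then obtain l' z where "p < z" "z < q" "DERIV (\<lambda>t. ch t powr l) z :> l'" "ch q powr l - ch p powr l = (q - p) * l'" by blast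
      moreover from this have "l' = \<Phi> z" using der[of z] by (auto intro: DERIV_unique)
      ultimately show ?thesis by blast
    qed
    have Phr: "\<Phi> s \<le> exp (K * \<bar>s - t\<bar>) * \<Phi> t" and Ph0: "0 \<le> \<Phi> t" if st: "s \<in> {\<delta>..<L}" "t \<in> {\<delta>..<L}" for s t
    proof -
      have st': "s \<in> {0<..<L}" "t \<in> {0<..<L}" "s \<in> {\<delta>..L}" "t \<in> {\<delta>..L}" using st dl by auto
      have "ch s \<le> ch t + M * \<bar>s - t\<bar>"
      proof (cases "s \<le> t")
        case True
        then have "ch s \<le> ch t" using smo[of s t] st' by (cases "s = t") auto
        moreover have "0 \<le> M * \<bar>s - t\<bar>" using mM m by simp
          ultimately show ?thesis by linarith
      next
        case False
        then obtain \<xi> where x: "t < \<xi>" "\<xi> < s" "ch s - ch t = (s - t) * ch1 \<xi>" using mvt[of t s] st' by auto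
        then have "(s - t) * ch1 \<xi> \<le> (s - t) * M" using M[of \<xi>] st' False by (intro mult_left_mono) auto
        then have "ch s \<le> ch t + (s - t) * M" using x(3) by linarith
        then show ?thesis using False by (simp add: mult.commute)
      qed
      also have "\<dots> \<le> ch t + M * \<bar>s - t\<bar> * (ch t / (m * \<delta>))"
      proof -
        have "1 \<le> ch t / (m * \<delta>)" using chp(1)[OF st'(4)] m dl by simp
        then show ?thesis using mM m mult_left_mono[of 1 "ch t / (m * \<delta>)" "M * \<bar>s - t\<bar>"] by simp
      qed
      also have "\<dots> = (1 + M / (m * \<delta>) * \<bar>s - t\<bar>) * ch t" by (simp add: field_simps)
      also have "\<dots> \<le> exp (M / (m * \<delta>) * \<bar>s - t\<bar>) * ch t"
        using chp(2)[OF st'(4)] by (intro mult_right_mono exp_ge_add_one_self) auto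
      finally have "ch s powr (l - 1) \<le> (exp (M / (m * \<delta>) * \<bar>s - t\<bar>) * ch t) powr (l - 1)"
        using chp(2)[OF st'(3)] l by (intro powr_mono2) auto
      also have "\<dots> = exp ((l - 1) * (M / (m * \<delta>)) * \<bar>s - t\<bar>) * ch t powr (l - 1)"
      proof -
        have ex: "exp y powr e = exp (e * y)" for y e :: real by (simp add: powr_def)
        show ?thesis unfolding powr_mult ex by (simp add: mult.assoc)
      qed
      finally have p: "ch s powr (l - 1) \<le> exp ((l - 1) * (M / (m * \<delta>)) * \<bar>s - t\<bar>) * ch t powr (l - 1)" .
      have pos: "0 < ch1 s" "0 < ch1 t" using m1[OF st'(1)] m1[OF st'(2)] m by auto
      show "0 \<le> \<Phi> t" using pos l by (simp add: \<Phi>_def)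
      have "ch s powr (l - 1) * ch1 s \<le> (exp ((l - 1) * (M / (m * \<delta>)) * \<bar>s - t\<bar>) * ch t powr (l - 1)) * (exp (Lc / m * \<bar>s - t\<bar>) * ch1 t)"
        using p rat[OF st'(1,2)] pos by (intro mult_mono) auto
      also have "\<dots> = exp (K * \<bar>s - t\<bar>) * (ch t powr (l - 1) * ch1 t)"
        unfolding K_def distrib_right exp_add by (simp add: mult_ac)
      finally have "l * (ch s powr (l - 1) * ch1 s) \<le> l * (exp (K * \<bar>s - t\<bar>) * (ch t powr (l - 1) * ch1 t))"
        using l by (intro mult_left_mono) auto
      then show "\<Phi> s \<le> exp (K * \<bar>s - t\<bar>) * \<Phi> t" by (simp add: \<Phi>_def mult_ac)
    qed
    have fin: "\<bar>ch q powr l - ch p powr l\<bar> * \<bar>r - q\<bar> \<le> exp (K * \<bar>r - p\<bar>) * \<bar>ch r powr l - ch q powr l\<bar> * \<bar>q - p\<bar>"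
      if "\<bar>ch q powr l - ch p powr l\<bar> = \<bar>q - p\<bar> * \<Phi> y" "\<bar>ch r powr l - ch q powr l\<bar> = \<bar>r - q\<bar> * \<Phi> w"
        "y \<in> {\<delta>..<L}" "w \<in> {\<delta>..<L}" "\<bar>y - w\<bar> \<le> \<bar>r - p\<bar>" for p q r y w
    proof -
      have "\<Phi> y \<le> exp (K * \<bar>y - w\<bar>) * \<Phi> w" by (rule Phr) (use that in auto)
      also have "\<dots> \<le> exp (K * \<bar>r - p\<bar>) * \<Phi> w"
        using that(5) K0 Ph0[OF that(3,4)] by (intro mult_right_mono) (auto intro: mult_left_mono)
      finally have "(\<bar>q - p\<bar> * \<bar>r - q\<bar>) * \<Phi> y \<le> (\<bar>q - p\<bar> * \<bar>r - q\<bar>) * (exp (K * \<bar>r - p\<bar>) * \<Phi> w)"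
        by (intro mult_left_mono) auto
      then show ?thesis unfolding that(1,2) by (simp add: mult_ac)
    qed
    show "\<exists>K\<ge>0. \<forall>p q r. (p < q \<and> q < r \<or> r < q \<and> q < p) \<and> p \<in> {\<delta>..L} \<and> r \<in> {\<delta>..L} \<longrightarrow>
      \<bar>\<bar>F q - F 0\<bar> - \<bar>F p - F 0\<bar>\<bar> * \<bar>r - q\<bar> \<le> exp (K * \<bar>r - p\<bar>) * \<bar>\<bar>F r - F 0\<bar> - \<bar>F q - F 0\<bar>\<bar> * \<bar>q - p\<bar>"
    proof (intro exI[of _ K] conjI allI impI K0)
      fix p q r assume h: "(p < q \<and> q < r \<or> r < q \<and> q < p) \<and> p \<in> {\<delta>..L} \<and> r \<in> {\<delta>..L}"
      have in0: "p \<in> {0..L}" "q \<in> {0..L}" "r \<in> {0..L}" using h dl by auto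
      have "\<bar>ch q powr l - ch p powr l\<bar> * \<bar>r - q\<bar> \<le> exp (K * \<bar>r - p\<bar>) * \<bar>ch r powr l - ch q powr l\<bar> * \<bar>q - p\<bar>"
      proof (cases "p < q")
        case True
        with h have o: "p < q" "q < r" "\<delta> \<le> p" "r \<le> L" by auto
        obtain y where y: "p < y" "y < q" "ch q powr l - ch p powr l = (q - p) * \<Phi> y" using mvt2[of p q] o by auto
        obtain w where w: "q < w" "w < r" "ch r powr l - ch q powr l = (r - q) * \<Phi> w" using mvt2[of q r] o by auto
        have i: "y \<in> {\<delta>..<L}" "w \<in> {\<delta>..<L}" using y w o by auto
        show ?thesis
          by (rule fin[of q p y r w]) (use y w o i Ph0[OF i(1) i(1)] Ph0[OF i(2) i(2)] in \<open>auto simp: abs_mult\<close>)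
      next
        case False
        with h have o: "r < q" "q < p" "\<delta> \<le> r" "p \<le> L" by auto
        obtain y where y: "q < y" "y < p" "ch p powr l - ch q powr l = (p - q) * \<Phi> y" using mvt2[of q p] o by auto
        obtain w where w: "r < w" "w < q" "ch q powr l - ch r powr l = (q - r) * \<Phi> w" using mvt2[of r q] o by auto
        have i: "y \<in> {\<delta>..<L}" "w \<in> {\<delta>..<L}" using y w o by auto
        have e: "\<bar>ch q powr l - ch p powr l\<bar> = \<bar>q - p\<bar> * \<Phi> y" "\<bar>ch r powr l - ch q powr l\<bar> = \<bar>r - q\<bar> * \<Phi> w"
          using y(3) w(3) o Ph0[OF i(1) i(1)] Ph0[OF i(2) i(2)]
          by (metis abs_minus_commute abs_mult abs_of_nonneg)+
        show ?thesis by (rule fin[OF e i]) (use y w o in auto)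
      qed
      then show "\<bar>\<bar>F q - F 0\<bar> - \<bar>F p - F 0\<bar>\<bar> * \<bar>r - q\<bar> \<le> exp (K * \<bar>r - p\<bar>) * \<bar>\<bar>F r - F 0\<bar> - \<bar>F q - F 0\<bar>\<bar> * \<bar>q - p\<bar>"
        unfolding F[OF in0(1)] F[OF in0(2)] F[OF in0(3)] .
    qed
  qed
qed

section \<open>From the local normal forms to one-sided power maps\<close>

text \<open>Bounded Lipschitz functions: stable under products, composition, and powers away from zero, which is
how Lipschitz bounds for derivatives are assembled below.\<close>

definition BL :: "(real \<Rightarrow> real) \<Rightarrow> real set \<Rightarrow> bool" where
  "BL g S \<longleftrightarrow> (\<exists>C M. 0 \<le> C \<and> (\<forall>x\<in>S. \<bar>g x\<bar> \<le> M) \<and> (\<forall>x\<in>S. \<forall>y\<in>S. \<bar>g x - g y\<bar> \<le> C * \<bar>x - y\<bar>))"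

lemma BL_subset: "BL g T \<Longrightarrow> S \<subseteq> T \<Longrightarrow> BL g S" unfolding BL_def by blast

lemma BL_cong: "(\<And>x. x \<in> S \<Longrightarrow> g x = h x) \<Longrightarrow> BL h S \<Longrightarrow> BL g S" unfolding BL_def by auto

lemma BL_const: "BL (\<lambda>_. k) S" unfolding BL_def by (intro exI[of _ 0] exI[of _ "\<bar>k\<bar>"]) auto

lemma BL_mult: assumes "BL g S" "BL h S" shows "BL (\<lambda>x. g x * h x) S"
proof -
  obtain C M where g: "0 \<le> C" "\<And>x. x \<in> S \<Longrightarrow> \<bar>g x\<bar> \<le> M" "\<And>x y. x \<in> S \<Longrightarrow> y \<in> S \<Longrightarrow> \<bar>g x - g y\<bar> \<le> C * \<bar>x - y\<bar>"
    using assms(1) unfolding BL_def by blast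
  obtain D N where h: "0 \<le> D" "\<And>x. x \<in> S \<Longrightarrow> \<bar>h x\<bar> \<le> N" "\<And>x y. x \<in> S \<Longrightarrow> y \<in> S \<Longrightarrow> \<bar>h x - h y\<bar> \<le> D * \<bar>x - y\<bar>"
    using assms(2) unfolding BL_def by blast
  show ?thesis unfolding BL_def
  proof (rule exI[of _ "C * \<bar>N\<bar> + \<bar>M\<bar> * D"], rule exI[of _ "\<bar>M\<bar> * \<bar>N\<bar>"], intro conjI ballI)
    show "0 \<le> C * \<bar>N\<bar> + \<bar>M\<bar> * D" using g h by auto
    fix x assume x: "x \<in> S"
    show "\<bar>g x * h x\<bar> \<le> \<bar>M\<bar> * \<bar>N\<bar>" unfolding abs_mult
      using g(2)[OF x] h(2)[OF x] by (intro mult_mono) auto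
    fix y assume y: "y \<in> S"
    have "g x * h x - g y * h y = (g x - g y) * h x + g y * (h x - h y)" by (simp add: algebra_simps)
    then have "\<bar>g x * h x - g y * h y\<bar> \<le> \<bar>g x - g y\<bar> * \<bar>h x\<bar> + \<bar>g y\<bar> * \<bar>h x - h y\<bar>"
      by (metis abs_mult abs_triangle_ineq)
    also have "\<dots> \<le> (C * \<bar>x - y\<bar>) * \<bar>N\<bar> + \<bar>M\<bar> * (D * \<bar>x - y\<bar>)"
      using g(2)[OF y] h(2)[OF x] g(3)[OF x y] h(3)[OF x y] g(1) by (intro add_mono mult_mono) auto
    also have "\<dots> = (C * \<bar>N\<bar> + \<bar>M\<bar> * D) * \<bar>x - y\<bar>" by (simp add: algebra_simps)
    finally show "\<bar>g x * h x - g y * h y\<bar> \<le> (C * \<bar>N\<bar> + \<bar>M\<bar> * D) * \<bar>x - y\<bar>" .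
  qed
qed

lemma BL_comp: assumes "BL g T" "BL h S" "\<And>x. x \<in> S \<Longrightarrow> h x \<in> T" shows "BL (\<lambda>x. g (h x)) S"
proof -
  obtain C M where g: "0 \<le> C" "\<And>x. x \<in> T \<Longrightarrow> \<bar>g x\<bar> \<le> M" "\<And>x y. x \<in> T \<Longrightarrow> y \<in> T \<Longrightarrow> \<bar>g x - g y\<bar> \<le> C * \<bar>x - y\<bar>"
    using assms(1) unfolding BL_def by blast
  obtain D N where h: "0 \<le> D" "\<And>x y. x \<in> S \<Longrightarrow> y \<in> S \<Longrightarrow> \<bar>h x - h y\<bar> \<le> D * \<bar>x - y\<bar>"
    using assms(2) unfolding BL_def by blast
  show ?thesis unfolding BL_def
  proof (rule exI[of _ "C * D"], rule exI[of _ M], intro conjI ballI)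
    fix x y assume "x \<in> S" "y \<in> S"
    then have "\<bar>g (h x) - g (h y)\<bar> \<le> C * \<bar>h x - h y\<bar>" "\<bar>h x - h y\<bar> \<le> D * \<bar>x - y\<bar>" using g(3) h(2) assms(3) by auto
    then show "\<bar>g (h x) - g (h y)\<bar> \<le> C * D * \<bar>x - y\<bar>" using mult_left_mono[of "\<bar>h x - h y\<bar>" "D * \<bar>x - y\<bar>" C] g(1) by simp
  qed (use g h assms(3) in auto)
qed

lemma BL_deriv:
  assumes S: "is_interval S" and d: "\<And>x. x \<in> S \<Longrightarrow> (g has_real_derivative g1 x) (at x)"
    and C: "\<And>x. x \<in> S \<Longrightarrow> \<bar>g1 x\<bar> \<le> C" and M: "\<And>x. x \<in> S \<Longrightarrow> \<bar>g x\<bar> \<le> M"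
  shows "BL g S"
proof -
  have lt: "\<bar>g x - g y\<bar> \<le> \<bar>C\<bar> * \<bar>x - y\<bar>" if xy: "x \<in> S" "y \<in> S" "x < y" for x y
  proof -
    have sub: "t \<in> S" if "x \<le> t" "t \<le> y" for t using S xy(1,2) that unfolding is_interval_1 by blast
    obtain z where z: "x < z" "z < y" "g y - g x = (y - x) * g1 z"
      using MVT2[OF xy(3), of g g1] d sub by blast
    have "\<bar>g1 z\<bar> \<le> \<bar>C\<bar>" using C[of z] sub[of z] z by auto
    then have "\<bar>y - x\<bar> * \<bar>g1 z\<bar> \<le> \<bar>y - x\<bar> * \<bar>C\<bar>" by (intro mult_left_mono) auto
    then show ?thesis using z(3) by (metis abs_minus_commute abs_mult mult.commute)
  qed
  then have "\<bar>g x - g y\<bar> \<le> \<bar>C\<bar> * \<bar>x - y\<bar>" if "x \<in> S" "y \<in> S" for x y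
    using that lt[of x y] lt[of y x] by (cases x y rule: linorder_cases) (simp_all add: abs_minus_commute)
  then show ?thesis unfolding BL_def using M by (intro exI[of _ "\<bar>C\<bar>"] exI[of _ M]) auto
qed

lemma compact_bound: fixes g :: "real \<Rightarrow> real" assumes "continuous_on {p..q} g" obtains M where "\<And>x. x \<in> {p..q} \<Longrightarrow> \<bar>g x\<bar> \<le> M"
proof -
  have "bounded (g ` {p..q})" using assms compact_continuous_image compact_imp_bounded by blast
  then obtain M where M: "\<forall>x\<in>g ` {p..q}. norm x \<le> M" unfolding bounded_iff by blast
  show ?thesis by (rule that[of M]) (use M in auto)
qed

lemma compact_pos: fixes g :: "real \<Rightarrow> real" assumes "continuous_on {p..q} g" "\<And>x. x \<in> {p..q} \<Longrightarrow> 0 < g x"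
  obtains m where "0 < m" "\<And>x. x \<in> {p..q} \<Longrightarrow> m \<le> g x"
proof (cases "p \<le> q")
  case True
  then obtain x where "x \<in> {p..q}" "\<And>y. y \<in> {p..q} \<Longrightarrow> g x \<le> g y"
    using continuous_attains_inf[of "{p..q}" g] assms(1) by auto
  then show ?thesis using that[of "g x"] assms(2) by auto
next
  case False then show ?thesis using that[of 1] by auto
qed

lemma BL_C1:
  assumes d: "\<And>x. x \<in> {p..q} \<Longrightarrow> (g has_real_derivative g1 x) (at x)" and c: "continuous_on {p..q} g1"
  shows "BL g {p..q}"
proof -
  have "continuous_on {p..q} g" using d DERIV_continuous_on by (metis has_field_derivative_at_within)
  then obtain M where M: "\<And>x. x \<in> {p..q} \<Longrightarrow> \<bar>g x\<bar> \<le> M" using compact_bound by blast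
  obtain C where C: "\<And>x. x \<in> {p..q} \<Longrightarrow> \<bar>g1 x\<bar> \<le> C" using compact_bound[OF c] by blast
  show ?thesis by (rule BL_deriv[OF _ d C M]) (auto simp: is_interval_cc)
qed

lemma BL_powr:
  assumes h: "BL h S" and m: "0 < m" "\<And>x. x \<in> S \<Longrightarrow> m \<le> h x"
  shows "BL (\<lambda>x. h x powr e) S"
proof -
  obtain M where M: "\<And>x. x \<in> S \<Longrightarrow> \<bar>h x\<bar> \<le> M" using h unfolding BL_def by blast
  have "BL (\<lambda>t. t powr e) {m..M}"
  proof (rule BL_C1)
    fix x assume "x \<in> {m..M}"
    then show "((\<lambda>t. t powr e) has_real_derivative e * x powr (e - 1)) (at x)"
      using m by (auto intro!: derivative_eq_intros)
  next
    show "continuous_on {m..M} (\<lambda>x. e * x powr (e - 1))"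
      using m by (intro continuous_intros) auto
  qed
  then show ?thesis by (rule BL_comp[OF _ h]) (use m M in force)
qed

lemma BL_power_near_0:
  assumes "1 \<le> l" shows "BL (\<lambda>t. t powr l) {0<..U}"
proof (rule BL_deriv)
  show "is_interval {0<..U}" by (simp add: is_interval_oc)
  fix x assume x: "x \<in> {0<..U}"
  then show "((\<lambda>t. t powr l) has_real_derivative l * x powr (l - 1)) (at x)" by (auto intro!: derivative_eq_intros)
  show "\<bar>l * x powr (l - 1)\<bar> \<le> l * U powr (l - 1)" "\<bar>x powr l\<bar> \<le> U powr l"
    using x assms by (auto intro!: mult_left_mono powr_mono2)
qed

lemma const_sign:
  fixes g :: "real \<Rightarrow> real"
  assumes S: "is_interval S" and g: "continuous_on S g" and nz: "\<And>x. x \<in> S \<Longrightarrow> g x \<noteq> 0"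
  obtains s :: real where "s = 1 \<or> s = -1" "\<And>x. x \<in> S \<Longrightarrow> 0 < s * g x"
proof -
  have c: "connected (g ` S)" using connected_continuous_image[OF g] S is_interval_connected by blast
  have "\<not> (\<exists>x\<in>S. \<exists>y\<in>S. g x < 0 \<and> 0 < g y)"
  proof
    assume "\<exists>x\<in>S. \<exists>y\<in>S. g x < 0 \<and> 0 < g y"
    then obtain x y where "x \<in> S" "y \<in> S" "g x < 0" "0 < g y" by blast
    then have "0 \<in> g ` S" using connected_contains_Icc[OF c, of "g x" "g y"] by auto
    then show False using nz by auto
  qed
  then have "(\<forall>x\<in>S. 0 < 1 * g x) \<or> (\<forall>x\<in>S. 0 < -1 * g x)" using nz by (force simp: not_less less_le)
  then show ?thesis using that[of 1] that[of "-1"] by blast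
qed

text \<open>If \<open>\<bar>F t - F 0\<bar> = \<theta> (u t powr l)\<close> then its \<open>l\<close>-th root has the derivative \<open>w\<close>: the singular factors
combine to a power of \<open>\<theta> x / x\<close>, which extends to a Lipschitz function since \<open>\<theta>\<close> is
\<open>C\<^sup>2\<close> with \<open>\<theta> 0 = 0\<close>. This is where two derivatives of the coordinate changes are needed.\<close>

lemma near_part:
  assumes l: "1 \<le> l" and e: "0 < \<epsilon>1"
    and u: "\<And>t. (u has_real_derivative u1 t) (at t)" "\<And>t. (u1 has_real_derivative u2 t) (at t)" "continuous_on UNIV u2"
      "u 0 = 0" "\<And>t. 0 < u1 t"
    and th: "\<And>t. (\<theta> has_real_derivative \<theta>1 t) (at t)" "\<And>t. (\<theta>1 has_real_derivative \<theta>2 t) (at t)" "continuous_on UNIV \<theta>2"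
      "\<theta> 0 = 0" "\<And>t. 0 < \<theta>1 t"
  defines "w \<equiv> \<lambda>t. (\<theta> (u t powr l) / (u t powr l)) powr (1 / l - 1) * \<theta>1 (u t powr l) * u1 t"
  shows "BL w {0<..\<epsilon>1}" "\<exists>m>0. \<forall>t\<in>{0<..\<epsilon>1}. m \<le> w t"
proof -
  have cu: "continuous_on UNIV u1" "continuous_on UNIV \<theta>1"
    using u(2) th(2) by (meson DERIV_continuous_on has_field_derivative_at_within)+
  have upos: "0 < u t" if t: "0 < t" for t
  proof -
    obtain z where "u t - u 0 = (t - 0) * u1 z" using MVT2[OF t, of u u1] u(1) by blast
    then show ?thesis using u(4) u(5)[of z] t by simp
  qed
  have umono: "u s \<le> u t" if st: "s \<le> t" for s t
    by (rule DERIV_nonneg_imp_nondecreasing[OF st]) (use u(1,5) less_imp_le in blast)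
  define V where "V = u \<epsilon>1 powr l"
  have Vp: "0 < V" using upos[OF e] by (simp add: V_def)
  have vin: "u t powr l \<in> {0<..V}" if t: "t \<in> {0<..\<epsilon>1}" for t
    using upos[of t] umono[of t \<epsilon>1] t l by (auto simp: V_def intro!: powr_mono2)
  have BLu1: "BL u1 {0<..\<epsilon>1}" by (rule BL_subset[OF BL_C1[of 0 \<epsilon>1 u1 u2]]) (auto intro: u(2) continuous_on_subset[OF u(3)])
  have BLu: "BL u {0<..\<epsilon>1}" by (rule BL_subset[OF BL_C1[of 0 \<epsilon>1 u u1]]) (auto intro: u(1) continuous_on_subset[OF cu(1)])
  have BLv: "BL (\<lambda>t. u t powr l) {0<..\<epsilon>1}"
    by (rule BL_comp[OF BL_power_near_0[OF l, of "u \<epsilon>1"] BLu]) (use upos umono in auto)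
  have BLt1: "BL \<theta>1 {0<..V}" by (rule BL_subset[OF BL_C1[of 0 V \<theta>1 \<theta>2]]) (auto intro: th(2) continuous_on_subset[OF th(3)])
  obtain m1 where m1: "0 < m1" "\<And>x. x \<in> {0..V} \<Longrightarrow> m1 \<le> \<theta>1 x"
    using compact_pos[OF continuous_on_subset[OF cu(2) subset_UNIV], of 0 V] th(5) by blast
  obtain M1 where M1: "\<And>x. x \<in> {0..V} \<Longrightarrow> \<bar>\<theta>1 x\<bar> \<le> M1" using compact_bound[OF continuous_on_subset[OF cu(2) subset_UNIV], of 0 V] by blast
  obtain M2 where M2: "\<And>x. x \<in> {0..V} \<Longrightarrow> \<bar>\<theta>2 x\<bar> \<le> M2" using compact_bound[OF continuous_on_subset[OF th(3) subset_UNIV], of 0 V] by blast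
  obtain mu where mu: "0 < mu" "\<And>x. x \<in> {0..\<epsilon>1} \<Longrightarrow> mu \<le> u1 x"
    using compact_pos[OF continuous_on_subset[OF cu(1) subset_UNIV], of 0 \<epsilon>1] u(5) by blast
  define r where "r x = \<theta> x / x" for x
  have rx: "\<exists>y. 0 < y \<and> y < x \<and> r x = \<theta>1 y" if x: "x \<in> {0<..V}" for x
  proof -
    obtain y where "0 < y" "y < x" "\<theta> x - \<theta> 0 = (x - 0) * \<theta>1 y" using MVT2[of 0 x \<theta> \<theta>1] th(1) x by auto
    then show ?thesis using x th(4) by (auto simp: r_def)
  qed
  have rb: "m1 \<le> r x" "\<bar>r x\<bar> \<le> M1" if x: "x \<in> {0<..V}" for x
    using rx[OF x] m1(2) M1 x by fastforce+
  have BLr: "BL r {0<..V}"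
  proof (rule BL_deriv)
    show "is_interval {0<..V}" by (simp add: is_interval_oc)
    fix x assume x: "x \<in> {0<..V}"
    show "(r has_real_derivative (\<theta>1 x - r x) / x) (at x)"
      unfolding r_def using x by (auto intro!: derivative_eq_intros th(1) simp: field_simps power2_eq_square)
    obtain y where y: "0 < y" "y < x" "r x = \<theta>1 y" using rx[OF x] by blast
    obtain z where z: "y < z" "z < x" "\<theta>1 x - \<theta>1 y = (x - y) * \<theta>2 z" using MVT2[OF y(2), of \<theta>1 \<theta>2] th(2) by blast
    have zb: "\<bar>\<theta>2 z\<bar> \<le> M2" using M2[of z] z y x by auto
    have "\<bar>\<theta>1 x - r x\<bar> = \<bar>x - y\<bar> * \<bar>\<theta>2 z\<bar>" using z y by (simp add: abs_mult)
    also have "\<dots> \<le> x * M2" using zb y x by (intro mult_mono) auto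
    finally show "\<bar>(\<theta>1 x - r x) / x\<bar> \<le> M2" using x by (simp add: field_simps)
    show "\<bar>r x\<bar> \<le> M1" by (rule rb(2)[OF x])
  qed
  have BLp: "BL (\<lambda>t. r (u t powr l) powr (1 / l - 1)) {0<..\<epsilon>1}"
    by (rule BL_powr[OF BL_comp[OF BLr BLv vin] m1(1)]) (use rb(1) vin in auto)
  have BLt: "BL (\<lambda>t. \<theta>1 (u t powr l)) {0<..\<epsilon>1}" by (rule BL_comp[OF BLt1 BLv vin])
  have w: "w t = r (u t powr l) powr (1 / l - 1) * \<theta>1 (u t powr l) * u1 t" for t by (simp add: w_def r_def)
  show "BL w {0<..\<epsilon>1}" unfolding w[abs_def] by (rule BL_mult[OF BL_mult[OF BLp BLt] BLu1])
  show "\<exists>m>0. \<forall>t\<in>{0<..\<epsilon>1}. m \<le> w t"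
  proof (intro exI[of _ "M1 powr (1 / l - 1) * m1 * mu"] conjI ballI)
    have "m1 \<le> M1" using rb[of V] Vp by auto
    then show "0 < M1 powr (1 / l - 1) * m1 * mu" using m1 mu by simp
    fix t assume t: "t \<in> {0<..\<epsilon>1}"
    have v: "u t powr l \<in> {0<..V}" by (rule vin[OF t])
    have "1 / l \<le> 1" using l by simp
    then have "M1 powr (1 / l - 1) \<le> r (u t powr l) powr (1 / l - 1)"
      using rb[OF v] m1(1) by (intro powr_mono2') auto
    then show "M1 powr (1 / l - 1) * m1 * mu \<le> w t"
      unfolding w using m1 mu v t m1(2)[of "u t powr l"] mu(2)[of t] less_imp_le[OF th(5)[of "u t powr l"]] by (intro mult_mono mult_nonneg_nonneg) auto
  qed
qed

text \<open>The inner map is the \<open>l\<close>-th root of \<open>\<bar>F t - F 0\<bar>\<close>. Near 0 the normal form computes its derivative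
(\<open>near_part\<close>); away from 0 the function \<open>\<bar>F t - F 0\<bar>\<close> is bounded below and \<open>C\<^sup>2\<close>. The two descriptions are
glued at a common point.\<close>

lemma side_ok_of_normal_form:
  assumes L: "0 < L" and l: "1 \<le> l"
    and F1: "\<And>t. t \<in> {0<..L} \<Longrightarrow> (F has_real_derivative F1 t) (at t within {0<..L})"
    and F2: "\<And>t. t \<in> {0<..L} \<Longrightarrow> (F1 has_real_derivative F2 t) (at t within {0<..L})"
    and cF2: "continuous_on {0<..L} F2" and nz: "\<And>t. t \<in> {0<..L} \<Longrightarrow> F1 t \<noteq> 0"
    and phi: "\<And>t. (\<phi> has_real_derivative \<phi>1 t) (at t)" "\<And>t. (\<phi>1 has_real_derivative \<phi>2 t) (at t)"
      "continuous_on UNIV \<phi>2" "\<And>t. \<phi>1 t \<noteq> 0" "\<phi> 0 = 0"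
    and zeta: "\<And>t. (\<zeta> has_real_derivative \<zeta>1 t) (at t)" "\<And>t. (\<zeta>1 has_real_derivative \<zeta>2 t) (at t)"
      "continuous_on UNIV \<zeta>2" "\<And>t. \<zeta>1 t \<noteq> 0"
    and psi: "\<And>y. \<zeta> (\<psi> y) = y" "continuous_on UNIV \<psi>" "\<psi> (F 0) = 0"
    and nf: "0 < \<epsilon>" "\<And>t. 0 \<le> t \<Longrightarrow> t < \<epsilon> \<Longrightarrow> t \<le> L \<Longrightarrow> \<bar>\<psi> (F t)\<bar> = \<bar>\<phi> t\<bar> powr l"
  shows "side_ok F L l"
proof -
  have DF: "(F has_real_derivative F1 t) (at t)" and DF1: "(F1 has_real_derivative F2 t) (at t)" if t: "t \<in> {0<..<L}" for t
  proof -
    have a: "at t within {0<..L} = at t"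
      by (rule at_within_open_subset[of t "{0<..<L}"]) (use t in auto)
    show "(F has_real_derivative F1 t) (at t)" "(F1 has_real_derivative F2 t) (at t)" using F1[of t] F2[of t] t a by auto
  qed
  have z0: "\<zeta> 0 = F 0" using psi(1)[of "F 0"] psi(3) by simp
  define e' where "e' = min \<epsilon> L"
  have e': "0 < e'" "e' \<le> \<epsilon>" "e' \<le> L" using nf L by (auto simp: e'_def)
  have cF1': "continuous_on {0<..L} F" "continuous_on {0<..L} F1"
    using DERIV_continuous_on F1 F2 by blast+
  have contF: "continuous_on {0..L} F"
    unfolding continuous_on_eq_continuous_within
  proof
    fix t assume t: "t \<in> {0..L}"
    show "continuous (at t within {0..L}) F"
    proof (cases "t = 0")
      case False
      then have t': "t \<in> {0<..L}" using t by auto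
      have a: "at t within {0..L} = at t within {0<..L}"
        by (rule at_within_nhd[of t "{0<..}"]) (use t' in auto)
      show ?thesis unfolding a using cF1'(1) t' by (simp add: continuous_on_eq_continuous_within)
    next
      case True
      have "(\<phi> \<longlongrightarrow> \<phi> 0) (at 0 within {0..L})"
        by (rule tendsto_within_subset[OF DERIV_isCont[OF phi(1), unfolded isCont_def]]) simp
      then have "((\<lambda>t. \<bar>\<phi> t\<bar>) \<longlongrightarrow> 0) (at 0 within {0..L})" using phi(5) tendsto_rabs_zero by force
      then have "((\<lambda>t. \<bar>\<phi> t\<bar> powr l) \<longlongrightarrow> 0 powr l) (at 0 within {0..L})"
        by (rule tendsto_powr') (use l in auto)
      moreover have "\<forall>\<^sub>F t in at 0 within {0..L}. \<bar>\<phi> t\<bar> powr l = \<bar>\<psi> (F t)\<bar>"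
        unfolding eventually_at using nf e' by (intro exI[of _ e']) (auto simp: dist_real_def)
      ultimately have "((\<lambda>t. \<bar>\<psi> (F t)\<bar>) \<longlongrightarrow> 0) (at 0 within {0..L})"
        by (auto intro: Lim_transform_eventually)
      then have "((\<lambda>t. \<psi> (F t)) \<longlongrightarrow> 0) (at 0 within {0..L})" by (rule tendsto_rabs_zero_cancel)
      then have "((\<lambda>t. \<zeta> (\<psi> (F t))) \<longlongrightarrow> \<zeta> 0) (at 0 within {0..L})"
        by (rule isCont_tendsto_compose[OF DERIV_isCont[OF zeta(1)]])
      then show ?thesis using True z0 by (simp add: psi continuous_within)
    qed
  qed
  have ne: "F t \<noteq> F 0" if t: "t \<in> {0<..L}" for t
  proof
    assume e: "F t = F 0"
    have "\<exists>z. 0 < z \<and> z < t \<and> DERIV F z :> 0"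
      
    proof (rule Rolle[of 0 t F])
      show "continuous_on {0..t} F" by (rule continuous_on_subset[OF contF]) (use t in auto)
      fix x assume "0 < x" "x < t"
      then show "F differentiable (at x)" using DF[of x] t by (auto simp: real_differentiable_def)
    qed (use t e in auto)
    then obtain z where "0 < z" "z < t" "DERIV F z :> 0" by blast
    then show False using DERIV_unique[OF DF[of z]] nz[of z] t by auto
  qed
  obtain sF :: real where sF: "sF = 1 \<or> sF = -1" "\<And>t. t \<in> {0<..L} \<Longrightarrow> 0 < sF * (F t - F 0)"
    by (rule const_sign[of "{0<..L}" "\<lambda>t. F t - F 0"])
      (use ne in \<open>auto intro!: continuous_intros cF1' simp: is_interval_oc\<close>)
  define G where "G t = sF * (F t - F 0)" for t
  have G: "0 < G t" "G t = \<bar>F t - F 0\<bar>" if "t \<in> {0<..L}" for t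
    using sF(2)[OF that] sF(1) by (auto simp: G_def)
  define g1 where "g1 t = sF * F1 t" for t
  have DG: "(G has_real_derivative g1 t) (at t)" if t: "t \<in> {0<..<L}" for t
    unfolding G_def g1_def using DF[OF t] by (auto intro!: derivative_eq_intros)
  define ch where "ch t = \<bar>F t - F 0\<bar> powr (1 / l)" for t
  define ch1 where "ch1 t = 1 / l * G t powr (1 / l - 1) * g1 t" for t
  have Dch: "(ch has_real_derivative ch1 t) (at t)" if t: "t \<in> {0<..<L}" for t
  proof -
    have "((\<lambda>t. G t powr (1 / l)) has_real_derivative ch1 t) (at t)"
      unfolding ch1_def using DG[OF t] G(1)[of t] t by (auto intro!: derivative_eq_intros)
    then show ?thesis
      by (rule has_field_derivative_transform_within_open[of _ _ _ "{0<..<L}"]) (use t G(2) in \<open>auto simp: ch_def\<close>)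
  qed
  have cch: "continuous_on {0..L} ch"
    unfolding ch_def using l by (intro continuous_on_powr' continuous_intros contF) auto
  have chl: "\<bar>F t - F 0\<bar> = ch t powr l" for t unfolding ch_def using l by (simp add: powr_powr)
  have ch0: "ch 0 = 0" by (simp add: ch_def)
  have g1pos: "0 < g1 t" if t: "t \<in> {0<..L}" for t
  proof -
    obtain s1 :: real where s1: "s1 = 1 \<or> s1 = -1" "\<And>t. t \<in> {0<..L} \<Longrightarrow> 0 < s1 * F1 t"
      by (rule const_sign[of "{0<..L}" F1]) (use nz cF1'(2) in \<open>auto simp: is_interval_oc\<close>)
    have "\<exists>l z. 0 < z \<and> z < L \<and> DERIV F z :> l \<and> F L - F 0 = (L - 0) * l"
    proof (rule MVT[OF L contF])
      fix x assume "0 < x" "x < L"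
      then show "F differentiable (at x)" using DF[of x] by (auto simp: real_differentiable_def)
    qed
    then obtain l' z where z: "0 < z" "z < L" "DERIV F z :> l'" "F L - F 0 = L * l'" by auto
    then have "l' = F1 z" using DERIV_unique[OF DF[of z]] by auto
    then have "0 < sF * (L * F1 z)" using sF(2)[of L] z L by simp
    then have "0 < L * (sF * F1 z)" by (simp add: mult_ac)
    then have "0 < sF * F1 z" using L by (simp add: zero_less_mult_iff)
    moreover have "0 < s1 * F1 z" using s1(2)[of z] z by auto
    ultimately have "s1 = sF" using s1(1) sF(1) by auto
    then show ?thesis using s1(2)[OF t] by (simp add: g1_def)
  qed
  have cphi1: "continuous_on UNIV \<phi>1" "continuous_on UNIV \<zeta>1"
    using phi(2) zeta(2) by (meson DERIV_continuous_on has_field_derivative_at_within)+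
  obtain \<tau> :: real where tau: "\<tau> = 1 \<or> \<tau> = -1" "\<And>t. 0 < \<tau> * \<phi>1 t"
    by (rule const_sign[OF is_interval_univ cphi1(1) phi(4)]) (use that in auto)
  obtain \<rho> :: real where rho: "\<rho> = 1 \<or> \<rho> = -1" "\<And>t. 0 < \<rho> * \<zeta>1 t"
    by (rule const_sign[OF is_interval_univ cphi1(2) zeta(4)]) (use that in auto)
  define u where "u t = \<tau> * \<phi> t" for t
  define u1 where "u1 t = \<tau> * \<phi>1 t" for t
  have U: "(u has_real_derivative u1 t) (at t)" "(u1 has_real_derivative \<tau> * \<phi>2 t) (at t)" "u 0 = 0" "0 < u1 t" for t
    unfolding u_def u1_def using phi tau(2) by (auto intro!: derivative_eq_intros)
  have upos: "0 < u t" if t: "0 < t" for t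
  proof -
    obtain z where "u t - u 0 = (t - 0) * u1 z" using MVT2[OF t, of u u1] U(1) by blast
    then show ?thesis using U(3) U(4)[of z] t by simp
  qed
  have absphi: "\<bar>\<phi> t\<bar> = u t" if "0 < t" for t using upos[OF that] tau(1) by (auto simp: u_def)
  have psine: "\<psi> (F t) \<noteq> 0" if t: "t \<in> {0<..<e'}" for t
  proof -
    have "\<bar>\<psi> (F t)\<bar> = u t powr l" using nf(2)[of t] absphi[of t] t e' by auto
    then show ?thesis using upos[of t] t by auto
  qed
  have cpF: "continuous_on {0<..<e'} (\<lambda>t. \<psi> (F t))"
    by (rule continuous_on_compose2[OF psi(2) continuous_on_subset[OF contF]]) (use e' in auto)
  obtain \<sigma> :: real where sg: "\<sigma> = 1 \<or> \<sigma> = -1" "\<And>t. t \<in> {0<..<e'} \<Longrightarrow> 0 < \<sigma> * \<psi> (F t)"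
    by (rule const_sign[OF _ cpF psine]) (auto simp: is_interval_oo)
  have Fz: "F t = \<zeta> (\<sigma> * u t powr l)" if t: "t \<in> {0<..<e'}" for t
  proof -
    have "\<bar>\<psi> (F t)\<bar> = u t powr l" using nf(2)[of t] absphi[of t] t e' by auto
    then have "\<psi> (F t) = \<sigma> * u t powr l" using sg(1) sg(2)[OF t] by auto
    then show ?thesis using psi(1)[of "F t"] by simp
  qed
  define \<theta> where "\<theta> x = \<rho> * \<sigma> * (\<zeta> (\<sigma> * x) - \<zeta> 0)" for x
  define \<theta>1 where "\<theta>1 x = \<rho> * \<zeta>1 (\<sigma> * x)" for x
  have sg2: "\<sigma> * \<sigma> = 1" using sg(1) by auto
  have Dz: "((\<lambda>x. \<zeta> (\<sigma> * x)) has_real_derivative \<zeta>1 (\<sigma> * x) * \<sigma>) (at x)"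
    "((\<lambda>x. \<zeta>1 (\<sigma> * x)) has_real_derivative \<zeta>2 (\<sigma> * x) * \<sigma>) (at x)" for x
    by (rule DERIV_chain2[OF zeta(1)] DERIV_chain2[OF zeta(2)], auto intro!: derivative_eq_intros)+
  have T: "(\<theta> has_real_derivative \<theta>1 x) (at x)" "(\<theta>1 has_real_derivative \<rho> * (\<zeta>2 (\<sigma> * x) * \<sigma>)) (at x)"
      "\<theta> 0 = 0" "0 < \<theta>1 x" for x
  proof -
    have "(\<theta> has_real_derivative \<rho> * \<sigma> * (\<zeta>1 (\<sigma> * x) * \<sigma> - 0)) (at x)"
      unfolding \<theta>_def by (intro DERIV_cmult DERIV_diff Dz DERIV_const)
    moreover have "\<rho> * \<sigma> * (\<zeta>1 (\<sigma> * x) * \<sigma> - 0) = \<theta>1 x" unfolding \<theta>1_def using sg(1) by auto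
    ultimately show "(\<theta> has_real_derivative \<theta>1 x) (at x)" by simp
    show "(\<theta>1 has_real_derivative \<rho> * (\<zeta>2 (\<sigma> * x) * \<sigma>)) (at x)" unfolding \<theta>1_def by (intro DERIV_cmult Dz)
    show "\<theta> 0 = 0" "0 < \<theta>1 x" using rho(2) by (auto simp: \<theta>_def \<theta>1_def)
  qed
  have thpos: "0 < \<theta> x" if x: "0 < x" for x
  proof -
    obtain z where "\<theta> x - \<theta> 0 = (x - 0) * \<theta>1 z" using MVT2[OF x, of \<theta> \<theta>1] T(1) by blast
    then show ?thesis using T(3) T(4)[of z] x by simp
  qed
  have Gth: "G t = \<theta> (u t powr l)" if t: "t \<in> {0<..<e'}" for t
  proof -
    have "0 < u t powr l" using upos[of t] t by simp
    then have "0 < \<theta> (u t powr l)" by (rule thpos)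
    moreover have "\<bar>F t - F 0\<bar> = \<bar>\<theta> (u t powr l)\<bar>"
      using Fz[OF t] z0 rho(1) sg(1) by (auto simp: \<theta>_def abs_mult)
    ultimately show ?thesis using G(2)[of t] t e' by auto
  qed
  have g1th: "g1 t = \<theta>1 (u t powr l) * (l * u t powr (l - 1) * u1 t)" if t: "t \<in> {0<..<e'}" for t
  proof -
    have "((\<lambda>t. u t powr l) has_real_derivative l * u t powr (l - 1) * u1 t) (at t)"
      using U(1)[of t] upos[of t] t by (auto intro!: derivative_eq_intros)
    then have "((\<lambda>t. \<theta> (u t powr l)) has_real_derivative \<theta>1 (u t powr l) * (l * u t powr (l - 1) * u1 t)) (at t)"
      by (rule DERIV_chain2[OF T(1)])
    then have "(G has_real_derivative \<theta>1 (u t powr l) * (l * u t powr (l - 1) * u1 t)) (at t)"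
      by (rule has_field_derivative_transform_within_open[of _ _ _ "{0<..<e'}"]) (use t Gth in auto)
    then show ?thesis using DERIV_unique[OF DG[of t]] t e' by auto
  qed
  define w where "w t = (\<theta> (u t powr l) / (u t powr l)) powr (1 / l - 1) * \<theta>1 (u t powr l) * u1 t" for t
  define e1 where "e1 = e' / 2"
  have e1: "0 < e1" "e1 < e'" "e1 < L" using e' by (auto simp: e1_def)
  have chw: "ch1 t = w t" if t: "t \<in> {0<..e1}" for t
  proof -
    have t': "t \<in> {0<..<e'}" using t e1 by auto
    have up: "0 < u t" using upos t by auto
    have "\<theta> (u t powr l) powr (1 / l - 1) = (\<theta> (u t powr l) / (u t powr l) * (u t powr l)) powr (1 / l - 1)"
      using up by simp
    also have "\<dots> = (\<theta> (u t powr l) / (u t powr l)) powr (1 / l - 1) * (u t powr l) powr (1 / l - 1)" by (rule powr_mult)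
    also have "(u t powr l) powr (1 / l - 1) = u t powr (1 - l)" using l by (simp add: powr_powr algebra_simps)
    finally have a: "\<theta> (u t powr l) powr (1 / l - 1) = (\<theta> (u t powr l) / (u t powr l)) powr (1 / l - 1) * u t powr (1 - l)" .
    have b: "u t powr (1 - l) * u t powr (l - 1) = 1" using up by (simp add: powr_add[symmetric])
    have "ch1 t = 1 / l * ((\<theta> (u t powr l) / (u t powr l)) powr (1 / l - 1) * u t powr (1 - l)) * (\<theta>1 (u t powr l) * (l * u t powr (l - 1) * u1 t))"
      unfolding ch1_def Gth[OF t'] g1th[OF t'] a ..
    also have "\<dots> = (1 / l * l) * (u t powr (1 - l) * u t powr (l - 1)) * w t" unfolding w_def by (simp only: mult_ac)
    finally show ?thesis unfolding b using l by simp
  qed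
  have near: "BL w {0<..e1}" "\<exists>m>0. \<forall>t\<in>{0<..e1}. m \<le> w t"
    unfolding w_def[abs_def]
    by (rule near_part[OF l e1(1) U(1,2) _ U(3,4) T(1,2) _ T(3,4)];
        auto intro!: continuous_intros phi(3) continuous_on_compose2[OF zeta(3)])+
  have BL1: "BL ch1 {0<..e1}" by (rule BL_cong[OF chw near(1)])
  obtain m1 where m1: "0 < m1" "\<And>t. t \<in> {0<..e1} \<Longrightarrow> m1 \<le> ch1 t" using near(2) chw by auto
  have sub: "{e1..L} \<subseteq> {0<..L}" "{e1..<L} \<subseteq> {0<..<L}" using e1 by auto
  obtain mG where mG: "0 < mG" "\<And>t. t \<in> {e1..L} \<Longrightarrow> mG \<le> G t"
    by (rule compact_pos[of e1 L G]) (use G(1) sub in \<open>auto simp: G_def[abs_def] intro!: continuous_intros continuous_on_subset[OF cF1'(1)]\<close>)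
  obtain MG where MG: "\<And>t. t \<in> {e1..L} \<Longrightarrow> \<bar>G t\<bar> \<le> MG"
    by (rule compact_bound[of e1 L G]) (use sub in \<open>auto simp: G_def[abs_def] intro!: continuous_intros continuous_on_subset[OF cF1'(1)]\<close>)
  obtain mg where mg: "0 < mg" "\<And>t. t \<in> {e1..L} \<Longrightarrow> mg \<le> g1 t"
    by (rule compact_pos[of e1 L g1]) (use g1pos sub in \<open>auto simp: g1_def[abs_def] intro!: continuous_intros continuous_on_subset[OF cF1'(2)]\<close>)
  obtain Mg where Mg: "\<And>t. t \<in> {e1..L} \<Longrightarrow> \<bar>g1 t\<bar> \<le> Mg"
    by (rule compact_bound[of e1 L g1]) (use sub in \<open>auto simp: g1_def[abs_def] intro!: continuous_intros continuous_on_subset[OF cF1'(2)]\<close>)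
  obtain M2 where M2: "\<And>t. t \<in> {e1..L} \<Longrightarrow> \<bar>sF * F2 t\<bar> \<le> M2"
    by (rule compact_bound[of e1 L "\<lambda>t. sF * F2 t"]) (use sub in \<open>auto intro!: continuous_intros continuous_on_subset[OF cF2]\<close>)
  have BLG: "BL G {e1..<L}"
    by (rule BL_deriv[where ?g1.0 = g1 and C = Mg and M = MG]) (use DG Mg MG sub in \<open>auto simp: is_interval_co\<close>)
  have BLg: "BL g1 {e1..<L}"
  proof (rule BL_deriv[where ?g1.0 = "\<lambda>t. sF * F2 t" and C = M2 and M = Mg])
    fix t assume "t \<in> {e1..<L}"
    then show "(g1 has_real_derivative sF * F2 t) (at t)" unfolding g1_def using DF1[of t] sub(2) by (intro DERIV_cmult) auto
  qed (use M2 Mg in \<open>auto simp: is_interval_co\<close>)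
  have BL2: "BL ch1 {e1..<L}"
    unfolding ch1_def[abs_def] by (intro BL_mult BL_const BLg BL_powr[OF BLG mG(1)]) (use mG in auto)
  obtain C1 where C1: "0 \<le> C1" "\<And>x y. x \<in> {0<..e1} \<Longrightarrow> y \<in> {0<..e1} \<Longrightarrow> \<bar>ch1 x - ch1 y\<bar> \<le> C1 * \<bar>x - y\<bar>"
    using BL1 unfolding BL_def by blast
  obtain C2 where C2: "0 \<le> C2" "\<And>x y. x \<in> {e1..<L} \<Longrightarrow> y \<in> {e1..<L} \<Longrightarrow> \<bar>ch1 x - ch1 y\<bar> \<le> C2 * \<bar>x - y\<bar>"
    using BL2 unfolding BL_def by blast
  define m2 where "m2 = 1 / l * MG powr (1 / l - 1) * mg"
  have m2: "0 < m2" "\<And>t. t \<in> {e1..<L} \<Longrightarrow> m2 \<le> ch1 t"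
  proof -
    have MGp: "0 < MG" using mG(2)[of L] MG[of L] mG(1) e1 by auto
    then show "0 < m2" using l mg by (simp add: m2_def)
    fix t assume t: "t \<in> {e1..<L}"
    have "1 / l \<le> 1" using l by simp
    then have "MG powr (1 / l - 1) \<le> G t powr (1 / l - 1)"
      using mG(1) mG(2)[of t] MG[of t] t by (intro powr_mono2') auto
    then show "m2 \<le> ch1 t" unfolding m2_def ch1_def using mg(1) mg(2)[of t] t l by (intro mult_mono) auto
  qed
  have lipord: "\<bar>ch1 x - ch1 y\<bar> \<le> (C1 + C2) * \<bar>x - y\<bar>" if xy: "x \<in> {0<..<L}" "y \<in> {0<..<L}" "x \<le> y" for x y
  proof -
    consider "y \<le> e1" | "e1 \<le> x" | "x \<le> e1" "e1 \<le> y" by linarith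
    then show ?thesis
    proof cases
      case 1
      then have "\<bar>ch1 x - ch1 y\<bar> \<le> C1 * \<bar>x - y\<bar>" using C1(2)[of x y] xy by auto
      also have "\<dots> \<le> (C1 + C2) * \<bar>x - y\<bar>" using C2(1) by (intro mult_right_mono) auto
      finally show ?thesis .
    next
      case 2
      then have "\<bar>ch1 x - ch1 y\<bar> \<le> C2 * \<bar>x - y\<bar>" using C2(2)[of x y] xy by auto
      also have "\<dots> \<le> (C1 + C2) * \<bar>x - y\<bar>" using C1(1) by (intro mult_right_mono) auto
      finally show ?thesis .
    next
      case 3
      then have "\<bar>ch1 x - ch1 e1\<bar> \<le> C1 * \<bar>x - e1\<bar>" "\<bar>ch1 e1 - ch1 y\<bar> \<le> C2 * \<bar>e1 - y\<bar>"
        using C1(2)[of x e1] C2(2)[of e1 y] xy e1 by auto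
      moreover have "C1 * \<bar>x - e1\<bar> \<le> C1 * \<bar>x - y\<bar>" "C2 * \<bar>e1 - y\<bar> \<le> C2 * \<bar>x - y\<bar>"
        using C1(1) C2(1) 3 by (auto intro!: mult_left_mono)
      moreover have "\<bar>ch1 x - ch1 y\<bar> \<le> \<bar>ch1 x - ch1 e1\<bar> + \<bar>ch1 e1 - ch1 y\<bar>"
        using abs_triangle_ineq[of "ch1 x - ch1 e1" "ch1 e1 - ch1 y"] by simp
      ultimately show ?thesis unfolding distrib_right by linarith
    qed
  qed
  have lip: "\<bar>ch1 x - ch1 y\<bar> \<le> (C1 + C2) * \<bar>x - y\<bar>" if xy: "x \<in> {0<..<L}" "y \<in> {0<..<L}" for x y
    using lipord[of x y] lipord[of y x] xy by (cases "x \<le> y") (simp_all add: abs_minus_commute)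
  have low: "min m1 m2 \<le> ch1 t" if "t \<in> {0<..<L}" for t
    using m1(2)[of t] m2(2)[of t] that by (cases "t \<le> e1") auto
  have "\<exists>ch ch1 m Lc. 0 < m \<and> 0 \<le> Lc \<and> continuous_on {0..L} ch \<and> ch 0 = 0 \<and>
     (\<forall>t\<in>{0<..<L}. (ch has_real_derivative ch1 t) (at t) \<and> m \<le> ch1 t) \<and>
     (\<forall>s\<in>{0<..<L}. \<forall>t\<in>{0<..<L}. \<bar>ch1 s - ch1 t\<bar> \<le> Lc * \<bar>s - t\<bar>) \<and>
     (\<forall>t\<in>{0..L}. \<bar>F t - F 0\<bar> = ch t powr l)"
    by (rule exI[of _ ch], rule exI[of _ ch1], rule exI[of _ "min m1 m2"], rule exI[of _ "C1 + C2"])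
      (use m1(1) m2(1) C1(1) C2(1) cch ch0 Dch low lip chl in auto)
  with contF show ?thesis unfolding side_ok_def by blast
qed

section \<open>A unimodal map has no gap of wild points\<close>

context wander_metric begin

text \<open>The gaps of the orbit satisfy the hypotheses of \<open>gap\<close>; images approach \<open>f c\<close> because the
orbit comes close to \<open>c\<close>.\<close>

lemma nothing_wanders: False
proof -
  obtain m0 where m0: "0 < A m0" "B m0 < 1" using pick[of 0] by blast
  note al = A_less[of m0]
  have between: "(f ^^ k) (y m0) < max ((f ^^ k) (A m0)) ((f ^^ k) (B m0))" for k
    using free_smono[OF freeAB[of k m0]] al unfolding smono_def
    by (metis less_imp_le less_max_iff_disj order_refl)
  have left: "\<exists>p n. 0 \<le> p \<and> e < p \<and> p \<le> A m0 \<and> (f ^^ n) p = c" if e: "e < A m0" for e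
  proof -
    obtain p where "p \<in> precrit" "e < p" "p \<le> A m0" using A_approx[OF e m0(1)] by blast
    then show ?thesis unfolding precrit_def by auto
  qed
  have right: "\<exists>p n. p \<le> 1 \<and> p < e \<and> B m0 \<le> p \<and> (f ^^ n) p = c" if e: "B m0 < e" for e
  proof -
    obtain p where "p \<in> precrit" "p < e" "B m0 \<le> p" using B_approx[OF e m0(2)] by blast
    then show ?thesis unfolding precrit_def by auto
  qed
  have inAB: "A (m0 + k) \<le> (f ^^ k) x \<and> (f ^^ k) x \<le> B (m0 + k)" if "x \<in> {A m0..B m0}" for x k
    using step[OF that, of k] by auto
  have dis: "max ((f ^^ m) (A m0)) ((f ^^ m) (B m0)) \<le> min ((f ^^ n) (A m0)) ((f ^^ n) (B m0)) \<or>
      max ((f ^^ n) (A m0)) ((f ^^ n) (B m0)) \<le> min ((f ^^ m) (A m0)) ((f ^^ m) (B m0))" if "m \<noteq> n" for m n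
  proof -
    have i: "A m0 \<in> {A m0..B m0}" "B m0 \<in> {A m0..B m0}" using al by auto
    note e = inAB[OF i(1), of m] inAB[OF i(1), of n] inAB[OF i(2), of m] inAB[OF i(2), of n]
    have "B (m0 + m) \<le> A (m0 + n) \<or> B (m0 + n) \<le> A (m0 + m)" using that by (intro disjAB) simp
    then show ?thesis
    proof
      assume "B (m0 + m) \<le> A (m0 + n)"
      with e have "max ((f ^^ m) (A m0)) ((f ^^ m) (B m0)) \<le> min ((f ^^ n) (A m0)) ((f ^^ n) (B m0))"
        by (intro max.boundedI min.boundedI) linarith+
      then show ?thesis ..
    next
      assume "B (m0 + n) \<le> A (m0 + m)"
      with e have "max ((f ^^ n) (A m0)) ((f ^^ n) (B m0)) \<le> min ((f ^^ m) (A m0)) ((f ^^ m) (B m0))"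
        by (intro max.boundedI min.boundedI) linarith+
      then show ?thesis ..
    qed
  qed
  have app: "\<exists>m\<ge>M. v < max ((f ^^ m) (A m0)) ((f ^^ m) (B m0))" if v: "v < f c" for v M
  proof -
    have "\<exists>\<delta>>0. \<forall>x\<in>{0..1}. dist x c < \<delta> \<longrightarrow> dist (f x) (f c) < f c - v"
      using cont v c0 c1 unfolding continuous_on_iff by auto
    then obtain \<delta> where d: "0 < \<delta>" "\<And>x. x \<in> {0..1} \<Longrightarrow> dist x c < \<delta> \<Longrightarrow> dist (f x) (f c) < f c - v" by blast
    obtain m where m: "m0 + M \<le> m" "\<bar>y m - c\<bar> < \<delta>" using accumulates_at_c[OF d(1)] by blast
    have "dist (f (y m)) (f c) < f c - v" using d(2)[OF y_in] m(2) by (simp add: dist_real_def)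
    then have "v < f (y m)" by (simp add: dist_real_def abs_less_iff)
    moreover have "f (y m) = (f ^^ (Suc m - m0)) (y m0)"
      using y_add[of m0 "Suc m - m0"] y_add[of m 1] m(1) by simp
    ultimately have "v < max ((f ^^ (Suc m - m0)) (A m0)) ((f ^^ (Suc m - m0)) (B m0))"
      using between[of "Suc m - m0"] by linarith
    moreover have "M \<le> Suc m - m0" using m(1) by simp
    ultimately show ?thesis by blast
  qed
  interpret g: gap f c "A m0" "B m0"
  proof (unfold_locales, goal_cases)
    case 2 show ?case using al by linarith
  next case 5 show ?case using al y_wild[of m0] by blast
  qed (fact m0 freeAB left right dis app)+
  interpret gap_metric f c "A m0" "B m0" K lm lp mm MM ..
  show False by (rule contradiction)
qed

end

text \<open>Both sides are measured from \<open>c\<close> outwards and from \<open>f c\<close> downwards; cross ratios are invariant under these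
affine changes, also when they reverse orientation.\<close>

lemma (in fold) metric_of_sides:
  assumes sp: "side_ok (\<lambda>t. f (c + t)) (1 - c) lp" and sm: "side_ok (\<lambda>t. f (c - t)) c lm"
    and l: "1 \<le> lm" "1 \<le> lp"
  shows "\<exists>K mm MM. metric f c K lm lp mm MM"
proof -
  have L: "0 < 1 - c" "0 < c" using c0 c1 by auto
  have absp: "\<bar>f (c + t) - f (c + 0)\<bar> = f c - f (c + t)" if "t \<in> {0..1 - c}" for t
    using top_le[of "c + t"] that c0 by simp
  have absm: "\<bar>f (c - t) - f (c - 0)\<bar> = f c - f (c - t)" if "t \<in> {0..c}" for t
    using top_le[of "c - t"] that c1 by simp
  obtain Kp where Kp: "0 \<le> Kp" "\<And>a b x d. 0 \<le> a \<Longrightarrow> a < b \<Longrightarrow> b < x \<Longrightarrow> x < d \<Longrightarrow> d \<le> 1 - c \<Longrightarrow>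
      exp (- Kp * (d - a)) * cross a b x d \<le> cross \<bar>f (c + a) - f (c + 0)\<bar> \<bar>f (c + b) - f (c + 0)\<bar> \<bar>f (c + x) - f (c + 0)\<bar> \<bar>f (c + d) - f (c + 0)\<bar>"
    using side_consequences(1)[OF sp L(1) l(2)] by blast
  obtain Km where Km: "0 \<le> Km" "\<And>a b x d. 0 \<le> a \<Longrightarrow> a < b \<Longrightarrow> b < x \<Longrightarrow> x < d \<Longrightarrow> d \<le> c \<Longrightarrow>
      exp (- Km * (d - a)) * cross a b x d \<le> cross \<bar>f (c - a) - f (c - 0)\<bar> \<bar>f (c - b) - f (c - 0)\<bar> \<bar>f (c - x) - f (c - 0)\<bar> \<bar>f (c - d) - f (c - 0)\<bar>"
    using side_consequences(1)[OF sm L(2) l(1)] by blast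
  obtain mp Mp where mp: "0 < mp" "\<And>t. t \<in> {0..1 - c} \<Longrightarrow> mp * t powr lp \<le> \<bar>f (c + t) - f (c + 0)\<bar> \<and> \<bar>f (c + t) - f (c + 0)\<bar> \<le> Mp * t powr lp"
    using side_consequences(2)[OF sp L(1) l(2)] by blast
  obtain mq Mq where mq: "0 < mq" "\<And>t. t \<in> {0..c} \<Longrightarrow> mq * t powr lm \<le> \<bar>f (c - t) - f (c - 0)\<bar> \<and> \<bar>f (c - t) - f (c - 0)\<bar> \<le> Mq * t powr lm"
    using side_consequences(2)[OF sm L(2) l(1)] by blast
  define K where "K = max Kp Km"
  define mm where "mm = min mp mq"
  define MM where "MM = max Mp Mq"
  have flip: "cross (y - p) (y - q) (y - r) (y - t) = cross p q r t" for y p q r t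
    using cross_scale[of "-1" p y q r t] by simp
  have shift: "cross (p - y) (q - y) (r - y) (t - y) = cross p q r t" for y p q r t
    using cross_scale[of 1 p y q r t] by simp
  have "metric f c K lm lp mm MM"
  proof (unfold_locales, goal_cases)
    case 1 show ?case using Kp by (simp add: K_def)
  next case 2 show ?case by (rule l(1))
  next case 3 show ?case by (rule l(2))
  next case 4 show ?case using mp mq by (simp add: mm_def)
  next
    case (5 a b x d)
    have n: "0 \<le> cross a b x d" using 5 unfolding cross_def by (intro divide_nonneg_nonneg mult_nonneg_nonneg) auto
    from 5(6) show ?case
    proof
      assume dc: "d \<le> c"
      have "exp (- K * (d - a)) * cross a b x d \<le> exp (- Km * (d - a)) * cross a b x d"
        using 5 n by (intro mult_right_mono) (auto simp: K_def intro!: mult_right_mono)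
      also have "\<dots> = exp (- Km * ((c - a) - (c - d))) * cross (c - d) (c - x) (c - b) (c - a)"
        unfolding flip by (simp add: cross_rev)
      also have "\<dots> \<le> cross \<bar>f (c - (c - d)) - f (c - 0)\<bar> \<bar>f (c - (c - x)) - f (c - 0)\<bar> \<bar>f (c - (c - b)) - f (c - 0)\<bar> \<bar>f (c - (c - a)) - f (c - 0)\<bar>"
        using 5 dc by (intro Km(2)) auto
      also have "\<dots> = cross (f c - f d) (f c - f x) (f c - f b) (f c - f a)"
        using absm[of "c - d"] absm[of "c - x"] absm[of "c - b"] absm[of "c - a"] 5 dc by simp
      also have "\<dots> = cross (f a) (f b) (f x) (f d)" unfolding flip by (simp add: cross_rev)
      finally show ?thesis .
    next
      assume ca: "c \<le> a"
      have "exp (- K * (d - a)) * cross a b x d \<le> exp (- Kp * (d - a)) * cross a b x d"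
        using 5 n by (intro mult_right_mono) (auto simp: K_def intro!: mult_right_mono)
      also have "\<dots> = exp (- Kp * ((d - c) - (a - c))) * cross (a - c) (b - c) (x - c) (d - c)"
        unfolding shift by simp
      also have "\<dots> \<le> cross \<bar>f (c + (a - c)) - f (c + 0)\<bar> \<bar>f (c + (b - c)) - f (c + 0)\<bar> \<bar>f (c + (x - c)) - f (c + 0)\<bar> \<bar>f (c + (d - c)) - f (c + 0)\<bar>"
        using 5 ca by (intro Kp(2)) auto
      also have "\<dots> = cross (f c - f a) (f c - f b) (f c - f x) (f c - f d)"
        using absp[of "d - c"] absp[of "x - c"] absp[of "b - c"] absp[of "a - c"] 5 ca by simp
      also have "\<dots> = cross (f a) (f b) (f x) (f d)" unfolding flip ..
      finally show ?thesis .
    qed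
  next
    case (6 x)
    have "mq * (c - x) powr lm \<le> f c - f x \<and> f c - f x \<le> Mq * (c - x) powr lm"
      using mq(2)[of "c - x"] absm[of "c - x"] 6 by simp
    moreover have "mm * (c - x) powr lm \<le> mq * (c - x) powr lm" "Mq * (c - x) powr lm \<le> MM * (c - x) powr lm"
      by (auto simp: mm_def MM_def intro!: mult_right_mono)
    ultimately show ?case by linarith
  next
    case (7 x)
    have "mp * (x - c) powr lp \<le> f c - f x \<and> f c - f x \<le> Mp * (x - c) powr lp"
      using mp(2)[of "x - c"] absp[of "x - c"] 7 by simp
    moreover have "mm * (x - c) powr lp \<le> mp * (x - c) powr lp" "Mp * (x - c) powr lp \<le> MM * (x - c) powr lp"
      by (auto simp: mm_def MM_def intro!: mult_right_mono)
    ultimately show ?case by linarith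
  next
    case (8 \<delta>)
    obtain Lp where Lp: "0 \<le> Lp" "\<forall>p q r. (p < q \<and> q < r \<or> r < q \<and> q < p) \<and> p \<in> {\<delta>..1 - c} \<and> r \<in> {\<delta>..1 - c} \<longrightarrow>
      \<bar>\<bar>f (c + q) - f (c + 0)\<bar> - \<bar>f (c + p) - f (c + 0)\<bar>\<bar> * \<bar>r - q\<bar> \<le> exp (Lp * \<bar>r - p\<bar>) * \<bar>\<bar>f (c + r) - f (c + 0)\<bar> - \<bar>f (c + q) - f (c + 0)\<bar>\<bar> * \<bar>q - p\<bar>"
      using side_consequences(3)[OF sp L(1) l(2), rule_format, OF 8] by (elim exE conjE) (rule that)
    obtain Lm where Lm: "0 \<le> Lm" "\<forall>p q r. (p < q \<and> q < r \<or> r < q \<and> q < p) \<and> p \<in> {\<delta>..c} \<and> r \<in> {\<delta>..c} \<longrightarrow>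
      \<bar>\<bar>f (c - q) - f (c - 0)\<bar> - \<bar>f (c - p) - f (c - 0)\<bar>\<bar> * \<bar>r - q\<bar> \<le> exp (Lm * \<bar>r - p\<bar>) * \<bar>\<bar>f (c - r) - f (c - 0)\<bar> - \<bar>f (c - q) - f (c - 0)\<bar>\<bar> * \<bar>q - p\<bar>"
      using side_consequences(3)[OF sm L(2) l(1), rule_format, OF 8] by (elim exE conjE) (rule that)
    define Lx where "Lx = max Lp Lm"
    show ?case
    proof (intro exI[of _ Lx] conjI allI impI)
      show "0 \<le> Lx" using Lp(1) by (simp add: Lx_def)
      fix p q r
      assume h: "(p < q \<and> q < r \<or> r < q \<and> q < p) \<and> p \<in> {0..1} \<and> r \<in> {0..1} \<and>
        (p \<le> c - \<delta> \<and> r \<le> c - \<delta> \<or> c + \<delta> \<le> p \<and> c + \<delta> \<le> r)"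
      have ex: "exp (Lp * \<bar>r - p\<bar>) \<le> exp (Lx * \<bar>r - p\<bar>)" "exp (Lm * \<bar>r - p\<bar>) \<le> exp (Lx * \<bar>r - p\<bar>)"
        by (auto simp: Lx_def intro!: mult_right_mono)
      have up: "E * \<bar>f r - f q\<bar> * \<bar>q - p\<bar> \<le> exp (Lx * \<bar>r - p\<bar>) * \<bar>f r - f q\<bar> * \<bar>q - p\<bar>" if "E \<le> exp (Lx * \<bar>r - p\<bar>)" for E
        using that by (intro mult_right_mono) auto
      from h have "p \<le> c - \<delta> \<and> r \<le> c - \<delta> \<or> c + \<delta> \<le> p \<and> c + \<delta> \<le> r" by blast
      then show "\<bar>f q - f p\<bar> * \<bar>r - q\<bar> \<le> exp (Lx * \<bar>r - p\<bar>) * \<bar>f r - f q\<bar> * \<bar>q - p\<bar>"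
      proof
        assume s: "p \<le> c - \<delta> \<and> r \<le> c - \<delta>"
        have in_: "c - p \<in> {0..c}" "c - q \<in> {0..c}" "c - r \<in> {0..c}" using h s 8 by auto
        have e: "\<bar>f p - f c\<bar> = f c - f p" "\<bar>f q - f c\<bar> = f c - f q" "\<bar>f r - f c\<bar> = f c - f r"
          using absm[OF in_(1)] absm[OF in_(2)] absm[OF in_(3)] by auto
        have "\<bar>f q - f p\<bar> * \<bar>r - q\<bar> \<le> exp (Lm * \<bar>r - p\<bar>) * \<bar>f r - f q\<bar> * \<bar>q - p\<bar>"
          using Lm(2)[rule_format, of "c - p" "c - q" "c - r"] h s e by (auto simp: abs_minus_commute)
        then show ?thesis using up[OF ex(2)] by linarith
      next
        assume s: "c + \<delta> \<le> p \<and> c + \<delta> \<le> r"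
        have in_: "p - c \<in> {0..1-c}" "q - c \<in> {0..1-c}" "r - c \<in> {0..1-c}" using h s 8 by auto
        have e: "\<bar>f p - f c\<bar> = f c - f p" "\<bar>f q - f c\<bar> = f c - f q" "\<bar>f r - f c\<bar> = f c - f r"
          using absp[OF in_(1)] absp[OF in_(2)] absp[OF in_(3)] by auto
        have "\<bar>f q - f p\<bar> * \<bar>r - q\<bar> \<le> exp (Lp * \<bar>r - p\<bar>) * \<bar>f r - f q\<bar> * \<bar>q - p\<bar>"
          using Lp(2)[rule_format, of "p - c" "q - c" "r - c"] h s e by (auto simp: abs_minus_commute)
        then show ?thesis using up[OF ex(1)] by linarith
      qed
    qed
  qed
  then show ?thesis by blast
qed

section \<open>From wandering intervals to wild points\<close>

text \<open>If \<open>f ^^ (r * k)\<close> converges to a point \<open>p\<close> of period \<open>r\<close>, the orbit of \<open>x\<close> is asymptotic to that of \<open>p\<close>, and its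
limit set is the finite orbit of \<open>p\<close>.\<close>

lemma (in selfmap) wild_if_no_periodic_limit:
  assumes x: "x \<in> {0..1}" and np: "\<not> periodic_orbit f (omega_limit f x)"
  shows "wild x"
proof -
  have False if r: "1 \<le> r" and p: "p \<in> {0..1}" "(f ^^ r) p = p" and lim: "(\<lambda>k. (f ^^ (r * k)) x) \<longlonglongrightarrow> p" for r p
  proof -
    have pmod: "(f ^^ (n mod r)) p = (f ^^ n) p" for n
      using funpow_mod_eq[OF p(2)] by simp
    have sub: "(\<lambda>k. (f ^^ (r * k + j)) x) \<longlonglongrightarrow> (f ^^ j) p" for j
      using it_tendsto[OF lim, of j] it_in[OF x] p(1) by (simp add: it_add[symmetric] add.commute)
    have close: "(\<lambda>n. (f ^^ n) x - (f ^^ n) p) \<longlonglongrightarrow> 0"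
    proof (rule LIMSEQ_I)
      fix e :: real assume e: "0 < e"
      have "\<forall>\<^sub>F k in sequentially. \<forall>j\<in>{..<r}. dist ((f ^^ (r * k + j)) x) ((f ^^ j) p) < e"
        using sub e by (intro eventually_ball_finite) (auto dest: tendstoD)
      then obtain K where K: "\<And>k j. K \<le> k \<Longrightarrow> j < r \<Longrightarrow> dist ((f ^^ (r * k + j)) x) ((f ^^ j) p) < e"
        unfolding eventually_sequentially by (metis lessThan_iff)
      have "norm ((f ^^ n) x - (f ^^ n) p - 0) < e" if n: "r * K \<le> n" for n
      proof -
        have "K \<le> n div r" using n r by (simp add: less_eq_div_iff_mult_less_eq mult.commute)
        from K[OF this, of "n mod r"] r pmod[of n] show ?thesis by (simp add: dist_real_def)
      qed
      then show "\<exists>no. \<forall>n\<ge>no. norm ((f ^^ n) x - (f ^^ n) p - 0) < e" by blast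
    qed
    have "omega_limit f x = range (\<lambda>k. (f ^^ k) p)"
    proof
      show "range (\<lambda>k. (f ^^ k) p) \<subseteq> omega_limit f x"
      proof
        fix y assume "y \<in> range (\<lambda>k. (f ^^ k) p)"
        then obtain j where "y = (f ^^ j) p" by blast
        moreover have "strict_mono (\<lambda>k. r * k + j)" using r by (simp add: strict_mono_def)
        ultimately show "y \<in> omega_limit f x" unfolding omega_limit_def using sub[of j] by blast
      qed
      show "omega_limit f x \<subseteq> range (\<lambda>k. (f ^^ k) p)"
      proof
        fix y assume "y \<in> omega_limit f x"
        then obtain s where s: "strict_mono s" "(\<lambda>k. (f ^^ s k) x) \<longlonglongrightarrow> y" unfolding omega_limit_def by blast
        define P where "P = (\<lambda>j. (f ^^ j) p) ` {..<r}"
        have "(\<lambda>k. (f ^^ s k) x - (f ^^ s k) p) \<longlonglongrightarrow> 0"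
          using LIMSEQ_subseq_LIMSEQ[OF close s(1)] by (simp add: o_def)
        from tendsto_diff[OF s(2) this] have l: "(\<lambda>k. (f ^^ s k) p) \<longlonglongrightarrow> y" by simp
        have "(f ^^ n) p \<in> P" for n
          unfolding P_def using pmod[of n, symmetric] r by (intro image_eqI[of _ _ "n mod r"]) auto
        then have "y \<in> P"
          using closed_sequentially[of P "\<lambda>k. (f ^^ s k) p" y] l by (simp add: P_def finite_imp_closed)
        then show "y \<in> range (\<lambda>k. (f ^^ k) p)" by (auto simp: P_def)
      qed
    qed
    then show False using np r p unfolding periodic_orbit_def by blast
  qed
  then show ?thesis unfolding wild_def using x by blast
qed

lemma (in selfmap) monotone_not_wild:
  assumes m: "(\<forall>x y. 0 \<le> x \<longrightarrow> x \<le> y \<longrightarrow> y \<le> 1 \<longrightarrow> f x \<le> f y) \<or> (\<forall>x y. 0 \<le> x \<longrightarrow> x \<le> y \<longrightarrow> y \<le> 1 \<longrightarrow> f y \<le> f x)"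
  shows "\<not> wild x"
proof
  assume w: "wild x"
  then have x: "x \<in> {0..1}" by (simp add: wild_def)
  have 2: "(f ^^ (1 + 1)) u \<le> (f ^^ (1 + 1)) v" if "0 \<le> u" "u \<le> v" "v \<le> 1" for u v
    using m self[of u] self[of v] that by (elim disjE) auto
  have st: "(f ^^ (1 + 1)) u \<in> {0..1}" if "u \<in> {0..1}" for u by (rule it_in[OF that])
  have "\<not> wild x" by (rule mono_trap[OF _ _ _ st 2 x]) simp_all
  then show False using w by blast
qed

context fold begin

text \<open>By disjointness at most one image of the interval contains \<open>c\<close>, and, the earlier iterates being monotone, it does so
at a single parameter \<open>z\<close>. Cutting there leaves an interval that never meets \<open>c\<close>.\<close>

lemma wander_ex:
  assumes ab: "0 \<le> a" "a < b" "b \<le> 1" and w: "\<And>x. x \<in> {a..b} \<Longrightarrow> wild x"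
    and dj: "\<And>m n. m \<noteq> n \<Longrightarrow> (f ^^ m) ` {a..b} \<inter> (f ^^ n) ` {a..b} = {}"
  shows "\<exists>x0. wander f c x0"
proof -
  have mk: "\<exists>x0. wander f c x0" if h: "a \<le> a'" "a' < b'" "b' \<le> b" "\<And>n. free n a' b'" for a' b'
  proof (intro exI)
    show "wander f c ((a' + b') / 2)"
    proof unfold_locales
      show "wild ((a' + b') / 2)" using h by (intro w) auto
      show "\<exists>a b. a < (a' + b') / 2 \<and> (a' + b') / 2 < b \<and> (\<forall>n. free n a b)"
        using h by (intro exI[of _ a'] exI[of _ b']) auto
    qed
  qed
  show ?thesis
  proof (cases "\<exists>k z. a < z \<and> z < b \<and> (f ^^ k) z = c")
    case False
    then have "free n a b" for n unfolding free_def using ab by auto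
    then show ?thesis using mk[of a b] ab by auto
  next
    case True
    then obtain k z where z: "a < z" "z < b" "(f ^^ k) z = c" by blast
    have other: "(f ^^ j) x \<noteq> c" if "j \<noteq> k" "x \<in> {a..b}" for j x
    proof
      assume "(f ^^ j) x = c"
      then have "c \<in> (f ^^ j) ` {a..b} \<inter> (f ^^ k) ` {a..b}"
        using that z by (intro IntI image_eqI[of _ _ x] image_eqI[of _ _ z]) auto
      then show False using dj[OF that(1)] by blast
    qed
    have "free k a b" unfolding free_def using ab other by auto
    from free_smono[OF this] have one: "(f ^^ k) x \<noteq> c" if "a < x" "x < z" for x
      using that z unfolding smono_def by (metis less_imp_le order_less_irrefl)
    have "(f ^^ j) x \<noteq> c" if "a < x" "x < z" for j x
      using other[of j x] one[of x] that z by (cases "j = k") auto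
    then have "free n a z" for n unfolding free_def using ab z by auto
    then show ?thesis using mk[of a z] z by auto
  qed
qed

lemma no_wild_interval:
  assumes "side_ok (\<lambda>t. f (c + t)) (1 - c) lp" "side_ok (\<lambda>t. f (c - t)) c lm" "1 \<le> lm" "1 \<le> lp"
    and "0 \<le> a" "a < b" "b \<le> 1" "\<And>x. x \<in> {a..b} \<Longrightarrow> wild x"
    and "\<And>m n. m \<noteq> n \<Longrightarrow> (f ^^ m) ` {a..b} \<inter> (f ^^ n) ` {a..b} = {}"
  shows False
proof -
  obtain K mm MM where "metric f c K lm lp mm MM" using metric_of_sides[OF assms(1-4)] by blast
  moreover obtain x0 where "wander f c x0" using wander_ex[OF assms(5-9)] by blast
  ultimately have "wander_metric f c x0 K lm lp mm MM" by (simp add: wander_metric_def)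
  then show False by (rule wander_metric.nothing_wanders)
qed

end

lemma side_ok_reflect: assumes "side_ok F L l" shows "side_ok (\<lambda>t. 1 - F t) L l"
proof -
  have "\<bar>1 - F t - (1 - F 0)\<bar> = \<bar>F t - F 0\<bar>" for t by (simp add: abs_minus_commute)
  then show ?thesis using assms unfolding side_ok_def by (auto intro!: continuous_intros)
qed

lemma side_monotone:
  assumes F: "side_ok F L l" and L: "0 < L" and l: "1 \<le> l"
  obtains s :: real where "s = 1 \<or> s = -1" "\<And>x y. 0 \<le> x \<Longrightarrow> x < y \<Longrightarrow> y \<le> L \<Longrightarrow> s * F x < s * F y"
proof -
  note big = side_consequences(4)[OF F L l]
  have "continuous_on {0..L} F" using F unfolding side_ok_def by blast
  then have c: "continuous_on {0<..L} (\<lambda>t. F t - F 0)" by (intro continuous_intros) (auto elim: continuous_on_subset)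
  have "F t - F 0 \<noteq> 0" if "t \<in> {0<..L}" for t using big[of 0 t] that by auto
  from const_sign[OF is_interval_oc c this] obtain s :: real
    where s: "s = 1 \<or> s = -1" "\<And>t. t \<in> {0<..L} \<Longrightarrow> 0 < s * (F t - F 0)" by blast
  have e: "\<bar>F t - F 0\<bar> = s * F t - s * F 0" if "0 \<le> t" "t \<le> L" for t
    using s(1) s(2)[of t] that by (cases "t = 0") auto
  show ?thesis
  proof (rule that[OF s(1)])
    fix x y assume "0 \<le> x" "x < y" "y \<le> L"
    then show "s * F x < s * F y" using big[of x y] e[of x] e[of y] by simp
  qed
qed

lemma Cr_diffeo2_derivs:
  assumes "Cr_diffeo 2 \<phi>"
  obtains \<phi>1 \<phi>2 where "\<And>t. (\<phi> has_real_derivative \<phi>1 t) (at t)" "\<And>t. (\<phi>1 has_real_derivative \<phi>2 t) (at t)"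
    "continuous_on UNIV \<phi>2" "\<And>t. \<phi>1 t \<noteq> 0"
proof -
  have b: "bij \<phi>" and "Cr_on (Suc (Suc 0)) \<phi> UNIV" "Cr_on (Suc (Suc 0)) (inv \<phi>) UNIV"
    using assms unfolding Cr_diffeo_def numeral_2_eq_2 by blast+
  then obtain \<phi>1 \<phi>2 \<theta> where d: "\<And>t. (\<phi> has_real_derivative \<phi>1 t) (at t)" "\<And>t. (\<phi>1 has_real_derivative \<phi>2 t) (at t)"
    "continuous_on UNIV \<phi>2" and i: "\<And>t. (inv \<phi> has_real_derivative \<theta> t) (at t)" by auto
  have "\<phi>1 t \<noteq> 0" for t
  proof
    assume z: "\<phi>1 t = 0"
    have "inv \<phi> (\<phi> t) = t" for t using b by (simp add: bij_is_inj)
    moreover have "((\<lambda>t. inv \<phi> (\<phi> t)) has_real_derivative \<theta> (\<phi> t) * \<phi>1 t) (at t)"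
      by (rule DERIV_chain2[OF i d(1)])
    ultimately have "((\<lambda>t. t) has_real_derivative 0) (at t)" using z by simp
    then show False using DERIV_unique[OF _ DERIV_ident] by fastforce
  qed
  with d show ?thesis by (rule that)
qed

text \<open>The factor \<open>\<sigma>\<close> selects the side. A derivative within \<open>S\<close> is turned into one in the parameter \<open>t\<close>, where it is
unique, so the nonvanishing derivative of the hypothesis is the one used for \<open>C\<^sup>2\<close>.\<close>

lemma side_ok_of_branch:
  fixes f :: "real \<Rightarrow> real"
  assumes \<sigma>: "\<sigma> = 1 \<or> \<sigma> = (-1::real)" and L: "0 < L" and l: "1 \<le> l"
    and S: "\<And>t. t \<in> {0<..L} \<Longrightarrow> c + \<sigma> * t \<in> S"
    and C2: "Cr_on 2 f S" and nz: "\<forall>x\<in>S. \<exists>D. (f has_real_derivative D) (at x within S) \<and> D \<noteq> 0"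
    and U: "open U" "c \<in> U" and df: "Cr_diffeo 2 \<phi>" "Cr_diffeo 2 \<psi>" and z: "\<phi> c = 0" "\<psi> (f c) = 0"
    and nf: "\<And>t. 0 \<le> t \<Longrightarrow> t \<le> L \<Longrightarrow> c + \<sigma> * t \<in> U \<Longrightarrow> \<bar>\<psi> (f (c + \<sigma> * t))\<bar> = \<bar>\<phi> (c + \<sigma> * t)\<bar> powr l"
  shows "side_ok (\<lambda>t. f (c + \<sigma> * t)) L l"
proof -
  let ?g = "\<lambda>t. c + \<sigma> * t"
  have g: "(?g has_real_derivative \<sigma>) (at t within T)" for t T
    by (auto intro!: derivative_eq_intros)
  obtain f1 f2 where f1: "\<And>x. x \<in> S \<Longrightarrow> (f has_real_derivative f1 x) (at x within S)"
    and f2: "\<And>x. x \<in> S \<Longrightarrow> (f1 has_real_derivative f2 x) (at x within S)" and cf2: "continuous_on S f2"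
    using C2 unfolding numeral_2_eq_2 by auto
  have im: "?g ` {0<..L} \<subseteq> S" using S by blast
  have ch: "((\<lambda>t. q (?g t)) has_real_derivative D * \<sigma>) (at t within {0<..L})"
    if "(q has_real_derivative D) (at (?g t) within S)" for q D t
    using DERIV_image_chain[OF DERIV_subset[OF that im] g] by (simp add: o_def)
  have nz1: "f1 (?g t) * \<sigma> \<noteq> 0" if t: "t \<in> {0<..L}" for t
  proof -
    obtain D where D: "(f has_real_derivative D) (at (?g t) within S)" "D \<noteq> 0" using nz S[OF t] by blast
    have "t islimpt {0<..<t}" using t by (intro islimpt_greaterThanLessThan2) simp
    then have "t islimpt {0<..L}" by (rule islimpt_subset) (use t in auto)
    then have "f1 (?g t) * \<sigma> = D * \<sigma>"
      using has_field_derivative_unique[OF ch[OF f1[OF S[OF t]]] ch[OF D(1)]] by (simp add: trivial_limit_within)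
    then show ?thesis using D(2) \<sigma> by auto
  qed
  obtain \<phi>1 \<phi>2 where p: "\<And>t. (\<phi> has_real_derivative \<phi>1 t) (at t)" "\<And>t. (\<phi>1 has_real_derivative \<phi>2 t) (at t)"
    "continuous_on UNIV \<phi>2" "\<And>t. \<phi>1 t \<noteq> 0" by (rule Cr_diffeo2_derivs[OF df(1)]) (rule that)
  have b: "bij \<psi>" and "Cr_on 2 (inv \<psi>) UNIV" using df(2) unfolding Cr_diffeo_def by blast+
  have "Cr_diffeo 2 (inv \<psi>)"
    using df(2) unfolding Cr_diffeo_def by (simp add: bij_imp_bij_inv inv_inv_eq)
  then obtain \<zeta>1 \<zeta>2 where q: "\<And>t. (inv \<psi> has_real_derivative \<zeta>1 t) (at t)" "\<And>t. (\<zeta>1 has_real_derivative \<zeta>2 t) (at t)"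
    "continuous_on UNIV \<zeta>2" "\<And>t. \<zeta>1 t \<noteq> 0" by (rule Cr_diffeo2_derivs) (rule that)
  obtain \<psi>1 where ps: "\<And>t. (\<psi> has_real_derivative \<psi>1 t) (at t)"
    by (rule Cr_diffeo2_derivs[OF df(2)]) (rule that)
  obtain \<epsilon> where e: "0 < \<epsilon>" "ball c \<epsilon> \<subseteq> U" using U open_contains_ball by blast
  have chp: "((\<lambda>t. q (?g t)) has_real_derivative D * \<sigma>) (at t)"
    if "(q has_real_derivative D) (at (?g t))" for q D t
    using DERIV_chain2[OF that g] .
  show ?thesis
  proof (rule side_ok_of_normal_form[where \<epsilon> = \<epsilon> and \<psi> = \<psi> and \<zeta> = "inv \<psi>" and ?\<zeta>1.0 = \<zeta>1 and ?\<zeta>2.0 = \<zeta>2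
        and \<phi> = "\<lambda>t. \<phi> (?g t)" and ?\<phi>1.0 = "\<lambda>t. \<phi>1 (?g t) * \<sigma>" and ?\<phi>2.0 = "\<lambda>t. \<phi>2 (?g t) * \<sigma> * \<sigma>"
        and ?F1.0 = "\<lambda>t. f1 (?g t) * \<sigma>" and ?F2.0 = "\<lambda>t. f2 (?g t) * \<sigma> * \<sigma>"])
    fix t assume t: "t \<in> {0<..L}"
    show "((\<lambda>t. f (?g t)) has_real_derivative f1 (?g t) * \<sigma>) (at t within {0<..L})" by (rule ch[OF f1[OF S[OF t]]])
    show "((\<lambda>t. f1 (?g t) * \<sigma>) has_real_derivative f2 (?g t) * \<sigma> * \<sigma>) (at t within {0<..L})"
      by (rule DERIV_cmult_right[OF ch[OF f2[OF S[OF t]]]])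
    show "f1 (?g t) * \<sigma> \<noteq> 0" by (rule nz1[OF t])
  next
    have "continuous_on {0<..L} (\<lambda>t. f2 (?g t))"
      by (rule continuous_on_compose2[OF cf2 _ im]) (intro continuous_intros)
    then show "continuous_on {0<..L} (\<lambda>t. f2 (?g t) * \<sigma> * \<sigma>)" by (intro continuous_intros)
  next
    fix t
    show "((\<lambda>t. \<phi> (?g t)) has_real_derivative \<phi>1 (?g t) * \<sigma>) (at t)" by (rule chp[OF p(1)])
    show "((\<lambda>t. \<phi>1 (?g t) * \<sigma>) has_real_derivative \<phi>2 (?g t) * \<sigma> * \<sigma>) (at t)"
      by (rule DERIV_cmult_right[OF chp[OF p(2)]])
    show "\<phi>1 (?g t) * \<sigma> \<noteq> 0" using p(4)[of "?g t"] \<sigma> by auto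
  next
    have "continuous_on UNIV (\<lambda>t. \<phi>2 (?g t))"
      by (rule continuous_on_compose2[OF p(3)]) (auto intro!: continuous_intros)
    then show "continuous_on UNIV (\<lambda>t. \<phi>2 (?g t) * \<sigma> * \<sigma>)" by (intro continuous_intros)
  next
    fix y show "inv \<psi> (\<psi> y) = y" using b by (simp add: bij_is_inj)
  next
    show "continuous_on UNIV \<psi>" using ps by (rule DERIV_continuous_on)
  next
    fix t assume t: "0 \<le> t" "t < \<epsilon>" "t \<le> L"
    have "?g t \<in> U" using e(2) t \<sigma> by (auto simp: dist_real_def subset_iff)
    then show "\<bar>\<psi> (f (?g t))\<bar> = \<bar>\<phi> (?g t)\<bar> powr l" using nf t by blast
  qed (use L l q z e in auto)
qed

text \<open>Both sides of \<open>c\<close> are strictly monotone. If they have the same direction, the map is monotone on the whole interval; if \<open>c\<close> is a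
minimum, conjugating by \<open>x \<mapsto> 1 - x\<close> exchanges the two sides and turns it into a maximum.\<close>

theorem mainTheorem1:
  fixes f :: "real \<Rightarrow> real"
  assumes "f \<in> unimodal_maps 2"
  shows "\<not> (\<exists>J. wandering_interval f J)"
proof
  assume "\<exists>J. wandering_interval f J"
  then obtain J where J: "is_interval J" "\<exists>a\<in>J. \<exists>b\<in>J. a < b" "J \<subseteq> {0..1}" "disjoint_family (\<lambda>n. (f ^^ n) ` J)"
    "\<And>x. x \<in> J \<Longrightarrow> \<not> periodic_orbit f (omega_limit f x)" unfolding wandering_interval_def by blast
  from J(2) obtain a b where ab: "a \<in> J" "b \<in> J" "a < b" by blast
  have sub: "{a..b} \<subseteq> J" using mem_is_interval_1_I[OF J(1) ab(1,2)] by auto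
  have ab01: "0 \<le> a" "b \<le> 1" using ab J(3) by auto
  have dj: "(f ^^ m) ` {a..b} \<inter> (f ^^ n) ` {a..b} = {}" if "m \<noteq> n" for m n
  proof -
    have "(f ^^ m) ` J \<inter> (f ^^ n) ` J = {}" using J(4) that by (simp add: disjoint_family_on_def)
    then show ?thesis using image_mono[OF sub, of "f ^^ m"] image_mono[OF sub, of "f ^^ n"] by blast
  qed
  obtain c lm lp where ua: "unimodal_at 2 f c lm lp" using assms unfolding unimodal_maps_def by blast
  then have un: "f \<in> {0..1} \<rightarrow> {0..1}" "0 < c" "c < 1" "Cr_on 2 f ({0..1} - {c})"
      "\<forall>x\<in>{0..1} - {c}. \<exists>D. (f has_real_derivative D) (at x within {0..1} - {c}) \<and> D \<noteq> 0"
    and l: "1 \<le> lm" "1 \<le> lp" unfolding unimodal_at_def by blast+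
  from ua obtain U \<phi>m \<phi>p \<psi>m \<psi>p where B: "open U \<and> c \<in> U \<and>
        Cr_diffeo 2 \<phi>m \<and> Cr_diffeo 2 \<phi>p \<and> Cr_diffeo 2 \<psi>m \<and> Cr_diffeo 2 \<psi>p \<and>
        \<phi>m c = 0 \<and> \<phi>p c = 0 \<and> \<psi>m (f c) = 0 \<and> \<psi>p (f c) = 0 \<and>
        (\<forall>x\<in>U \<inter> {0..1}. x \<le> c \<longrightarrow> \<bar>\<psi>m (f x)\<bar> = \<bar>\<phi>m x\<bar> powr lm) \<and>
        (\<forall>x\<in>U \<inter> {0..1}. c \<le> x \<longrightarrow> \<bar>\<psi>p (f x)\<bar> = \<bar>\<phi>p x\<bar> powr lp)"
    unfolding unimodal_at_def by blast
  have U: "open U" "c \<in> U"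
    and df: "Cr_diffeo 2 \<phi>m" "Cr_diffeo 2 \<phi>p" "Cr_diffeo 2 \<psi>m" "Cr_diffeo 2 \<psi>p"
    and z: "\<phi>m c = 0" "\<phi>p c = 0" "\<psi>m (f c) = 0" "\<psi>p (f c) = 0"
    and nf: "\<forall>x\<in>U \<inter> {0..1}. x \<le> c \<longrightarrow> \<bar>\<psi>m (f x)\<bar> = \<bar>\<phi>m x\<bar> powr lm"
      "\<forall>x\<in>U \<inter> {0..1}. c \<le> x \<longrightarrow> \<bar>\<psi>p (f x)\<bar> = \<bar>\<phi>p x\<bar> powr lp"
    using B by simp_all
  have c1: "0 < 1 - c" using un(3) by simp
  have sp: "side_ok (\<lambda>t. f (c + t)) (1 - c) lp"
    using side_ok_of_branch[of 1 "1 - c" lp c "{0..1} - {c}" f U \<phi>p \<psi>p] c1 un l U df z nf(2) by simp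
  have sm: "side_ok (\<lambda>t. f (c - t)) c lm"
    using side_ok_of_branch[of "-1" c lm c "{0..1} - {c}" f U \<phi>m \<psi>m] un l U df z nf(1) by simp
  obtain sR :: real where sR: "sR = 1 \<or> sR = -1" "\<And>x y. 0 \<le> x \<Longrightarrow> x < y \<Longrightarrow> y \<le> 1 - c \<Longrightarrow> sR * f (c + x) < sR * f (c + y)"
    by (rule side_monotone[OF sp c1 l(2)]) (rule that)
  obtain sL :: real where sL: "sL = 1 \<or> sL = -1" "\<And>x y. 0 \<le> x \<Longrightarrow> x < y \<Longrightarrow> y \<le> c \<Longrightarrow> sL * f (c - x) < sL * f (c - y)"
    by (rule side_monotone[OF sm un(2) l(1)]) (rule that)
  have R: "sR * f x < sR * f y" if "c \<le> x" "x < y" "y \<le> 1" for x y using sR(2)[of "x - c" "y - c"] that by simp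
  have Lf: "sL * f y < sL * f x" if "0 \<le> x" "x < y" "y \<le> c" for x y using sL(2)[of "c - y" "c - x"] that by simp
  have cont: "continuous_on {0..1} f"
  proof -
    have "continuous_on {0..1 - c} (\<lambda>t. f (c + t))" "continuous_on {0..c} (\<lambda>t. f (c - t))"
      using sp sm unfolding side_ok_def by blast+
    from continuous_on_compose2[OF this(1), of "{c..1}" "\<lambda>x. x - c"] continuous_on_compose2[OF this(2), of "{0..c}" "\<lambda>x. c - x"]
    have "continuous_on {c..1} f" "continuous_on {0..c} f" by (simp_all add: continuous_on_op_minus continuous_on_diff)
    then have "continuous_on ({0..c} \<union> {c..1}) f" by (intro continuous_on_closed_Un) auto
    moreover have "{0..c} \<union> {c..1} = {0..1}" using un by auto
    ultimately show ?thesis by simp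
  qed
  interpret sf: selfmap f by unfold_locales (use cont un in auto)
  have w: "sf.wild x" if "x \<in> {a..b}" for x
    using sf.wild_if_no_periodic_limit[of x] J(3,5) sub that by blast
  consider "sR = -1" "sL = -1" | "sR = 1" "sL = 1" | "sR = - sL" using sR(1) sL(1) by fastforce
  then show False
  proof cases
    case 1
    interpret fold f c
      by unfold_locales (use un R Lf 1 in auto)
    show False by (rule no_wild_interval[OF sp sm l ab01(1) ab(3) ab01(2) w dj])
  next
    case 2
    define g where "g x = 1 - f (1 - x)" for x
    have gn: "(g ^^ n) x = 1 - (f ^^ n) (1 - x)" for n x by (induction n) (auto simp: g_def)
    interpret g: fold g "1 - c"
    proof unfold_locales
      show "continuous_on {0..1} g" unfolding g_def
        by (intro continuous_intros continuous_on_compose2[OF cont]) auto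
    qed (use un R Lf 2 in \<open>auto simp: g_def Pi_iff\<close>)
    have gw: "g.wild x" if x: "x \<in> {1 - b..1 - a}" for x
    proof -
      have tame: False if r: "1 \<le> r" "p \<in> {0..1}" "(g ^^ r) p = p" "(\<lambda>k. (g ^^ (r * k)) x) \<longlonglongrightarrow> p" for r p
      proof -
        have "(\<lambda>k. 1 - (1 - (f ^^ (r * k)) (1 - x))) \<longlonglongrightarrow> 1 - p"
          using tendsto_diff[OF tendsto_const r(4), of 1] by (simp add: gn)
        moreover have "(f ^^ r) (1 - p) = 1 - p" using r(3) by (simp add: gn)
        moreover have "sf.wild (1 - x)" using x by (intro w) auto
        ultimately show False using r(1,2) unfolding sf.wild_def by auto
      qed
      have "x \<in> {0..1}" using x ab01 by auto
      with tame show ?thesis unfolding g.wild_def by blast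
    qed
    have gi: "(g ^^ n) ` {1 - b..1 - a} = (\<lambda>u. 1 - u) ` (f ^^ n) ` {a..b}" for n
    proof -
      have e: "{a..b} = (\<lambda>u. 1 - u) ` {1 - b..1 - a}" by simp
      show ?thesis unfolding e image_image by (rule image_cong[OF refl gn])
    qed
    have gd: "(g ^^ m) ` {1 - b..1 - a} \<inter> (g ^^ n) ` {1 - b..1 - a} = {}" if "m \<noteq> n" for m n
    proof -
      have "inj (\<lambda>u::real. 1 - u)" by (rule injI) simp
      from image_Int[OF this, of "(f ^^ m) ` {a..b}" "(f ^^ n) ` {a..b}"]
      show ?thesis unfolding gi dj[OF that] by simp
    qed
    show False
    proof (rule g.no_wild_interval[OF _ _ l(2,1) _ _ _ gw gd])
      show "side_ok (\<lambda>t. g (1 - c + t)) (1 - (1 - c)) lm" using side_ok_reflect[OF sm] by (simp add: g_def algebra_simps)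
      show "side_ok (\<lambda>t. g (1 - c - t)) (1 - c) lp" using side_ok_reflect[OF sp] by (simp add: g_def algebra_simps)
    qed (use ab ab01 in auto)
  next
    case 3
    have s: "sR * f x \<le> sR * f y" if xy: "0 \<le> x" "x \<le> y" "y \<le> 1" for x y
    proof -
      have le: "sR * f u \<le> sR * f v" if "u \<le> v" "c \<le> u \<and> v \<le> 1 \<or> 0 \<le> u \<and> v \<le> c" for u v
        using R[of u v] Lf[of u v] 3 that by (cases "u = v") auto
      show ?thesis
      proof (cases "c \<le> x \<or> y \<le> c")
        case True then show ?thesis using le[of x y] xy by auto
      next
        case False then show ?thesis using le[of x c] le[of c y] xy by auto
      qed
    qed
    have "(\<forall>x y. 0 \<le> x \<longrightarrow> x \<le> y \<longrightarrow> y \<le> 1 \<longrightarrow> f x \<le> f y) \<or> (\<forall>x y. 0 \<le> x \<longrightarrow> x \<le> y \<longrightarrow> y \<le> 1 \<longrightarrow> f y \<le> f x)"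
      using sR(1)
    proof
      assume "sR = 1" then show ?thesis using s by simp
    next
      assume "sR = -1" then show ?thesis using s by simp
    qed
    then show False using sf.monotone_not_wild w[of a] ab by auto
  qed
qed

end
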